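(* Let $\Omega\subset\mathbb{R}^n$ be a bounded Lipschitz domain, let $I\subset\mathbb{R}$ be a bounded interval, let $r_0=\min\{|I|^{1/2},\mathrm{diam}(\Omega)\}$ and let $0<\beta\leq1$. Suppose that $u=u(t,x)\in L^2(I\times\Omega)$. Then: (1) $u\in C^{\beta/2,\beta}_{t,x}(\overline{I\times\Omega})$ if and only if there is a constant $C>0$ such that $$\inf_{c\in\mathbb{R}}\frac{1}{|Q_r(t,x)\cap(I\times\Omega)|}\int_{Q_r(t,x)\cap(I\times\Omega)}|u(\tau,z)-c|^2\,d\tau\,dz\leq Cr^{2\beta}$$ for all $(t,x)\in\overline{I\times\Omega}$ and $0<r\leq r_0$. In this case, if $C_\ast$ denotes the least constant for which this inequality holds, then $\|u\|^2_{L^2(I\times\Omega)}+C_\ast$ is equivalent to $\|u\|_{C^{\beta/2,\beta}_{t,x}(\overline{I\times\Omega})}^2$. (2) $u\in C^{(1+\beta)/2,1+\beta}_{t,x}(\overline{I\times\Omega})$ if and only if there is a constant $C>0$ such that $$\inf_{P\in\mathcal{P}_1}\frac{1}{|Q_r(t,x)\cap(I\times\Omega)|}\int_{Q_r(t,x)\cap(I\times\Omega)}|u(\tau,z)-P(z)|^2\,d\tau\,dz\leq Cr^{2(1+\beta)}$$ for all $(t,x)\in\overline{I\times\Omega}$ and $0<r\leq r_0$. In this case, if $C_{\ast\ast}$ denotes the least constant for which this inequality holds, then $\|u\|^2_{L^2(I\times\Omega)}+C_{\ast\ast}$ is equivalent to $\|u\|_{C^{(1+\beta)/2,1+\beta}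_{t,x}(\overline{I\times\Omega})}^2$.
   Context: $Q_r(t,x)=(t-r^2,t+r^2)\times B_r(x)\subset\mathbb{R}\times\mathbb{R}^n$. $\mathcal{P}_1=\{P(z)=A_0+A_1\cdot z:A_0\in\mathbb{R},A_1\in\mathbb{R}^n\}$ (polynomials in the space variable only). Membership of $u\in L^2$ in a Hölder space is understood after modification on a null set, and equivalence of the quantities is up to multiplicative constants independent of $u$. $C^{\beta/2,\beta}_{t,x}(\overline{I\times\Omega})$ is the set of continuous $u:\overline{I\times\Omega}\to\mathbb{R}$ with finite norm $\|u\|_{L^\infty(I\times\Omega)}+\sup_{t,\tau\in I,\,x,z\in\Omega}\frac{|u(t,x)-u(\tau,z)|}{\max(|t-\tau|^{1/2},|x-z|)^\beta}$. $C^{(1+\beta)/2,1+\beta}_{t,x}(\overline{I\times\Omega})$ is the set of continuous $u:\overline{I\times\Omega}\to\mathbb{R}$ with $\nabla_xu\in C(\overline{I\times\Omega})$ and finite norm $$\|u\|_{L^\infty(I\times\Omega)}+\|\nabla_xu\|_{L^\infty(I\times\Omega)}+\sup_{x\in\Omega}\sup_{t,\tau\in I}\frac{|u(t,x)-u(\tau,x)|}{|t-\tau|^{(1+\beta)/2}}+\sup_{t,\tau\in I,\,x,z\in\Omega}\frac{|\nabla_xu(t,x)-\nabla_xu(\tau,z)|}{\max(|t-\tau|^{1/2},|x-z|)^\beta}.$$ *)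

theory Defs
  imports "HOL-Analysis.Analysis" "HOL-Probability.Essential_Supremum"
begin

text \<open>
  A Lipschitz domain: near every boundary point, and in coordinates adapted to some unit vector
  \<open>e\<close> (the last coordinate being \<open>x \<bullet> e\<close>), the set is the region strictly above the graph of a
  Lipschitz function of the remaining coordinates. These are represented by the orthogonal
  projection of \<open>x\<close> to the hyperplane orthogonal to \<open>e\<close>. The vector, function, Lipschitz constant
  and radius may all depend on the boundary point.
\<close>

definition lipschitz_domain :: "'a::euclidean_space set \<Rightarrow> bool" where
  "lipschitz_domain \<Omega> \<longleftrightarrow>
     \<Omega> \<noteq> {} \<and> open \<Omega> \<and> connected \<Omega> \<and>
     (\<forall>p\<in>frontier \<Omega>. \<exists>\<rho>>0. \<exists>e L. \<exists>\<phi>::'a \<Rightarrow> real.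
        norm e = 1 \<and> L-lipschitz_on {y. y \<bullet> e = 0} \<phi> \<and>
        \<Omega> \<inter> ball p \<rho> = {x \<in> ball p \<rho>. \<phi> (x - (x \<bullet> e) *\<^sub>R e) < x \<bullet> e})"

definition parabolic_cylinder :: "real \<Rightarrow> real \<times> 'a::euclidean_space \<Rightarrow> (real \<times> 'a) set" where
  "parabolic_cylinder r = (\<lambda>(t, x). {t - r\<^sup>2 <..< t + r\<^sup>2} \<times> ball x r)"

definition parabolic_dist :: "real \<times> 'a::euclidean_space \<Rightarrow> real \<times> 'a \<Rightarrow> real" where
  "parabolic_dist = (\<lambda>(t, x) (\<tau>, z). max (\<bar>t - \<tau>\<bar> powr (1/2)) (norm (x - z)))"

definition constant_polys :: "('a::euclidean_space \<Rightarrow> real) set" where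
  "constant_polys = {(\<lambda>z. c) | c. True}"

definition affine_polys :: "('a::euclidean_space \<Rightarrow> real) set" where
  "affine_polys = {(\<lambda>z. A0 + A1 \<bullet> z) | A0 A1. True}"

definition square_integrable :: "(real \<times> 'a::euclidean_space) set \<Rightarrow> (real \<times> 'a \<Rightarrow> real) \<Rightarrow> bool" where
  "square_integrable S u \<longleftrightarrow>
     u \<in> borel_measurable (lebesgue_on S) \<and> integrable (lebesgue_on S) (\<lambda>p. (u p)\<^sup>2)"

definition L2_norm_sq :: "(real \<times> 'a::euclidean_space) set \<Rightarrow> (real \<times> 'a \<Rightarrow> real) \<Rightarrow> real" where
  "L2_norm_sq S u = integral\<^sup>L (lebesgue_on S) (\<lambda>p. (u p)\<^sup>2)"

definition Linf_norm ::
  "(real \<times> 'a::euclidean_space) set \<Rightarrow> (real \<times> 'a \<Rightarrow> 'b::real_normed_vector) \<Rightarrow> ereal" where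
  "Linf_norm S f = esssup (lebesgue_on S) (\<lambda>p. ereal (norm (f p)))"

definition mean_sq_excess ::
  "('a::euclidean_space \<Rightarrow> real) set \<Rightarrow> (real \<times> 'a) set \<Rightarrow> (real \<times> 'a \<Rightarrow> real) \<Rightarrow> real \<Rightarrow> real \<times> 'a \<Rightarrow> real"
where
  "mean_sq_excess \<P> S u r p =
     (INF P\<in>\<P>. 1 / measure lebesgue (parabolic_cylinder r p \<inter> S) *
        integral\<^sup>L (lebesgue_on (parabolic_cylinder r p \<inter> S)) (\<lambda>(\<tau>, z). (u (\<tau>, z) - P z)\<^sup>2))"

definition campanato_bound ::
  "('a::euclidean_space \<Rightarrow> real) set \<Rightarrow> real \<Rightarrow> real \<Rightarrow> (real \<times> 'a) set \<Rightarrow> (real \<times> 'a \<Rightarrow> real) \<Rightarrow> real \<Rightarrow> bool"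
where
  "campanato_bound \<P> \<gamma> r0 S u C \<longleftrightarrow>
     (\<forall>p\<in>closure S. \<forall>r. 0 < r \<and> r \<le> r0 \<longrightarrow> mean_sq_excess \<P> S u r p \<le> C * r powr (2 * \<gamma>))"

text \<open>
  The norms below take values in the extended reals, so that ``finite norm'' is a condition.
  Because \<open>a / 0 = 0\<close>, coinciding points do not contribute to the suprema of the difference quotients.
\<close>

definition holder_norm ::
  "real \<Rightarrow> real set \<Rightarrow> 'a::euclidean_space set \<Rightarrow> (real \<times> 'a \<Rightarrow> real) \<Rightarrow> ereal" where
  "holder_norm \<beta> I \<Omega> u =
     Linf_norm (I \<times> \<Omega>) u +
     (SUP p\<in>I \<times> \<Omega>. SUP q\<in>I \<times> \<Omega>. ereal (\<bar>u p - u q\<bar> / parabolic_dist p q powr \<beta>))"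

definition holder_space ::
  "real \<Rightarrow> real set \<Rightarrow> 'a::euclidean_space set \<Rightarrow> (real \<times> 'a \<Rightarrow> real) set" where
  "holder_space \<beta> I \<Omega> =
     {u. continuous_on (closure (I \<times> \<Omega>)) u \<and> holder_norm \<beta> I \<Omega> u < \<infinity>}"

definition space_gradient :: "(real \<times> 'a::euclidean_space \<Rightarrow> real) \<Rightarrow> real \<times> 'a \<Rightarrow> 'a" where
  "space_gradient u = (\<lambda>(t, x). THE D. GDERIV (\<lambda>y. u (t, y)) x :> D)"

definition holder1_norm ::
  "real \<Rightarrow> real set \<Rightarrow> 'a::euclidean_space set \<Rightarrow> (real \<times> 'a \<Rightarrow> real) \<Rightarrow> ereal" where
  "holder1_norm \<beta> I \<Omega> u =
     Linf_norm (I \<times> \<Omega>) u + Linf_norm (I \<times> \<Omega>) (space_gradient u) +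
     (SUP x\<in>\<Omega>. SUP t\<in>I. SUP \<tau>\<in>I. ereal (\<bar>u (t, x) - u (\<tau>, x)\<bar> / \<bar>t - \<tau>\<bar> powr ((1 + \<beta>) / 2))) +
     (SUP p\<in>I \<times> \<Omega>. SUP q\<in>I \<times> \<Omega>.
        ereal (norm (space_gradient u p - space_gradient u q) / parabolic_dist p q powr \<beta>))"

text \<open>
  The spatial gradient exists on \<open>I \<times> \<Omega>\<close>; that it belongs to \<open>C(closure (I \<times> \<Omega>))\<close> means that it
  has a continuous extension to the closure.
\<close>

definition holder1_space ::
  "real \<Rightarrow> real set \<Rightarrow> 'a::euclidean_space set \<Rightarrow> (real \<times> 'a \<Rightarrow> real) set" where
  "holder1_space \<beta> I \<Omega> =
     {u. continuous_on (closure (I \<times> \<Omega>)) u \<and>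
         (\<forall>t\<in>I. \<forall>x\<in>\<Omega>. \<exists>D. GDERIV (\<lambda>y. u (t, y)) x :> D) \<and>
         (\<exists>G. continuous_on (closure (I \<times> \<Omega>)) G \<and> (\<forall>p\<in>I \<times> \<Omega>. G p = space_gradient u p)) \<and>
         holder1_norm \<beta> I \<Omega> u < \<infinity>}"

definition ae_equal_on ::
  "(real \<times> 'a::euclidean_space) set \<Rightarrow> (real \<times> 'a \<Rightarrow> real) \<Rightarrow> (real \<times> 'a \<Rightarrow> real) \<Rightarrow> bool" where
  "ae_equal_on S u v \<longleftrightarrow> (AE p in lebesgue_on S. u p = v p)"

end

theory Submission
  imports Defs
begin

text \<open>
  Each of the two equivalences has an easy and a hard half. If \<open>u\<close> is regular, then its value at a
  point of the cylinder, respectively its spatial Taylor polynomial there, is an admissible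
  competitor in the infimum. For gradients this requires integrating along paths: \<open>\<Omega>\<close> need not be convex,
  but two points at a small distance \<open>r\<close> can be joined inside \<open>\<Omega>\<close> by three segments of length
  comparable with \<open>r\<close> (\<open>short_path_taylor\<close>). At the scales that are not small, the zero polynomial
  is good enough.

  The hard half is Campanato's iteration on the cylinders with radii \<open>r0 / 2 ^ k\<close>. The only geometric
  input is that a cylinder around a point of the closure, intersected with \<open>I \<times> \<Omega>\<close>, contains a box of
  comparable size (\<open>cylinder_interior_box\<close>). On such a set the mean square of an affine function
  controls its value and, weighted with the radius, its slope (\<open>affine_coefficients_le\<close>). Hence almost
  optimal polynomials on overlapping cylinders of comparable size have nearby coefficients
  (\<open>fits_compare\<close>): the values differ by \<open>O(r powr \<gamma>)\<close>, the slopes by \<open>O(r powr (\<gamma> - 1))\<close>. Along the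
  dyadic radii the differences form geometric series, so values and slopes converge at each point
  to limits \<open>v\<close> and \<open>G\<close>. Comparing the cylinders around two points at a scale given by their
  parabolic distance \<open>d\<close> yields \<open>v q - v p - G p \<bullet> (z - x) = O(d powr \<gamma>)\<close> and
  \<open>G q - G p = O(d powr (\<gamma> - 1))\<close> (\<open>taylor\<close>, \<open>G_holder\<close>), where \<open>x\<close> and \<open>z\<close> are the spatial parts of
  \<open>p\<close> and \<open>q\<close>. For points at the same time this says that \<open>G\<close> is the spatial gradient of \<open>v\<close>; for
  points at the same place it is the regularity in time. For constants, \<open>\<gamma> = \<beta>\<close> and \<open>G = 0\<close>.

  That \<open>v\<close> represents \<open>u\<close> follows from a covering: on cylinders of radius \<open>r\<close> the mean square of
  \<open>u - v\<close> is \<open>O(r powr (2 * \<gamma>))\<close>, and \<open>I \<times> \<Omega>\<close> is covered by such cylinders with bounded total measure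
  (\<open>ae_zero_if_small_on_cylinders\<close>). Two continuous representatives agree everywhere on \<open>I \<times> \<Omega>\<close>, so
  every estimate for the constructed one holds for a given one; \<open>campanato_equivalence\<close> turns the
  estimates of both halves into the comparison of the norms.
\<close>

section \<open>Interior balls and short paths in Lipschitz domains\<close>

text \<open>
  The function \<open>h\<close> is the height above the graph. It is Lipschitz on the whole space because the
  orthogonal projection to the hyperplane is a contraction, and it grows with unit speed in the
  direction \<open>e\<close>. An interior point has such a chart as well, with an affine \<open>h\<close> that is positive on
  the ball, so that all points of the closure can be treated alike.
\<close>

lemma lipschitz_domain_chart:
  fixes \<Omega> :: "'a::euclidean_space set"
  assumes "lipschitz_domain \<Omega>" and "p \<in> closure \<Omega>"
  obtains \<rho> M e h where "\<rho> > 0" "M \<ge> 1" "norm e = 1" "M-lipschitz_on UNIV h"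
    "\<And>x s. h (x + s *\<^sub>R e) = h x + s" "\<Omega> \<inter> ball p \<rho> = {x \<in> ball p \<rho>. 0 < (h x::real)}"
proof (cases "p \<in> frontier \<Omega>")
  case True
  then obtain \<rho> e L and \<phi> :: "'a \<Rightarrow> real" where *: "\<rho> > 0" "norm e = 1"
      "L-lipschitz_on {y. y \<bullet> e = 0} \<phi>"
      "\<Omega> \<inter> ball p \<rho> = {x \<in> ball p \<rho>. \<phi> (x - (x \<bullet> e) *\<^sub>R e) < x \<bullet> e}"
    using assms(1) unfolding lipschitz_domain_def by meson
  define \<pi> where "\<pi> = (\<lambda>x. x - (x \<bullet> e) *\<^sub>R e)"
  define h where "h = (\<lambda>x. x \<bullet> e - \<phi> (\<pi> x))"
  have ee: "e \<bullet> e = 1" using *(2) by (simp add: norm_eq_1)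
  have L: "L \<ge> 0" using *(3) by (rule lipschitz_on_nonneg)
  have \<pi>0: "\<pi> x \<bullet> e = 0" for x by (simp add: \<pi>_def inner_diff_left ee)
  have \<pi>n: "norm (\<pi> x) \<le> norm x" for x
  proof -
    have "(norm (\<pi> x))\<^sup>2 = x \<bullet> x - (x \<bullet> e)\<^sup>2"
      unfolding power2_norm_eq_inner
      by (simp add: \<pi>_def inner_diff_left inner_diff_right ee inner_commute power2_eq_square)
    also have "\<dots> \<le> (norm x)\<^sup>2" by (simp add: power2_norm_eq_inner)
    finally show ?thesis by simp
  qed
  have \<pi>d: "\<pi> x - \<pi> y = \<pi> (x - y)" for x y
    by (simp add: \<pi>_def inner_diff_left algebra_simps)
  have "\<bar>h x - h y\<bar> \<le> (1 + L) * norm (x - y)" for x y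
  proof -
    have "\<bar>\<phi> (\<pi> x) - \<phi> (\<pi> y)\<bar> \<le> L * norm (\<pi> x - \<pi> y)"
      using lipschitz_onD[OF *(3), of "\<pi> x" "\<pi> y"] \<pi>0 by (simp add: dist_norm)
    also have "\<dots> \<le> L * norm (x - y)" unfolding \<pi>d by (intro mult_left_mono \<pi>n L)
    finally have 1: "\<bar>\<phi> (\<pi> x) - \<phi> (\<pi> y)\<bar> \<le> L * norm (x - y)" .
    have "\<bar>(x - y) \<bullet> e\<bar> \<le> norm (x - y)"
      using Cauchy_Schwarz_ineq2[of "x - y" e] *(2) by simp
    with 1 show ?thesis unfolding h_def by (simp add: inner_diff_left algebra_simps)
  qed
  then have "(1 + L)-lipschitz_on UNIV h"
    using L by (auto intro!: lipschitz_onI simp: dist_norm)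
  moreover have "h (x + s *\<^sub>R e) = h x + s" for x s
    by (simp add: h_def \<pi>_def inner_add_left ee algebra_simps)
  moreover have "\<Omega> \<inter> ball p \<rho> = {x \<in> ball p \<rho>. 0 < h x}"
    using *(4) by (auto simp: h_def \<pi>_def)
  ultimately show ?thesis using * L by (intro that[of \<rho> "1 + L" e h]) auto
next
  case False
  moreover have "open \<Omega>" using assms(1) by (simp add: lipschitz_domain_def)
  ultimately have "p \<in> \<Omega>" using assms(2) by (simp add: frontier_def interior_open)
  then obtain \<rho> where \<rho>: "\<rho> > 0" "ball p \<rho> \<subseteq> \<Omega>" using \<open>open \<Omega>\<close> openE by blast
  obtain e :: 'a where e: "norm e = 1" using vector_choose_size[of 1] by auto
  define h where "h = (\<lambda>x. \<rho> + (x - p) \<bullet> e)"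
  have ee: "e \<bullet> e = 1" using e by (simp add: norm_eq_1)
  have bd: "\<bar>z \<bullet> e\<bar> \<le> norm z" for z
    using Cauchy_Schwarz_ineq2[of z e] e by simp
  have "1-lipschitz_on UNIV h"
    using bd by (intro lipschitz_onI) (simp_all add: h_def dist_norm flip: inner_diff_left)
  moreover have "0 < h x" if "x \<in> ball p \<rho>" for x
    using bd[of "x - p"] that by (auto simp: h_def dist_norm norm_minus_commute)
  ultimately show ?thesis using \<rho> e
    by (intro that[of \<rho> 1 e h]) (auto simp: h_def inner_diff_left inner_add_left ee)
qed

text \<open>
  In the next two definitions a single number bounds the scales and relates the radii. This makes
  both properties monotone in it, so that compactness yields one value for all points.
\<close>

definition interior_ball_upto :: "'a::euclidean_space set \<Rightarrow> real \<Rightarrow> 'a \<Rightarrow> bool" where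
  "interior_ball_upto \<Omega> \<epsilon> x \<longleftrightarrow>
     (\<forall>r. 0 < r \<and> r \<le> \<epsilon> \<longrightarrow> (\<exists>y. ball y (\<epsilon> * r) \<subseteq> \<Omega> \<inter> ball x r))"

definition short_paths_upto :: "'a::euclidean_space set \<Rightarrow> real \<Rightarrow> 'a \<Rightarrow> bool" where
  "short_paths_upto \<Omega> \<epsilon> x \<longleftrightarrow>
     (\<forall>r y z. 0 < r \<and> r \<le> \<epsilon> \<and> y \<in> \<Omega> \<inter> ball x r \<and> z \<in> \<Omega> \<inter> ball x r \<longrightarrow>
        (\<exists>a b. closed_segment y a \<union> closed_segment a b \<union> closed_segment b z \<subseteq> \<Omega> \<inter> ball x (r / \<epsilon>)))"

lemma interior_ball_upto_mono:
  assumes "interior_ball_upto \<Omega> \<epsilon> x" "0 < \<epsilon>'" "\<epsilon>' \<le> \<epsilon>"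
  shows "interior_ball_upto \<Omega> \<epsilon>' x"
  unfolding interior_ball_upto_def
proof safe
  fix r assume r: "0 < r" "r \<le> \<epsilon>'"
  then obtain y where "ball y (\<epsilon> * r) \<subseteq> \<Omega> \<inter> ball x r"
    using assms unfolding interior_ball_upto_def by (meson order_trans)
  moreover have "ball y (\<epsilon>' * r) \<subseteq> ball y (\<epsilon> * r)"
    using assms r by (intro subset_ball mult_right_mono) auto
  ultimately show "\<exists>y. ball y (\<epsilon>' * r) \<subseteq> \<Omega> \<inter> ball x r" by blast
qed

lemma short_paths_upto_mono:
  assumes "short_paths_upto \<Omega> \<epsilon> x" "0 < \<epsilon>'" "\<epsilon>' \<le> \<epsilon>"
  shows "short_paths_upto \<Omega> \<epsilon>' x"
  unfolding short_paths_upto_def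
proof (intro allI impI)
  fix r y z assume *: "0 < r \<and> r \<le> \<epsilon>' \<and> y \<in> \<Omega> \<inter> ball x r \<and> z \<in> \<Omega> \<inter> ball x r"
  moreover have "r \<le> \<epsilon>" using * assms by linarith
  ultimately obtain a b where
    "closed_segment y a \<union> closed_segment a b \<union> closed_segment b z \<subseteq> \<Omega> \<inter> ball x (r / \<epsilon>)"
    using assms(1) unfolding short_paths_upto_def by metis
  moreover have "ball x (r / \<epsilon>) \<subseteq> ball x (r / \<epsilon>')"
    using assms * by (intro subset_ball divide_left_mono) auto
  ultimately show "\<exists>a b. closed_segment y a \<union> closed_segment a b \<union> closed_segment b z
      \<subseteq> \<Omega> \<inter> ball x (r / \<epsilon>')" by blast
qed

text \<open>
  Moving in the direction \<open>e\<close> of a chart by an amount comparable with \<open>r\<close> leads from anywhere in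
  \<open>closure \<Omega> \<inter> ball x r\<close> to a height at which the Lipschitz function \<open>h\<close> stays positive on a ball of
  comparable radius. This gives the interior ball, and also the paths, which go up, across and down.
\<close>

lemma lipschitz_domain_local_geometry:
  fixes \<Omega> :: "'a::euclidean_space set"
  assumes "lipschitz_domain \<Omega>" and "p \<in> closure \<Omega>"
  shows "\<exists>\<epsilon>>0. \<forall>x\<in>closure \<Omega> \<inter> ball p \<epsilon>. interior_ball_upto \<Omega> \<epsilon> x \<and> short_paths_upto \<Omega> \<epsilon> x"
proof -
  obtain \<rho> M e h where
    \<rho>: "\<rho> > 0" and M: "M \<ge> 1" and e: "norm e = 1" and lip: "M-lipschitz_on UNIV h"
    and shift: "\<And>x s. h (x + s *\<^sub>R e) = h x + s"
    and \<Omega>: "\<Omega> \<inter> ball p \<rho> = {x \<in> ball p \<rho>. 0 < (h x::real)}"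
    using lipschitz_domain_chart[OF assms] by blast
  have lipD: "h y \<ge> h x - M * dist x y" for x y
    using lipschitz_onD[OF lip UNIV_I UNIV_I, of x y] unfolding dist_real_def by linarith
  have iff: "y \<in> \<Omega> \<longleftrightarrow> h y > 0" if "dist p y < \<rho>" for y
  proof -
    have "y \<in> \<Omega> \<inter> ball p \<rho> \<longleftrightarrow> y \<in> {x \<in> ball p \<rho>. 0 < h x}" by (simp only: \<Omega>)
    then show ?thesis using that by simp
  qed
  have in\<Omega>: "y \<in> \<Omega>" if "dist p y < \<rho>" "h y > 0" for y
    using iff that by blast
  have pos: "h y > 0" if "dist p y < \<rho>" "y \<in> \<Omega>" for y
    using iff that by blast
  have nonneg: "h x \<ge> 0" if x: "x \<in> closure \<Omega>" "dist p x < \<rho>" for x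
  proof (rule ccontr)
    assume neg: "\<not> h x \<ge> 0"
    define \<delta> where "\<delta> = min (\<rho> - dist p x) (- h x / M)"
    have "\<delta> > 0" using neg x M by (simp add: \<delta>_def divide_neg_pos)
    then obtain y where y: "y \<in> \<Omega>" "dist y x < \<delta>" using x(1) unfolding closure_approachable by blast
    have "dist y x < \<rho> - dist p x" using y by (simp add: \<delta>_def)
    then have "dist p y < \<rho>" using dist_triangle[of p y x] dist_commute[of x y] by linarith
    then have "0 < h y" using y(1) by (rule pos)
    have "dist y x < - h x / M" using y by (simp add: \<delta>_def)
    then have "M * dist y x < M * (- h x / M)" using M by (intro mult_strict_left_mono) auto
    then have "M * dist y x < - h x" using M by simp
    with \<open>0 < h y\<close> show False using lipD[of y x] by linarith
  qed
  \<comment> \<open>the first two bounds keep all points inside the chart, the third one is for the ratio of the radii\<close>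
  define \<epsilon> where "\<epsilon> = min (\<rho> / 2) (min (\<rho> / (2 + 4 * M)) (1 / (2 + 2 * M)))"
  have \<epsilon>: "\<epsilon> > 0" "\<epsilon> \<le> \<rho> / 2" "\<epsilon> * (2 + 4 * M) \<le> \<rho>" "\<epsilon> * (2 + 2 * M) \<le> 1"
  proof -
    show "\<epsilon> > 0" using \<rho> M by (simp add: \<epsilon>_def)
    show "\<epsilon> \<le> \<rho> / 2" unfolding \<epsilon>_def by (rule min.cobounded1)
    have "\<epsilon> \<le> \<rho> / (2 + 4 * M)" "\<epsilon> \<le> 1 / (2 + 2 * M)"
      unfolding \<epsilon>_def by (meson min.cobounded1 min.cobounded2 order_trans)+
    then show "\<epsilon> * (2 + 4 * M) \<le> \<rho>" "\<epsilon> * (2 + 2 * M) \<le> 1"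
      using M by (simp_all add: pos_le_divide_eq)
  qed
  have "interior_ball_upto \<Omega> \<epsilon> x" if x: "x \<in> closure \<Omega>" "dist p x < \<epsilon>" for x
    unfolding interior_ball_upto_def
  proof (intro allI impI)
    fix r assume "0 < r \<and> r \<le> \<epsilon>"
    then have r: "0 < r" "r \<le> \<epsilon>" by auto
    let ?y = "x + (r/2) *\<^sub>R e"
    have "w \<in> \<Omega> \<inter> ball x r" if "dist ?y w < \<epsilon> * r" for w
    proof -
      have d1: "dist x ?y = r / 2" using r e by (simp add: dist_norm)
      have "\<epsilon> * r * (2 + 2 * M) = r * (\<epsilon> * (2 + 2 * M))" by simp
      also have "\<dots> \<le> r * 1" using \<epsilon> r by (intro mult_left_mono) auto
      finally have er: "\<epsilon> * r + M * (\<epsilon> * r) \<le> r / 2" by (simp add: algebra_simps)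
      have "M * dist ?y w \<le> M * (\<epsilon> * r)" using that M by (intro mult_left_mono) auto
      moreover have "0 < \<epsilon> * r" "0 < M * (\<epsilon> * r)" using \<epsilon> r M by auto
      ultimately have small: "dist ?y w < r / 2" "M * dist ?y w < r / 2" using that er by auto
      have dxw: "dist x w < r" using d1 small dist_triangle[of x w ?y] by linarith
      then have "dist p w < \<rho>" using x(2) r \<epsilon>(2) dist_triangle[of p w x] by linarith
      moreover have "h x \<ge> 0" using nonneg[OF x(1)] x(2) \<epsilon>(2) \<rho> by linarith
      then have "h ?y \<ge> r / 2" by (simp add: shift)
      then have "h w > 0" using lipD[of ?y w] small by linarith
      ultimately show ?thesis using in\<Omega> dxw by auto
    qed
    then show "\<exists>y. ball y (\<epsilon> * r) \<subseteq> \<Omega> \<inter> ball x r" by (intro exI[of _ ?y]) auto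
  qed
  moreover have "short_paths_upto \<Omega> \<epsilon> x" if x: "dist p x < \<epsilon>" for x
    unfolding short_paths_upto_def
  proof (intro allI impI)
    fix r y z assume *: "0 < r \<and> r \<le> \<epsilon> \<and> y \<in> \<Omega> \<inter> ball x r \<and> z \<in> \<Omega> \<inter> ball x r"
    then have r: "0 < r" "r \<le> \<epsilon>" and y: "y \<in> \<Omega>" "dist x y < r" and z: "z \<in> \<Omega>" "dist x z < r" by auto
    \<comment> \<open>on the way across, the height drops by less than \<open>s\<close>\<close>
    define s where "s = 2 * M * r"
    define R where "R = r + s"
    have s: "s > 0" using M r by (simp add: s_def)
    have "M * r \<le> M * \<epsilon>" "r \<le> \<epsilon>" using M r by auto
    then have "2 * R \<le> \<epsilon> * (2 + 4 * M)" by (simp add: R_def s_def algebra_simps)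
    then have "R \<le> \<rho> / 2" using \<epsilon> by linarith
    then have cyl: "dist p w < \<rho>" if "dist x w < R" for w
      using that x \<epsilon>(2) dist_triangle[of p w x] by linarith
    have "\<epsilon> * R = r * (\<epsilon> * (1 + 2 * M))" by (simp add: R_def s_def algebra_simps)
    also have "\<dots> \<le> r * (\<epsilon> * (2 + 2 * M))" using \<epsilon>(1) r by (intro mult_left_mono) auto
    also have "\<dots> \<le> r * 1" using \<epsilon>(4) r by (intro mult_left_mono) auto
    finally have "\<epsilon> * R \<le> r" by simp
    then have R: "R \<le> r / \<epsilon>" using \<epsilon>(1) by (simp add: pos_le_divide_eq mult.commute)
    have seg: "closed_segment a b \<subseteq> \<Omega> \<inter> ball x (r / \<epsilon>)"
      if "dist x a < R" "dist x b < R" "\<And>w. w \<in> closed_segment a b \<Longrightarrow> h w > 0" for a b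
    proof
      fix w assume w: "w \<in> closed_segment a b"
      have "closed_segment a b \<subseteq> ball x R"
        using that(1,2) by (intro closed_segment_subset) auto
      then have "dist x w < R" using w by auto
      then show "w \<in> \<Omega> \<inter> ball x (r / \<epsilon>)" using in\<Omega> cyl that(3) w R by auto
    qed
    have far: "dist x (w + s *\<^sub>R e) < R" if "dist x w < r" for w
    proof -
      have "dist w (w + s *\<^sub>R e) = s" using s e by (simp add: dist_norm)
      then show ?thesis using that dist_triangle[of x "w + s *\<^sub>R e" w] by (auto simp: R_def)
    qed
    have near: "dist x w < R" if "dist x w < r" for w using that s by (auto simp: R_def)
    have up: "h w > 0" if w: "w \<in> closed_segment v (v + s *\<^sub>R e)" and v: "v \<in> \<Omega>" "dist x v < r" for v w
    proof -
      obtain t where t: "0 \<le> t" "t \<le> 1" "w = (1 - t) *\<^sub>R v + t *\<^sub>R (v + s *\<^sub>R e)"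
        using w unfolding in_segment by auto
      then have "w = v + (t * s) *\<^sub>R e" by (simp add: algebra_simps)
      then have "h w = h v + t * s" by (simp add: shift)
      moreover have "h v > 0" using pos v cyl near by blast
      ultimately show ?thesis using t s by (simp add: add_pos_nonneg)
    qed
    have across: "h w > 0" if w: "w \<in> closed_segment (y + s *\<^sub>R e) (z + s *\<^sub>R e)" for w
    proof -
      have "dist (y + s *\<^sub>R e) w \<le> dist (y + s *\<^sub>R e) (z + s *\<^sub>R e)"
        using w dist_in_closed_segment by (metis dist_commute)
      also have "\<dots> = dist y z" by (simp add: dist_norm)
      also have "\<dots> < 2 * r" using y z dist_triangle[of y z x] by (simp add: dist_commute)
      finally have "M * dist (y + s *\<^sub>R e) w < s" using M by (simp add: s_def)
      moreover have "h y > 0" using pos y cyl near by blast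
      ultimately show ?thesis using lipD[of "y + s *\<^sub>R e" w] by (simp add: shift)
    qed
    have 1: "closed_segment y (y + s *\<^sub>R e) \<subseteq> \<Omega> \<inter> ball x (r / \<epsilon>)"
      using y by (intro seg near far up[of _ y]) auto
    have 2: "closed_segment (z + s *\<^sub>R e) z \<subseteq> \<Omega> \<inter> ball x (r / \<epsilon>)"
      using z by (intro seg near far up[of _ z]) (auto simp: closed_segment_commute)
    have 3: "closed_segment (y + s *\<^sub>R e) (z + s *\<^sub>R e) \<subseteq> \<Omega> \<inter> ball x (r / \<epsilon>)"
      using y z by (intro seg far across) auto
    show "\<exists>a b. closed_segment y a \<union> closed_segment a b \<union> closed_segment b z \<subseteq> \<Omega> \<inter> ball x (r / \<epsilon>)"
      using 1 2 3 by blast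
  qed
  ultimately show ?thesis using \<epsilon>(1) by (intro exI[of _ \<epsilon>]) auto
qed

lemma compact_uniform_scale:
  fixes K :: "'a::metric_space set"
  assumes "compact K" and loc: "\<And>p. p \<in> K \<Longrightarrow> \<exists>\<epsilon>>0::real. \<forall>x\<in>K \<inter> ball p \<epsilon>. Q \<epsilon> x"
    and mono: "\<And>\<epsilon> \<epsilon>' x. Q \<epsilon> x \<Longrightarrow> 0 < \<epsilon>' \<Longrightarrow> \<epsilon>' \<le> \<epsilon> \<Longrightarrow> Q \<epsilon>' x"
  obtains \<epsilon> where "\<epsilon> > 0" "\<And>x. x \<in> K \<Longrightarrow> Q \<epsilon> x"
proof -
  obtain \<epsilon> where \<epsilon>: "\<And>p. p \<in> K \<Longrightarrow> \<epsilon> p > 0 \<and> (\<forall>x\<in>K \<inter> ball p (\<epsilon> p). Q (\<epsilon> p) x)"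
    using loc by metis
  have "K \<subseteq> (\<Union>p\<in>K. ball p (\<epsilon> p))" using \<epsilon> by auto
  then obtain F where F: "F \<subseteq> K" "finite F" "K \<subseteq> (\<Union>p\<in>F. ball p (\<epsilon> p))"
    using compactE_image[OF assms(1), of K "\<lambda>p. ball p (\<epsilon> p)"] by auto
  define \<delta> where "\<delta> = Min (insert 1 (\<epsilon> ` F))"
  have "\<delta> > 0" unfolding \<delta>_def using F \<epsilon> by (subst Min_gr_iff) auto
  moreover have "Q \<delta> x" if "x \<in> K" for x
  proof -
    obtain p where p: "p \<in> F" "x \<in> ball p (\<epsilon> p)" using F(3) \<open>x \<in> K\<close> by blast
    have "\<delta> \<le> \<epsilon> p" unfolding \<delta>_def using F p by (intro Min_le) auto
    moreover have "Q (\<epsilon> p) x" using \<epsilon> F p that by auto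
    ultimately show ?thesis using mono \<open>\<delta> > 0\<close> by blast
  qed
  ultimately show ?thesis using that by blast
qed

lemma lipschitz_domain_uniform_geometry:
  fixes \<Omega> :: "'a::euclidean_space set"
  assumes "lipschitz_domain \<Omega>" "bounded \<Omega>"
  shows "\<exists>\<epsilon>>0. \<forall>x\<in>closure \<Omega>. interior_ball_upto \<Omega> \<epsilon> x \<and> short_paths_upto \<Omega> \<epsilon> x"
proof -
  have "compact (closure \<Omega>)" using assms(2) by simp
  then obtain \<epsilon> where "\<epsilon> > 0"
    "\<And>x. x \<in> closure \<Omega> \<Longrightarrow> interior_ball_upto \<Omega> \<epsilon> x \<and> short_paths_upto \<Omega> \<epsilon> x"
    by (rule compact_uniform_scale[where Q = "\<lambda>\<epsilon> x. interior_ball_upto \<Omega> \<epsilon> x \<and> short_paths_upto \<Omega> \<epsilon> x"])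
      (auto intro: lipschitz_domain_local_geometry[OF assms(1), simplified]
        interior_ball_upto_mono short_paths_upto_mono)
  then show ?thesis by blast
qed

lemma interval_interior_ball:
  assumes "bounded I" "is_interval I" "interior I \<noteq> {}" "t \<in> closure I"
    and r: "0 < r" "r \<le> measure lebesgue I powr (1/2)"
  shows "\<exists>s. {s - r\<^sup>2/4 <..< s + r\<^sup>2/4} \<subseteq> I \<inter> {t - r\<^sup>2 <..< t + r\<^sup>2}"
proof -
  have ne: "I \<noteq> {}" using assms(3) by auto
  define a b where "a = Inf I" and "b = Sup I"
  have bdd: "bdd_above I" "bdd_below I"
    using assms(1) by (auto intro: bounded_imp_bdd_above bounded_imp_bdd_below)
  have sub: "I \<subseteq> {a..b}"
    using bdd by (auto simp: a_def b_def intro: cInf_lower cSup_upper)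
  have sup: "{a<..<b} \<subseteq> I"
  proof
    fix x assume x: "x \<in> {a<..<b}"
    then obtain y z where "y \<in> I" "y < x" "z \<in> I" "x < z"
      using cInf_less_iff[OF ne bdd(2)] less_cSup_iff[OF ne bdd(1)] by (auto simp: a_def b_def)
    then show "x \<in> I" using assms(2) unfolding is_interval_1 by (meson less_imp_le)
  qed
  have ab: "a \<le> b" using ne sub by auto
  have "measure lebesgue I \<le> measure lebesgue {a..b}"
    using sub assms(1,2) by (intro measure_mono_fmeasurable fmeasurableD)
      (auto simp: is_interval_convex intro: measurable_convex)
  then have "measure lebesgue I \<le> b - a" using ab by simp
  moreover have "r\<^sup>2 \<le> measure lebesgue I"
  proof -
    have "r \<le> sqrt (measure lebesgue I)" using r by (simp add: powr_half_sqrt)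
    then have "r\<^sup>2 \<le> (sqrt (measure lebesgue I))\<^sup>2" using r by (intro power_mono) auto
    then show ?thesis by simp
  qed
  ultimately have rab: "r\<^sup>2 \<le> b - a" by simp
  have t: "a \<le> t" "t \<le> b" using assms(4) closure_minimal[OF sub] by auto
  have r2: "r\<^sup>2 > 0" using r by simp
  have key: ?thesis if "a \<le> s - r\<^sup>2/4" "s + r\<^sup>2/4 \<le> b" "t - r\<^sup>2 \<le> s - r\<^sup>2/4" "s + r\<^sup>2/4 \<le> t + r\<^sup>2" for s
    using that sup by (intro exI[of _ s] Int_greatest subset_trans[OF _ sup]) (simp_all add: greaterThanLessThan_subseteq_greaterThanLessThan)
  \<comment> \<open>the box lies next to \<open>t\<close>, on the side of the midpoint of \<open>I\<close>\<close>
  show ?thesis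
  proof (cases "t \<le> (a + b) / 2")
    case True
    show ?thesis using True t rab r2 by (intro key[of "t + r\<^sup>2/4"]) simp_all
  next
    case False
    show ?thesis using False t rab r2 by (intro key[of "t - r\<^sup>2/4"]) simp_all
  qed
qed

text \<open>
  Radii up to \<open>d\<close> are first shrunk by the factor \<open>\<epsilon> / d\<close>, which makes them at most \<open>\<epsilon>\<close>.
\<close>

lemma interior_ball_all_scales:
  assumes "interior_ball_upto \<Omega> \<epsilon> x" and "\<epsilon> > 0" "d > 0" "0 < r" "r \<le> d" "\<epsilon> \<le> d"
  shows "\<exists>y. ball y (\<epsilon>\<^sup>2 / d * r) \<subseteq> \<Omega> \<inter> ball x r"
proof -
  define r' where "r' = \<epsilon> / d * r"
  have "r' \<le> \<epsilon>" using assms by (simp add: r'_def field_simps)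
  moreover have r': "0 < r'" "r' \<le> r" using assms by (auto simp: r'_def field_simps)
  ultimately obtain y where "ball y (\<epsilon> * r') \<subseteq> \<Omega> \<inter> ball x r'"
    using assms(1) unfolding interior_ball_upto_def by auto
  moreover have "\<epsilon> * r' = \<epsilon>\<^sup>2 / d * r" by (simp add: r'_def power2_eq_square)
  moreover have "ball x r' \<subseteq> ball x r" using r' by auto
  ultimately show ?thesis by auto
qed

lemma cylinder_interior_box:
  fixes \<Omega> :: "'a::euclidean_space set"
  assumes "bounded \<Omega>" "lipschitz_domain \<Omega>" "bounded I" "is_interval I" "interior I \<noteq> {}"
  obtains \<kappa> where "0 < \<kappa>" "\<kappa> \<le> 1"
    "\<And>p r. p \<in> closure (I \<times> \<Omega>) \<Longrightarrow> 0 < r \<Longrightarrow> r \<le> min (measure lebesgue I powr (1/2)) (diameter \<Omega>) \<Longrightarrow>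
      \<exists>s y. {s - \<kappa> * r\<^sup>2 <..< s + \<kappa> * r\<^sup>2} \<times> ball y (\<kappa> * r) \<subseteq> parabolic_cylinder r p \<inter> I \<times> \<Omega>"
proof -
  obtain \<epsilon>0 where \<epsilon>0: "\<epsilon>0 > 0" "\<And>x. x \<in> closure \<Omega> \<Longrightarrow> interior_ball_upto \<Omega> \<epsilon>0 x"
    using lipschitz_domain_uniform_geometry[OF assms(2,1)] by blast
  define d where "d = diameter \<Omega> + 1"
  have "diameter \<Omega> \<ge> 0" using assms(1) by (rule diameter_ge_0)
  then have d: "d > 0" by (simp add: d_def)
  define \<epsilon> where "\<epsilon> = min \<epsilon>0 d"
  have \<epsilon>: "\<epsilon> > 0" "\<epsilon> \<le> d" "\<And>x. x \<in> closure \<Omega> \<Longrightarrow> interior_ball_upto \<Omega> \<epsilon> x"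
  proof -
    show "\<epsilon> > 0" "\<epsilon> \<le> d" using \<epsilon>0(1) d by (auto simp: \<epsilon>_def)
    then show "interior_ball_upto \<Omega> \<epsilon> x" if "x \<in> closure \<Omega>" for x
      using interior_ball_upto_mono[OF \<epsilon>0(2)[OF that]] by (simp add: \<epsilon>_def)
  qed
  define \<kappa> where "\<kappa> = min (1/4) (\<epsilon>\<^sup>2 / d)"
  show ?thesis
  proof (rule that)
    show "0 < \<kappa>" "\<kappa> \<le> 1" using \<epsilon> d by (auto simp: \<kappa>_def)
    fix p r assume p: "p \<in> closure (I \<times> \<Omega>)" and
      r: "0 < r" "r \<le> min (measure lebesgue I powr (1/2)) (diameter \<Omega>)"
    obtain t x where tx: "p = (t, x)" "t \<in> closure I" "x \<in> closure \<Omega>"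
      using p by (auto simp: closure_Times)
    obtain s where s: "{s - r\<^sup>2/4 <..< s + r\<^sup>2/4} \<subseteq> I \<inter> {t - r\<^sup>2 <..< t + r\<^sup>2}"
      using interval_interior_ball[OF assms(3-5) tx(2) r(1)] r(2) by auto
    obtain y where y: "ball y (\<epsilon>\<^sup>2 / d * r) \<subseteq> \<Omega> \<inter> ball x r"
      using interior_ball_all_scales[OF \<epsilon>(3)[OF tx(3)] \<epsilon>(1) d r(1) _ \<epsilon>(2)] r by (auto simp: d_def)
    have "\<kappa> * r\<^sup>2 \<le> 1/4 * r\<^sup>2" "\<kappa> * r \<le> \<epsilon>\<^sup>2 / d * r"
      using r unfolding \<kappa>_def by (intro mult_right_mono min.cobounded1 min.cobounded2; simp)+
    then have "{s - \<kappa> * r\<^sup>2 <..< s + \<kappa> * r\<^sup>2} \<subseteq> {s - r\<^sup>2/4 <..< s + r\<^sup>2/4}"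
      "ball y (\<kappa> * r) \<subseteq> ball y (\<epsilon>\<^sup>2 / d * r)" by (auto intro!: subset_ball)
    then have "{s - \<kappa> * r\<^sup>2 <..< s + \<kappa> * r\<^sup>2} \<times> ball y (\<kappa> * r)
        \<subseteq> (I \<inter> {t - r\<^sup>2 <..< t + r\<^sup>2}) \<times> (\<Omega> \<inter> ball x r)"
      using s y by (intro Sigma_mono) (metis subset_trans)+
    then show "\<exists>s y. {s - \<kappa> * r\<^sup>2 <..< s + \<kappa> * r\<^sup>2} \<times> ball y (\<kappa> * r) \<subseteq> parabolic_cylinder r p \<inter> I \<times> \<Omega>"
      unfolding tx(1) parabolic_cylinder_def by (intro exI[of _ s] exI[of _ y]) auto
  qed
qed

section \<open>Parabolic cylinders and square-integrable functions\<close>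

lemma parabolic_dist_eq:
  "parabolic_dist p q = max (sqrt \<bar>fst p - fst q\<bar>) (norm (snd p - snd q))"
  by (simp add: parabolic_dist_def powr_half_sqrt split: prod.split)

lemma parabolic_dist_nonneg: "0 \<le> parabolic_dist p q"
  by (simp add: parabolic_dist_eq le_max_iff_disj)

lemma parabolic_dist_eq_0_iff: "parabolic_dist p q = 0 \<longleftrightarrow> p = q"
proof
  assume "parabolic_dist p q = 0"
  then have "sqrt \<bar>fst p - fst q\<bar> \<le> 0" "norm (snd p - snd q) \<le> 0"
    unfolding parabolic_dist_eq by (metis max.cobounded1, metis max.cobounded2)
  then show "p = q" by (intro prod_eqI) auto
qed (simp add: parabolic_dist_eq)

lemma parabolic_dist_commute: "parabolic_dist p q = parabolic_dist q p"
  by (simp add: parabolic_dist_eq norm_minus_commute abs_minus_commute)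

lemma parabolic_dist_triangle: "parabolic_dist p q \<le> parabolic_dist p w + parabolic_dist w q"
proof -
  have "sqrt \<bar>fst p - fst q\<bar> \<le> sqrt (\<bar>fst p - fst w\<bar> + \<bar>fst w - fst q\<bar>)"
    by (intro real_sqrt_le_mono) linarith
  also have "\<dots> \<le> sqrt \<bar>fst p - fst w\<bar> + sqrt \<bar>fst w - fst q\<bar>"
    by (rule sqrt_add_le_add_sqrt) auto
  finally have 1: "sqrt \<bar>fst p - fst q\<bar> \<le> sqrt \<bar>fst p - fst w\<bar> + sqrt \<bar>fst w - fst q\<bar>" .
  have 2: "norm (snd p - snd q) \<le> norm (snd p - snd w) + norm (snd w - snd q)"
    using norm_triangle_ineq[of "snd p - snd w" "snd w - snd q"] by simp
  show ?thesis unfolding parabolic_dist_eq using 1 2 by linarith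
qed

lemma parabolic_dist_space: "norm (snd p - snd q) \<le> parabolic_dist p q"
  by (simp add: parabolic_dist_eq)

lemma parabolic_dist_same_time: "parabolic_dist (t, x) (t, y) = norm (x - y)"
  by (simp add: parabolic_dist_eq)

lemma parabolic_dist_same_space: "parabolic_dist (t, x) (s, x) = sqrt \<bar>t - s\<bar>"
  by (simp add: parabolic_dist_eq)

lemma in_parabolic_cylinder_iff:
  assumes "r > 0"
  shows "q \<in> parabolic_cylinder r p \<longleftrightarrow> parabolic_dist p q < r"
proof -
  have "sqrt \<bar>fst p - fst q\<bar> < r \<longleftrightarrow> \<bar>fst p - fst q\<bar> < r\<^sup>2"
    using assms by (metis abs_ge_zero real_less_lsqrt real_sqrt_less_iff real_sqrt_unique less_imp_le)
  then show ?thesis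
    by (cases p, cases q) (auto simp: parabolic_dist_eq parabolic_cylinder_def dist_norm)
qed

lemma tendsto_parabolic_dist: "((\<lambda>q. parabolic_dist p q) \<longlongrightarrow> 0) (at p within S)"
proof -
  have "((\<lambda>q. max (sqrt \<bar>fst p - fst q\<bar>) (norm (snd p - snd q))) \<longlongrightarrow>
      max (sqrt \<bar>fst p - fst p\<bar>) (norm (snd p - snd p))) (at p within S)"
    by (intro tendsto_intros)
  then show ?thesis by (simp add: parabolic_dist_eq)
qed

lemma parabolic_cylinder_open: "open (parabolic_cylinder r p)"
  by (auto simp: parabolic_cylinder_def split: prod.splits intro!: open_Times)

lemma time_box_in_borel: "{a<..<b} \<times> ball (y::'a::euclidean_space) r \<in> sets borel"
  for a b :: real
  by (intro borel_open open_Times) auto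

lemma time_box_measure:
  fixes y :: "'a::euclidean_space"
  assumes "0 \<le> a" "0 \<le> r"
  shows "{s - a<..<s + a} \<times> ball y r \<in> lmeasurable"
    and "measure lebesgue ({s - a<..<s + a} \<times> ball y r)
      = 2 * a * (unit_ball_vol (DIM('a)) * r ^ DIM('a))"
proof -
  have "emeasure lborel ({s - a<..<s + a} \<times> ball y r)
      = emeasure (lborel \<Otimes>\<^sub>M lborel) ({s - a<..<s + a} \<times> ball y r)"
    by (simp add: lborel_prod)
  also have "\<dots> = emeasure lborel {s - a<..<s + a} * emeasure lborel (ball y r)"
    by (rule lborel.emeasure_pair_measure_Times) auto
  also have "\<dots> = ennreal (2 * a) * ennreal (unit_ball_vol (DIM('a)) * r ^ DIM('a))"
    using assms by (simp add: emeasure_ball)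
  also have "\<dots> = ennreal (2 * a * (unit_ball_vol (DIM('a)) * r ^ DIM('a)))"
    using assms by (simp add: ennreal_mult)
  finally have e: "emeasure lborel ({s - a<..<s + a} \<times> ball y r)
      = ennreal (2 * a * (unit_ball_vol (DIM('a)) * r ^ DIM('a)))" .
  have nn: "0 \<le> 2 * a * (unit_ball_vol (DIM('a)) * r ^ DIM('a))"
    using assms by (intro mult_nonneg_nonneg zero_le_power unit_ball_vol_nonneg) auto
  have box: "{s - a<..<s + a} \<times> ball y r \<in> sets lborel" using time_box_in_borel by simp
  then have box': "{s - a<..<s + a} \<times> ball y r \<in> sets lebesgue" by (rule sets_completionI_sets)
  have l: "emeasure lebesgue ({s - a<..<s + a} \<times> ball y r)
      = ennreal (2 * a * (unit_ball_vol (DIM('a)) * r ^ DIM('a)))"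
    unfolding emeasure_completion[OF box'] main_part[OF box] by (rule e)
  show "{s - a<..<s + a} \<times> ball y r \<in> lmeasurable"
    using l box' by (intro fmeasurableI) auto
  show "measure lebesgue ({s - a<..<s + a} \<times> ball y r)
      = 2 * a * (unit_ball_vol (DIM('a)) * r ^ DIM('a))"
    unfolding measure_def l using nn by (rule enn2real_ennreal)
qed

lemma square_integrable_iff:
  assumes "S \<in> sets lebesgue"
  shows "square_integrable S u \<longleftrightarrow>
    (\<lambda>q. indicat_real S q *\<^sub>R u q) \<in> borel_measurable lebesgue \<and>
    integrable lebesgue (\<lambda>q. indicat_real S q *\<^sub>R (u q)\<^sup>2)"
  using assms unfolding square_integrable_def
  by (simp add: integrable_restrict_space borel_measurable_restrict_space_iff)

lemma L2_norm_sq_eq: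
  assumes "S \<in> sets lebesgue"
  shows "L2_norm_sq S u = (\<integral>q. indicat_real S q *\<^sub>R (u q)\<^sup>2 \<partial>lebesgue)"
  using assms unfolding L2_norm_sq_def by (simp add: integral_restrict_space)

lemma L2_norm_sq_nonneg: "0 \<le> L2_norm_sq S u"
  unfolding L2_norm_sq_def by (rule Bochner_Integration.integral_nonneg) simp

lemma square_integrable_subset:
  assumes "square_integrable S u" "D \<subseteq> S" "D \<in> sets lebesgue" "S \<in> sets lebesgue"
  shows "square_integrable D u" and "L2_norm_sq D u \<le> L2_norm_sq S u"
proof -
  have S: "(\<lambda>q. indicat_real S q *\<^sub>R u q) \<in> borel_measurable lebesgue"
    "integrable lebesgue (\<lambda>q. indicat_real S q *\<^sub>R (u q)\<^sup>2)"
    using assms square_integrable_iff by blast+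
  have eq: "indicat_real D q *\<^sub>R f q = indicat_real D q *\<^sub>R (indicat_real S q *\<^sub>R f q)"
    for q and f :: "_ \<Rightarrow> real"
    using assms(2) by (auto simp: indicator_def)
  have "(\<lambda>q. indicat_real D q *\<^sub>R u q) \<in> borel_measurable lebesgue"
    unfolding eq[of _ u] using S(1) assms(3) by measurable
  moreover have i: "integrable lebesgue (\<lambda>q. indicat_real D q *\<^sub>R (u q)\<^sup>2)"
    unfolding eq[of _ "\<lambda>q. (u q)\<^sup>2"] by (rule integrable_mult_indicator[OF assms(3) S(2)])
  ultimately show "square_integrable D u" using assms square_integrable_iff by blast
  show "L2_norm_sq D u \<le> L2_norm_sq S u"
    unfolding L2_norm_sq_eq[OF assms(3)] L2_norm_sq_eq[OF assms(4)]
    using assms(2) by (intro Bochner_Integration.integral_mono i S) (auto simp: indicator_def)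
qed

lemma square_integrable_diff:
  assumes "square_integrable D f" "square_integrable D g"
  shows "square_integrable D (\<lambda>q. f q - g q)"
    and "L2_norm_sq D (\<lambda>q. f q - g q) \<le> 2 * L2_norm_sq D f + 2 * L2_norm_sq D g"
proof -
  have m[measurable]: "f \<in> borel_measurable (lebesgue_on D)" "g \<in> borel_measurable (lebesgue_on D)"
    and i: "integrable (lebesgue_on D) (\<lambda>p. (f p)\<^sup>2)" "integrable (lebesgue_on D) (\<lambda>p. (g p)\<^sup>2)"
    using assms by (auto simp: square_integrable_def)
  have le: "(f q - g q)\<^sup>2 \<le> 2 * (f q)\<^sup>2 + 2 * (g q)\<^sup>2" for q
    using zero_le_power2[of "f q + g q"] by (simp add: power2_eq_square algebra_simps)
  have i2: "integrable (lebesgue_on D) (\<lambda>q. 2 * (f q)\<^sup>2 + 2 * (g q)\<^sup>2)" using i by simp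
  have i3: "integrable (lebesgue_on D) (\<lambda>q. (f q - g q)\<^sup>2)"
    by (rule Bochner_Integration.integrable_bound[OF i2]) (use le in auto)
  then show "square_integrable D (\<lambda>q. f q - g q)" by (simp add: square_integrable_def)
  have "L2_norm_sq D (\<lambda>q. f q - g q) \<le> (\<integral>q. 2 * (f q)\<^sup>2 + 2 * (g q)\<^sup>2 \<partial>lebesgue_on D)"
    unfolding L2_norm_sq_def using le by (intro Bochner_Integration.integral_mono i2 i3) auto
  also have "\<dots> = 2 * L2_norm_sq D f + 2 * L2_norm_sq D g"
    using i by (simp add: L2_norm_sq_def)
  finally show "L2_norm_sq D (\<lambda>q. f q - g q) \<le> 2 * L2_norm_sq D f + 2 * L2_norm_sq D g" .
qed

lemma square_integrable_bounded:
  assumes "D \<in> lmeasurable" "f \<in> borel_measurable (lebesgue_on D)"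
    and "AE q in lebesgue_on D. \<bar>f q\<bar> \<le> B"
  shows "square_integrable D f" and "L2_norm_sq D f \<le> B\<^sup>2 * measure lebesgue D"
proof -
  interpret finite_measure "lebesgue_on D" using assms(1) by (rule finite_measure_lebesgue_on)
  have m[measurable]: "f \<in> borel_measurable (lebesgue_on D)" by fact
  have ae: "AE q in lebesgue_on D. (f q)\<^sup>2 \<le> B\<^sup>2"
    using assms(3) by eventually_elim (simp add: abs_le_square_iff[symmetric])
  have i: "integrable (lebesgue_on D) (\<lambda>q. (f q)\<^sup>2)"
    by (rule integrable_const_bound[where B = "B\<^sup>2"]) (use ae in auto)
  then show "square_integrable D f" by (simp add: square_integrable_def m)
  have "L2_norm_sq D f \<le> (\<integral>q. B\<^sup>2 \<partial>lebesgue_on D)"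
    unfolding L2_norm_sq_def using ae by (intro integral_mono_AE i) auto
  also have "\<dots> = B\<^sup>2 * measure lebesgue D"
    using assms(1) by (simp add: measure_restrict_space fmeasurableD)
  finally show "L2_norm_sq D f \<le> B\<^sup>2 * measure lebesgue D" .
qed

lemma L2_norm_sq_lower_bound:
  assumes "square_integrable D f" "D \<in> sets lebesgue" "E \<in> lmeasurable" "E \<subseteq> D"
    and "0 \<le> b" "\<And>q. q \<in> E \<Longrightarrow> b \<le> \<bar>f q\<bar>"
  shows "b\<^sup>2 * measure lebesgue E \<le> L2_norm_sq D f"
proof -
  have "b\<^sup>2 * measure lebesgue E = (\<integral>q. indicat_real E q *\<^sub>R b\<^sup>2 \<partial>lebesgue)"
    using assms(3) by simp
  also have "\<dots> \<le> (\<integral>q. indicat_real D q *\<^sub>R (f q)\<^sup>2 \<partial>lebesgue)"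
  proof (rule Bochner_Integration.integral_mono)
    show "integrable lebesgue (\<lambda>q. indicat_real E q *\<^sub>R b\<^sup>2)"
      using assms(3) by (intro integrable_scaleR_left integrable_real_indicator)
        (auto simp: fmeasurable_def)
    show "integrable lebesgue (\<lambda>q. indicat_real D q *\<^sub>R (f q)\<^sup>2)"
      using assms square_integrable_iff by blast
    fix q
    have "b\<^sup>2 \<le> (f q)\<^sup>2" if "q \<in> E"
      using assms(5) assms(6)[OF that] by (simp add: abs_le_square_iff[symmetric])
    then show "indicat_real E q *\<^sub>R b\<^sup>2 \<le> indicat_real D q *\<^sub>R (f q)\<^sup>2"
      using assms(4) by (auto simp: indicator_def)
  qed
  finally show ?thesis using L2_norm_sq_eq[OF assms(2)] by metis
qed

lemma AE_lebesgue_on_subset: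
  assumes "AE q in lebesgue_on S. P q" "D \<subseteq> S" "D \<in> sets lebesgue" "S \<in> sets lebesgue"
  shows "AE q in lebesgue_on D. P q"
  using assms by (auto simp: AE_restrict_space_iff elim!: eventually_mono)

section \<open>Affine functions and coverings on domains with interior boxes\<close>

text \<open>
  The boxes make the measure of \<open>parabolic_cylinder r p \<inter> S\<close> comparable with that of the full cylinder,
  and they keep this set from being so thin that an affine function could almost vanish on it.
\<close>

locale cylinder_domain =
  fixes S :: "(real \<times> 'a::euclidean_space) set" and r0 \<kappa> :: real
  assumes bounded_S: "bounded S" and sets_S: "S \<in> sets lebesgue"
    and r0_pos: "0 < r0" and \<kappa>_pos: "0 < \<kappa>" and \<kappa>_le_1: "\<kappa> \<le> 1"
    and interior_box: "\<And>p r. p \<in> closure S \<Longrightarrow> 0 < r \<Longrightarrow> r \<le> r0 \<Longrightarrow>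
      \<exists>s y. {s - \<kappa> * r\<^sup>2 <..< s + \<kappa> * r\<^sup>2} \<times> ball y (\<kappa> * r) \<subseteq> parabolic_cylinder r p \<inter> S"
begin

definition cyl :: "real \<Rightarrow> real \<times> 'a \<Rightarrow> (real \<times> 'a) set" where
  "cyl r p = parabolic_cylinder r p \<inter> S"

text \<open>
  The Lebesgue measure of a full parabolic cylinder of radius \<open>r\<close>.
\<close>

definition vol :: "real \<Rightarrow> real" where
  "vol r = 2 * r\<^sup>2 * (unit_ball_vol (real DIM('a)) * r ^ DIM('a))"

abbreviation csize :: "real \<Rightarrow> real \<times> 'a \<Rightarrow> real" where
  "csize r p \<equiv> measure lebesgue (cyl r p)"

lemma vol_pos: "0 < r \<Longrightarrow> 0 < vol r"
  by (simp add: vol_def)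

lemma vol_mult: "vol (c * r) = c ^ (DIM('a) + 2) * vol r"
  by (simp add: vol_def power_mult_distrib power_add power2_eq_square)

lemma vol_half: "vol r = 2 ^ (DIM('a) + 2) * vol (r / 2)"
  using vol_mult[of 2 "r / 2"] by simp

lemma S_lmeasurable: "S \<in> lmeasurable"
  using bounded_S sets_S by (rule bounded_set_imp_lmeasurable)

lemma cyl_lmeasurable: "cyl r p \<in> lmeasurable"
proof -
  have "S \<inter> parabolic_cylinder r p \<in> lmeasurable"
    using S_lmeasurable parabolic_cylinder_open[of r p]
    by (intro fmeasurable_Int_fmeasurable sets_completionI_sets) (auto intro: borel_open)
  then show ?thesis by (simp add: cyl_def Int_commute)
qed

lemma cyl_sets: "cyl r p \<in> sets lebesgue"
  using cyl_lmeasurable by (rule fmeasurableD)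

lemma cyl_subset: "cyl r p \<subseteq> S"
  by (simp add: cyl_def)

lemma size_le_vol:
  assumes "0 < r"
  shows "csize r p \<le> vol r"
proof -
  obtain t x where p: "p = (t, x)" by force
  have "csize r p \<le> measure lebesgue ({t - r\<^sup>2 <..< t + r\<^sup>2} \<times> ball x r)"
    using time_box_measure(1)[of "r\<^sup>2" r t x] assms cyl_sets
    by (intro measure_mono_fmeasurable) (auto simp: cyl_def p parabolic_cylinder_def)
  also have "\<dots> = vol r"
    using assms by (subst time_box_measure(2)) (auto simp: vol_def)
  finally show ?thesis .
qed

lemma vol_le_size:
  assumes "p \<in> closure S" "0 < r" "r \<le> r0"
  shows "\<kappa> ^ Suc DIM('a) * vol r \<le> csize r p"
proof -
  obtain s y where sub: "{s - \<kappa> * r\<^sup>2 <..< s + \<kappa> * r\<^sup>2} \<times> ball y (\<kappa> * r) \<subseteq> cyl r p"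
    using interior_box[OF assms] by (auto simp: cyl_def)
  have "\<kappa> ^ Suc DIM('a) * vol r = 2 * (\<kappa> * r\<^sup>2) * (unit_ball_vol (real DIM('a)) * (\<kappa> * r) ^ DIM('a))"
    by (simp add: vol_def power_mult_distrib)
  also have "\<dots> = measure lebesgue ({s - \<kappa> * r\<^sup>2 <..< s + \<kappa> * r\<^sup>2} \<times> ball y (\<kappa> * r))"
    using assms \<kappa>_pos by (subst time_box_measure(2)) auto
  also have "\<dots> \<le> csize r p"
    using sub cyl_lmeasurable time_box_measure(1)[of "\<kappa> * r\<^sup>2" "\<kappa> * r" s y] assms \<kappa>_pos
    by (intro measure_mono_fmeasurable) auto
  finally show ?thesis .
qed

lemma size_pos:
  assumes "p \<in> closure S" "0 < r" "r \<le> r0"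
  shows "0 < csize r p"
proof -
  have "0 < \<kappa> ^ Suc DIM('a) * vol r" using \<kappa>_pos vol_pos[OF assms(2)] by simp
  then show ?thesis using vol_le_size[OF assms] by linarith
qed

lemma cyl_mono:
  assumes "0 < r" "parabolic_dist p q < r / 2"
  shows "cyl (r / 2) q \<subseteq> cyl r p"
proof
  fix w assume "w \<in> cyl (r / 2) q"
  then have "w \<in> S" "parabolic_dist q w < r / 2"
    using assms by (auto simp: cyl_def in_parabolic_cylinder_iff)
  moreover have "parabolic_dist p w \<le> parabolic_dist p q + parabolic_dist q w"
    by (rule parabolic_dist_triangle)
  ultimately show "w \<in> cyl r p" using assms by (simp add: cyl_def in_parabolic_cylinder_iff)
qed

text \<open>
  Every neighbourhood of \<open>p\<close> in \<open>S\<close> contains some \<open>cyl r p\<close>, and this has positive measure.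
\<close>

lemma ae_zero_continuous_imp_zero:
  assumes "continuous_on S f" "AE q in lebesgue_on S. f q = (0::real)" "p \<in> S"
  shows "f p = 0"
proof (rule ccontr)
  assume "f p \<noteq> 0"
  then have "(\<forall>\<^sub>F q in at p within S. f q \<noteq> 0)"
    using assms by (intro tendsto_imp_eventually_ne) (auto simp: continuous_on_def)
  moreover have "\<forall>\<^sub>F q in at p within S. True" by simp
  ultimately obtain e where e: "e > 0" "\<And>q. q \<in> S \<Longrightarrow> q \<noteq> p \<Longrightarrow> dist q p < e \<Longrightarrow> f q \<noteq> 0"
    unfolding eventually_at by blast
  define r where "r = min r0 (min 1 (e / 2))"
  have r: "0 < r" "r \<le> r0" "r \<le> 1" "r \<le> e / 2"
    using r0_pos e(1) unfolding r_def by (auto intro: min.coboundedI1 min.coboundedI2)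
  have "f q \<noteq> 0" if "q \<in> cyl r p" for q
  proof -
    have "\<bar>fst p - fst q\<bar> < r\<^sup>2" "norm (snd p - snd q) < r" "q \<in> S"
      using that by (cases p; cases q; auto simp: cyl_def parabolic_cylinder_def dist_norm)+
    moreover have "r\<^sup>2 \<le> r" using r by (simp add: power2_eq_square mult_left_le_one_le)
    moreover have "dist q p \<le> dist (fst q) (fst p) + dist (snd q) (snd p)"
      unfolding dist_prod_def by (rule sqrt_sum_squares_le_sum) auto
    ultimately have "dist q p < e"
      using r by (simp add: dist_norm norm_minus_commute abs_minus_commute)
    then show ?thesis using e(2)[of q] \<open>q \<in> S\<close> \<open>f p \<noteq> 0\<close> by blast
  qed
  then have "AE q in lebesgue_on (cyl r p). False"
    using AE_lebesgue_on_subset[OF assms(2) cyl_subset cyl_sets sets_S, of r p]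
    by (simp add: AE_restrict_space_iff cyl_sets)
  then have "AE q in lebesgue. q \<notin> cyl r p"
    by (simp add: AE_restrict_space_iff cyl_sets)
  then have "cyl r p \<in> null_sets lebesgue"
    using cyl_sets AE_iff_null_sets by blast
  then have "csize r p = 0" by (rule measure_eq_0_null_sets)
  then show False using size_pos[of p r] assms(3) r closure_subset by fastforce
qed

text \<open>
  On the sub-ball that is shifted in the direction of the slope, or in the opposite direction if
  \<open>a\<close> is negative, the constant part and the linear part have the same sign and cannot cancel.
\<close>

lemma affine_large_on_subball:
  fixes A y :: "'b::euclidean_space"
  assumes "0 < \<rho>"
  shows "\<exists>y'. ball y' (\<rho> / 4) \<subseteq> ball y \<rho> \<and>
    (\<forall>z\<in>ball y' (\<rho> / 4). \<bar>a\<bar> + norm A * \<rho> / 4 \<le> \<bar>a + A \<bullet> (z - y)\<bar>)"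
proof -
  define \<sigma> where "\<sigma> = (if 0 \<le> a then 1 else - 1 :: real)"
  define y' where "y' = y + (\<sigma> * \<rho> / 2) *\<^sub>R sgn A"
  have \<sigma>: "\<bar>\<sigma>\<bar> = 1" "\<sigma> * a = \<bar>a\<bar>" "\<sigma> * \<sigma> = 1" by (auto simp: \<sigma>_def)
  have A: "A \<bullet> sgn A = norm A"
    by (simp add: sgn_div_norm power2_norm_eq_inner[symmetric] power2_eq_square field_simps)
  have n: "norm (sgn A) \<le> 1" by (simp add: norm_sgn)
  have "norm (y' - y) \<le> \<rho> / 2"
    using n assms \<sigma>(1) by (simp add: y'_def abs_mult mult_left_le)
  then have "dist y y' \<le> \<rho> / 2" by (simp add: dist_norm norm_minus_commute)
  then have "dist y x < \<rho>" if "dist y' x < \<rho> / 4" for x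
    using dist_triangle[of y x y'] that assms by argo
  then have "ball y' (\<rho> / 4) \<subseteq> ball y \<rho>" by auto
  moreover have "\<bar>a\<bar> + norm A * \<rho> / 4 \<le> \<bar>a + A \<bullet> (z - y)\<bar>" if "z \<in> ball y' (\<rho> / 4)" for z
  proof -
    define h where "h = z - y'"
    have "norm h \<le> \<rho> / 4" using that by (simp add: h_def dist_norm norm_minus_commute)
    then have "\<bar>A \<bullet> h\<bar> \<le> norm A * (\<rho> / 4)"
      by (meson Cauchy_Schwarz_ineq2 mult_left_mono norm_ge_zero order_trans)
    then have h: "\<bar>\<sigma> * (A \<bullet> h)\<bar> \<le> norm A * \<rho> / 4" using \<sigma>(1) by (simp add: abs_mult)
    have "A \<bullet> (z - y) = \<sigma> * \<rho> / 2 * norm A + A \<bullet> h"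
      by (simp add: h_def y'_def A inner_diff_right inner_add_right)
    then have "\<sigma> * (a + A \<bullet> (z - y)) = \<sigma> * a + \<sigma> * \<sigma> * (\<rho> / 2 * norm A) + \<sigma> * (A \<bullet> h)"
      by (simp add: algebra_simps)
    then have "\<sigma> * (a + A \<bullet> (z - y)) = \<bar>a\<bar> + \<rho> / 2 * norm A + \<sigma> * (A \<bullet> h)"
      by (simp only: \<sigma>)
    then have "\<bar>a\<bar> + norm A * \<rho> / 4 \<le> \<sigma> * (a + A \<bullet> (z - y))"
      using h by (simp add: abs_le_iff algebra_simps)
    also have "\<dots> \<le> \<bar>\<sigma> * (a + A \<bullet> (z - y))\<bar>" by simp
    also have "\<dots> = \<bar>a + A \<bullet> (z - y)\<bar>" using \<sigma>(1) by (simp add: abs_mult)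
    finally show ?thesis .
  qed
  ultimately show ?thesis by blast
qed

definition affine_at :: "real \<Rightarrow> 'a \<Rightarrow> real \<times> 'a \<Rightarrow> real \<times> 'a \<Rightarrow> real" where
  "affine_at a A p q = a + A \<bullet> (snd q - snd p)"

lemma affine_at_center [simp]: "affine_at a A p p = a"
  by (simp add: affine_at_def)

lemma affine_at_diff:
  "affine_at a A p w - affine_at b B q w = affine_at (affine_at a A p q - b) (A - B) q w"
  by (simp add: affine_at_def inner_diff_left inner_diff_right algebra_simps)

lemma continuous_affine_at: "continuous_on X (affine_at a A p)"
  unfolding affine_at_def by (intro continuous_intros)

lemma affine_at_square_integrable: "square_integrable (cyl r p') (affine_at a A p)"
proof -
  have "bounded (affine_at a A p ` closure S)"
    using bounded_S by (intro compact_imp_bounded compact_continuous_image continuous_affine_at) auto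
  then obtain B where B: "\<And>q. q \<in> closure S \<Longrightarrow> \<bar>affine_at a A p q\<bar> \<le> B"
    unfolding bounded_iff by auto
  show ?thesis
  proof (rule square_integrable_bounded)
    show "affine_at a A p \<in> borel_measurable (lebesgue_on (cyl r p'))"
      by (intro continuous_imp_measurable_on_sets_lebesgue continuous_affine_at cyl_sets)
    show "AE q in lebesgue_on (cyl r p'). \<bar>affine_at a A p q\<bar> \<le> B"
    proof (rule AE_I2)
      fix q assume "q \<in> space (lebesgue_on (cyl r p'))"
      then have "q \<in> S" using cyl_subset[of r p'] by auto
      then show "\<bar>affine_at a A p q\<bar> \<le> B" using B closure_subset by blast
    qed
  qed (rule cyl_lmeasurable)
qed

definition coeff_const :: real where
  "coeff_const = (8 / \<kappa>)\<^sup>2 / (\<kappa> * (\<kappa> / 4) ^ DIM('a))"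

lemma coeff_const_pos: "0 < coeff_const"
  using \<kappa>_pos by (simp add: coeff_const_def)

text \<open>
  The mean square of an affine function controls both coefficients at scale \<open>r\<close>. The lower bound comes
  from the sub-box on which value and slope do not cancel. The centre of the box lies in the cylinder,
  so passing to the value at \<open>p\<close> costs at most \<open>r * norm A\<close>.
\<close>

lemma affine_coefficients_le:
  assumes p: "p \<in> closure S" and r: "0 < r" "r \<le> r0"
  shows "(\<bar>a\<bar> + r * norm A)\<^sup>2 * csize r p \<le> coeff_const * L2_norm_sq (cyl r p) (affine_at a A p)"
proof -
  define \<rho> where "\<rho> = \<kappa> * r"
  have \<rho>: "0 < \<rho>" using \<kappa>_pos r by (simp add: \<rho>_def)
  obtain s y where sub: "{s - \<kappa> * r\<^sup>2 <..< s + \<kappa> * r\<^sup>2} \<times> ball y \<rho> \<subseteq> cyl r p"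
    using interior_box[OF assms] by (auto simp: cyl_def \<rho>_def)
  define b where "b = a + A \<bullet> (y - snd p)"
  obtain y' where y': "ball y' (\<rho> / 4) \<subseteq> ball y \<rho>"
    and large: "\<And>z. z \<in> ball y' (\<rho> / 4) \<Longrightarrow> \<bar>b\<bar> + norm A * \<rho> / 4 \<le> \<bar>b + A \<bullet> (z - y)\<bar>"
    using affine_large_on_subball[OF \<rho>] by meson
  define box where "box = {s - \<kappa> * r\<^sup>2 <..< s + \<kappa> * r\<^sup>2} \<times> ball y' (\<rho> / 4)"
  have box_sub: "box \<subseteq> cyl r p" using y' sub by (auto simp: box_def)
  define m where "m = \<bar>b\<bar> + norm A * \<rho> / 4"
  have m0: "0 \<le> m" using \<rho> by (simp add: m_def)
  have "m\<^sup>2 * measure lebesgue box \<le> L2_norm_sq (cyl r p) (affine_at a A p)"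
  proof (rule L2_norm_sq_lower_bound[OF affine_at_square_integrable cyl_sets _ box_sub m0])
    show "box \<in> lmeasurable" unfolding box_def using \<kappa>_pos \<rho> by (intro time_box_measure(1)) auto
    fix q assume "q \<in> box"
    then have "snd q \<in> ball y' (\<rho> / 4)" by (auto simp: box_def)
    moreover have "affine_at a A p q = b + A \<bullet> (snd q - y)"
      by (simp add: affine_at_def b_def inner_diff_right)
    ultimately show "m \<le> \<bar>affine_at a A p q\<bar>" using large by (simp add: m_def)
  qed
  moreover have "measure lebesgue box = \<kappa> * (\<kappa> / 4) ^ DIM('a) * vol r"
    unfolding box_def using \<kappa>_pos \<rho>
    by (subst time_box_measure(2)) (auto simp: vol_def \<rho>_def power_mult_distrib power_divide)
  ultimately have 1: "m\<^sup>2 * (\<kappa> * (\<kappa> / 4) ^ DIM('a) * vol r) \<le> L2_norm_sq (cyl r p) (affine_at a A p)"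
    by simp
  have "(s, y) \<in> cyl r p" using sub \<rho> \<kappa>_pos r by auto
  then have "norm (snd p - y) < r"
    using r by (cases p) (auto simp: cyl_def parabolic_cylinder_def dist_norm)
  then have "norm (y - snd p) \<le> r" by (simp add: norm_minus_commute)
  then have "\<bar>A \<bullet> (y - snd p)\<bar> \<le> norm A * r"
    by (intro order_trans[OF Cauchy_Schwarz_ineq2] mult_left_mono) auto
  then have "\<bar>a\<bar> \<le> \<bar>b\<bar> + r * norm A" by (simp add: b_def algebra_simps)
  then have "\<bar>a\<bar> + r * norm A \<le> \<bar>b\<bar> + 2 * (r * norm A)" by simp
  also have "\<dots> \<le> 8 / \<kappa> * \<bar>b\<bar> + 2 * (r * norm A)"
    using \<kappa>_pos \<kappa>_le_1 mult_right_mono[of 1 "8 / \<kappa>" "\<bar>b\<bar>"] by simp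
  also have "\<dots> = 8 / \<kappa> * m"
    using \<kappa>_pos by (simp add: m_def \<rho>_def field_simps)
  finally have "(\<bar>a\<bar> + r * norm A)\<^sup>2 \<le> (8 / \<kappa> * m)\<^sup>2"
    using r by (intro power_mono) auto
  then have "(\<bar>a\<bar> + r * norm A)\<^sup>2 * csize r p \<le> (8 / \<kappa> * m)\<^sup>2 * vol r"
    using size_le_vol[OF r(1)] by (intro mult_mono) auto
  also have "\<dots> = coeff_const * (m\<^sup>2 * (\<kappa> * (\<kappa> / 4) ^ DIM('a) * vol r))"
    using \<kappa>_pos by (simp add: coeff_const_def power_mult_distrib power_divide)
  also have "\<dots> \<le> coeff_const * L2_norm_sq (cyl r p) (affine_at a A p)"
    using 1 coeff_const_pos by (intro mult_left_mono) auto
  finally show ?thesis .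
qed

text \<open>
  The centres form a maximal set of points with mutual distance at least \<open>\<rho>\<close>. The cylinders of half
  the radius around them are disjoint, which bounds their number.
\<close>

lemma finite_cover:
  assumes \<rho>: "0 < \<rho>" "\<rho> \<le> r0"
  obtains F where "finite F" "F \<subseteq> S" "S \<subseteq> (\<Union>p\<in>F. cyl \<rho> p)"
    "real (card F) * (\<kappa> ^ Suc DIM('a) * vol (\<rho> / 2)) \<le> measure lebesgue S"
proof -
  define sep where "sep F \<longleftrightarrow> finite F \<and> F \<subseteq> S \<and> pairwise (\<lambda>p q. \<rho> \<le> parabolic_dist p q) F" for F
  define c where "c = \<kappa> ^ Suc DIM('a) * vol (\<rho> / 2)"
  have c: "0 < c" using \<kappa>_pos vol_pos[of "\<rho> / 2"] \<rho> by (simp add: c_def)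
  have card: "real (card F) * c \<le> measure lebesgue S" if F: "sep F" for F
  proof -
    have fin: "finite F" and FS: "F \<subseteq> S" and pw: "pairwise (\<lambda>p q. \<rho> \<le> parabolic_dist p q) F"
      using F by (auto simp: sep_def)
    have "disjoint_family_on (cyl (\<rho> / 2)) F"
      unfolding disjoint_family_on_def
    proof (intro ballI impI, rule ccontr)
      fix p q assume pq: "p \<in> F" "q \<in> F" "p \<noteq> q" and "cyl (\<rho> / 2) p \<inter> cyl (\<rho> / 2) q \<noteq> {}"
      then obtain w where "w \<in> cyl (\<rho> / 2) p" "w \<in> cyl (\<rho> / 2) q" by blast
      then have "parabolic_dist p w < \<rho> / 2" "parabolic_dist w q < \<rho> / 2"
        using \<rho> by (auto simp: cyl_def in_parabolic_cylinder_iff parabolic_dist_commute)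
      then have "parabolic_dist p q < \<rho>" using parabolic_dist_triangle[of p q w] by simp
      moreover have "\<rho> \<le> parabolic_dist p q" using pw pq by (simp add: pairwise_def)
      ultimately show False by simp
    qed
    then have "(\<Sum>p\<in>F. csize (\<rho> / 2) p) = measure lebesgue (\<Union>p\<in>F. cyl (\<rho> / 2) p)"
      using fin cyl_sets fmeasurableD2[OF cyl_lmeasurable]
      by (intro measure_finite_Union[symmetric]) (simp_all add: image_subset_iff del: emeasure_completion)
    also have "\<dots> \<le> measure lebesgue S"
      using fin cyl_subset S_lmeasurable cyl_sets
      by (intro measure_mono_fmeasurable sets.finite_UN) auto
    finally have 1: "(\<Sum>p\<in>F. csize (\<rho> / 2) p) \<le> measure lebesgue S" .
    have "real (card F) * c = (\<Sum>p\<in>F. c)" by simp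
    also have "\<dots> \<le> (\<Sum>p\<in>F. csize (\<rho> / 2) p)"
      unfolding c_def using FS closure_subset \<rho> by (intro sum_mono vol_le_size) auto
    finally show ?thesis using 1 by simp
  qed
  have "sep {}" by (simp add: sep_def pairwise_def)
  moreover have "card F \<le> nat \<lceil>measure lebesgue S / c\<rceil>" if "sep F" for F
  proof -
    have "real (card F) \<le> measure lebesgue S / c" using card[OF that] c by (simp add: pos_le_divide_eq)
    then show ?thesis by linarith
  qed
  ultimately obtain F where F: "sep F" and max: "\<And>F'. sep F' \<Longrightarrow> card F' \<le> card F"
    using ex_has_greatest_nat[of sep "{}" card] by (metis less_Suc_eq_le)
  have "S \<subseteq> (\<Union>p\<in>F. cyl \<rho> p)"
  proof
    fix q assume q: "q \<in> S"
    show "q \<in> (\<Union>p\<in>F. cyl \<rho> p)"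
    proof (rule ccontr)
      assume "q \<notin> (\<Union>p\<in>F. cyl \<rho> p)"
      then have far: "\<rho> \<le> parabolic_dist p q" if "p \<in> F" for p
        using that q \<rho> by (auto simp: cyl_def in_parabolic_cylinder_iff not_less)
      then have "sep (insert q F)"
        using F q by (auto simp: sep_def pairwise_insert parabolic_dist_commute)
      moreover have "q \<notin> F" using far \<rho> by (fastforce simp: parabolic_dist_eq_0_iff[THEN iffD2])
      ultimately show False using max[of "insert q F"] F by (simp add: sep_def)
    qed
  qed
  then show ?thesis using F card[OF F] that by (auto simp: sep_def c_def)
qed

lemma L2_norm_sq_cover:
  assumes "square_integrable S f" "finite F" "S \<subseteq> (\<Union>p\<in>F. cyl \<rho> p)"
  shows "L2_norm_sq S f \<le> (\<Sum>p\<in>F. L2_norm_sq (cyl \<rho> p) f)"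
proof -
  have iS: "integrable lebesgue (\<lambda>q. indicat_real S q *\<^sub>R (f q)\<^sup>2)"
    using assms sets_S square_integrable_iff by blast
  have iD: "integrable lebesgue (\<lambda>q. indicat_real (cyl \<rho> p) q *\<^sub>R (f q)\<^sup>2)" for p
    using square_integrable_subset(1)[OF assms(1) cyl_subset cyl_sets sets_S] cyl_sets square_integrable_iff
    by blast
  have "L2_norm_sq S f \<le> (\<integral>q. (\<Sum>p\<in>F. indicat_real (cyl \<rho> p) q *\<^sub>R (f q)\<^sup>2) \<partial>lebesgue)"
    unfolding L2_norm_sq_eq[OF sets_S]
  proof (rule Bochner_Integration.integral_mono)
    fix q
    have nn: "0 \<le> (\<Sum>p\<in>F. indicat_real (cyl \<rho> p) q *\<^sub>R (f q)\<^sup>2)" by (intro sum_nonneg) auto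
    show "indicat_real S q *\<^sub>R (f q)\<^sup>2 \<le> (\<Sum>p\<in>F. indicat_real (cyl \<rho> p) q *\<^sub>R (f q)\<^sup>2)"
    proof (cases "q \<in> S")
      case True
      then obtain p where p: "p \<in> F" "q \<in> cyl \<rho> p" using assms(3) by blast
      have "indicat_real (cyl \<rho> p) q *\<^sub>R (f q)\<^sup>2 \<le> (\<Sum>p\<in>F. indicat_real (cyl \<rho> p) q *\<^sub>R (f q)\<^sup>2)"
        using assms(2) p by (intro member_le_sum) auto
      then show ?thesis using True p by simp
    qed (use nn in simp)
  qed (use iS iD in auto)
  also have "\<dots> = (\<Sum>p\<in>F. L2_norm_sq (cyl \<rho> p) f)"
    using iD by (simp add: L2_norm_sq_eq[OF cyl_sets])
  finally show ?thesis .
qed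

text \<open>
  Pointwise information is obtained from bounds at every scale by summation instead of
  differentiation: the total measure of the covering cylinders is bounded, so the integral over all
  of \<open>S\<close> is at most of the order \<open>\<epsilon> k\<close>.
\<close>

lemma ae_zero_if_small_on_cylinders:
  assumes f: "square_integrable S f"
    and \<rho>: "\<And>k. 0 < \<rho> k" "\<And>k. \<rho> k \<le> r0" and \<epsilon>: "\<epsilon> \<longlonglongrightarrow> 0"
    and small: "\<And>k p. p \<in> S \<Longrightarrow> L2_norm_sq (cyl (\<rho> k) p) f \<le> \<epsilon> k * vol (\<rho> k)"
  shows "AE q in lebesgue_on S. f q = 0"
proof -
  define C where "C = 2 ^ (DIM('a) + 2) / \<kappa> ^ Suc DIM('a) * measure lebesgue S"
  have "L2_norm_sq S f \<le> C * \<bar>\<epsilon> k\<bar>" for k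
  proof -
    obtain F where F: "finite F" "F \<subseteq> S" "S \<subseteq> (\<Union>p\<in>F. cyl (\<rho> k) p)"
      and card: "real (card F) * (\<kappa> ^ Suc DIM('a) * vol (\<rho> k / 2)) \<le> measure lebesgue S"
      using finite_cover[OF \<rho>] by blast
    have "L2_norm_sq S f \<le> (\<Sum>p\<in>F. L2_norm_sq (cyl (\<rho> k) p) f)"
      by (rule L2_norm_sq_cover[OF f F(1,3)])
    also have "\<dots> \<le> (\<Sum>p\<in>F. \<bar>\<epsilon> k\<bar> * vol (\<rho> k))"
    proof (rule sum_mono)
      fix p assume "p \<in> F"
      then have "L2_norm_sq (cyl (\<rho> k) p) f \<le> \<epsilon> k * vol (\<rho> k)" using small F by blast
      also have "\<dots> \<le> \<bar>\<epsilon> k\<bar> * vol (\<rho> k)"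
        using vol_pos[OF \<rho>(1)] by (intro mult_right_mono) (auto simp: less_imp_le)
      finally show "L2_norm_sq (cyl (\<rho> k) p) f \<le> \<bar>\<epsilon> k\<bar> * vol (\<rho> k)" .
    qed
    also have "\<dots> = \<bar>\<epsilon> k\<bar> * (2 ^ (DIM('a) + 2) / \<kappa> ^ Suc DIM('a)) *
        (real (card F) * (\<kappa> ^ Suc DIM('a) * vol (\<rho> k / 2)))"
      using \<kappa>_pos by (simp add: vol_half[of "\<rho> k"])
    also have "\<dots> \<le> \<bar>\<epsilon> k\<bar> * (2 ^ (DIM('a) + 2) / \<kappa> ^ Suc DIM('a)) * measure lebesgue S"
      using card \<kappa>_pos by (intro mult_left_mono) auto
    finally show ?thesis by (simp add: C_def mult_ac)
  qed
  moreover have "(\<lambda>k. C * \<bar>\<epsilon> k\<bar>) \<longlonglongrightarrow> C * \<bar>0\<bar>" by (intro tendsto_intros \<epsilon>)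
  ultimately have "L2_norm_sq S f \<le> 0"
    by (intro tendsto_lowerbound[where F = sequentially]) auto
  then have "L2_norm_sq S f = 0" using L2_norm_sq_nonneg by (rule antisym)
  then have "(\<integral>q. (f q)\<^sup>2 \<partial>lebesgue_on S) = 0" by (simp only: L2_norm_sq_def)
  then have "AE q in lebesgue_on S. (f q)\<^sup>2 = 0"
    using f by (subst (asm) integral_nonneg_eq_0_iff_AE) (auto simp: square_integrable_def)
  then show ?thesis by simp
qed

end

section \<open>The Campanato iteration\<close>

lemma geometric_telescope:
  fixes X :: "nat \<Rightarrow> 'b::banach"
  assumes \<theta>: "0 \<le> \<theta>" "\<theta> < 1" and step: "\<And>k. norm (X (Suc k) - X k) \<le> c * \<theta> ^ k"
  shows "convergent X" and "norm (lim X - X k) \<le> c * \<theta> ^ k / (1 - \<theta>)"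
proof -
  have sm: "summable (\<lambda>i. c * \<theta> ^ i)" using \<theta> by (intro summable_mult summable_geometric) auto
  have "summable (\<lambda>i. X (Suc i) - X i)"
    by (rule summable_comparison_test'[OF sm, of 0]) (use step in auto)
  then have "(\<lambda>n. \<Sum>i<n. X (Suc i) - X i) \<longlonglongrightarrow> (\<Sum>i. X (Suc i) - X i)"
    by (rule summable_LIMSEQ)
  then have "(\<lambda>n. X n - X 0) \<longlonglongrightarrow> (\<Sum>i. X (Suc i) - X i)"
    by (simp add: sum_lessThan_telescope)
  then have "(\<lambda>n. (X n - X 0) + X 0) \<longlonglongrightarrow> (\<Sum>i. X (Suc i) - X i) + X 0"
    by (intro tendsto_intros)
  then show conv: "convergent X" by (auto simp: convergent_def)
  then have lim: "X \<longlonglongrightarrow> lim X" by (simp add: convergent_LIMSEQ_iff)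
  have c: "0 \<le> c" using order_trans[OF norm_ge_zero step[of 0]] by simp
  have "norm (X (n + k) - X k) \<le> c * \<theta> ^ k / (1 - \<theta>)" for n
  proof -
    have "X (n + k) - X k = (\<Sum>i<n. X (Suc i + k) - X (i + k))"
      using sum_lessThan_telescope[of "\<lambda>i. X (i + k)" n] by simp
    also have "norm \<dots> \<le> (\<Sum>i<n. c * \<theta> ^ k * \<theta> ^ i)"
    proof (rule sum_norm_le)
      fix i show "norm (X (Suc i + k) - X (i + k)) \<le> c * \<theta> ^ k * \<theta> ^ i"
        using step[of "i + k"] by (simp add: power_add mult_ac)
    qed
    also have "\<dots> = c * \<theta> ^ k * (\<Sum>i<n. \<theta> ^ i)" by (simp add: sum_distrib_left)
    also have "(\<Sum>i<n. \<theta> ^ i) \<le> (\<Sum>i. \<theta> ^ i)"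
      using \<theta> by (intro sum_le_suminf summable_geometric) auto
    also have "(\<Sum>i. \<theta> ^ i) = 1 / (1 - \<theta>)" using \<theta> by (intro suminf_geometric) auto
    finally show ?thesis using c \<theta> by (simp add: mult_left_mono)
  qed
  moreover have "(\<lambda>n. norm (X (n + k) - X k)) \<longlonglongrightarrow> norm (lim X - X k)"
    by (intro tendsto_intros LIMSEQ_ignore_initial_segment lim)
  ultimately show "norm (lim X - X k) \<le> c * \<theta> ^ k / (1 - \<theta>)"
    by (intro tendsto_upperbound[where F = sequentially]) auto
qed

context cylinder_domain
begin

definition fits :: "(real \<times> 'a \<Rightarrow> real) \<Rightarrow> real \<Rightarrow> real \<Rightarrow> real \<times> 'a \<Rightarrow> real \<Rightarrow> 'a \<Rightarrow> bool" where
  "fits u e r p a A \<longleftrightarrow> L2_norm_sq (cyl r p) (\<lambda>q. u q - affine_at a A p q) \<le> e\<^sup>2 * csize r p"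

definition compare_const :: real where
  "compare_const = sqrt (coeff_const * (2 + 2 * (2 ^ (DIM('a) + 2) / \<kappa> ^ Suc DIM('a))))"

lemma compare_const_sq: "compare_const\<^sup>2 = coeff_const * (2 + 2 * (2 ^ (DIM('a) + 2) / \<kappa> ^ Suc DIM('a)))"
  unfolding compare_const_def using coeff_const_pos \<kappa>_pos by (intro real_sqrt_pow2) simp

lemma compare_const_pos: "0 < compare_const"
  unfolding compare_const_def using coeff_const_pos \<kappa>_pos
  by (intro real_sqrt_gt_zero mult_pos_pos add_pos_pos divide_pos_pos) auto

lemma residual_square_integrable:
  assumes "square_integrable S u"
  shows "square_integrable (cyl r p') (\<lambda>q. u q - affine_at a A p q)"
  using assms square_integrable_subset(1)[OF _ cyl_subset cyl_sets sets_S]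
  by (intro square_integrable_diff(1) affine_at_square_integrable) auto

text \<open>
  The difference of the two fits is affine, and its mean square on the smaller cylinder is small,
  because the measures of both cylinders are comparable. Hence its coefficients are small.
\<close>

lemma fits_compare:
  assumes u: "square_integrable S u" and p: "p \<in> closure S" and q: "q \<in> closure S"
    and r: "0 < r" "r \<le> r0" and near: "parabolic_dist p q < r / 2"
    and fit_p: "fits u e r p a A" and fit_q: "fits u e' (r / 2) q b B" and e: "0 \<le> e'" "e' \<le> e"
  shows "\<bar>affine_at a A p q - b\<bar> + r / 2 * norm (A - B) \<le> compare_const * e"
proof -
  let ?D = "cyl (r / 2) q" and ?X = "\<bar>affine_at a A p q - b\<bar> + r / 2 * norm (A - B)"
  have r2: "0 < r / 2" "r / 2 \<le> r0" using r by auto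
  have size: "0 < csize (r / 2) q" by (rule size_pos[OF q r2])
  have sub: "?D \<subseteq> cyl r p" by (rule cyl_mono[OF r(1) near])
  have sq: "square_integrable D' (\<lambda>w. u w - affine_at b B q w)"
    "square_integrable D' (\<lambda>w. u w - affine_at a A p w)" if "D' = ?D \<or> D' = cyl r p" for D'
    using that residual_square_integrable[OF u, of "r / 2" q b B q]
      residual_square_integrable[OF u, of r p b B q]
      residual_square_integrable[OF u, of "r / 2" q a A p]
      residual_square_integrable[OF u, of r p a A p] by blast+
  have "csize r p \<le> 2 ^ (DIM('a) + 2) * vol (r / 2)"
    using size_le_vol[OF r(1), of p] vol_half[of r] by simp
  also have "\<dots> = 2 ^ (DIM('a) + 2) / \<kappa> ^ Suc DIM('a) * (\<kappa> ^ Suc DIM('a) * vol (r / 2))"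
    using \<kappa>_pos by simp
  also have "\<dots> \<le> 2 ^ (DIM('a) + 2) / \<kappa> ^ Suc DIM('a) * csize (r / 2) q"
    using vol_le_size[OF q r2] \<kappa>_pos by (intro mult_left_mono) auto
  finally have ratio: "csize r p \<le> 2 ^ (DIM('a) + 2) / \<kappa> ^ Suc DIM('a) * csize (r / 2) q" .
  have "L2_norm_sq ?D (\<lambda>w. u w - affine_at b B q w) \<le> e'\<^sup>2 * csize (r / 2) q"
    using fit_q by (simp add: fits_def)
  also have "\<dots> \<le> e\<^sup>2 * csize (r / 2) q" using e by (intro mult_right_mono power_mono) auto
  finally have 1: "L2_norm_sq ?D (\<lambda>w. u w - affine_at b B q w) \<le> e\<^sup>2 * csize (r / 2) q" .
  have "L2_norm_sq ?D (\<lambda>w. u w - affine_at a A p w) \<le> L2_norm_sq (cyl r p) (\<lambda>w. u w - affine_at a A p w)"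
    by (rule square_integrable_subset(2)[OF _ sub cyl_sets cyl_sets]) (simp add: sq)
  also have "\<dots> \<le> e\<^sup>2 * csize r p" using fit_p by (simp add: fits_def)
  also have "\<dots> \<le> e\<^sup>2 * (2 ^ (DIM('a) + 2) / \<kappa> ^ Suc DIM('a) * csize (r / 2) q)"
    by (intro mult_left_mono ratio) auto
  finally have 2: "L2_norm_sq ?D (\<lambda>w. u w - affine_at a A p w)
      \<le> e\<^sup>2 * (2 ^ (DIM('a) + 2) / \<kappa> ^ Suc DIM('a) * csize (r / 2) q)" .
  have eq: "affine_at (affine_at a A p q - b) (A - B) q
      = (\<lambda>w. (u w - affine_at b B q w) - (u w - affine_at a A p w))"
  proof
    fix w show "affine_at (affine_at a A p q - b) (A - B) q w
        = (u w - affine_at b B q w) - (u w - affine_at a A p w)"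
      using affine_at_diff[of a A p w b B q] by linarith
  qed
  have "?X\<^sup>2 * csize (r / 2) q \<le> coeff_const * L2_norm_sq ?D (affine_at (affine_at a A p q - b) (A - B) q)"
    by (rule affine_coefficients_le[OF q r2])
  also have "\<dots> \<le> coeff_const * (2 * L2_norm_sq ?D (\<lambda>w. u w - affine_at b B q w)
      + 2 * L2_norm_sq ?D (\<lambda>w. u w - affine_at a A p w))"
    unfolding eq using coeff_const_pos square_integrable_diff(2)[OF sq(1)[of ?D] sq(2)[of ?D]]
    by (intro mult_left_mono) simp_all
  also have "\<dots> \<le> coeff_const * (2 * (e\<^sup>2 * csize (r / 2) q)
      + 2 * (e\<^sup>2 * (2 ^ (DIM('a) + 2) / \<kappa> ^ Suc DIM('a) * csize (r / 2) q)))"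
    using coeff_const_pos 1 2 by (intro mult_left_mono add_mono) auto
  also have "\<dots> = (compare_const * e)\<^sup>2 * csize (r / 2) q"
    by (simp add: compare_const_sq power_mult_distrib algebra_simps)
  finally have "?X\<^sup>2 \<le> (compare_const * e)\<^sup>2" using size by simp
  then show ?thesis
    by (rule power2_le_imp_le) (use compare_const_pos e in simp)
qed

end

locale campanato_exponent = cylinder_domain S r0 \<kappa>
  for S :: "(real \<times> 'a::euclidean_space) set" and r0 \<kappa> :: real +
  fixes \<gamma> :: real
  assumes \<gamma>_pos: "0 < \<gamma>"
begin

lemma ratio: "0 \<le> 2 powr - \<gamma>" "2 powr - \<gamma> < 1"
  using \<gamma>_pos by (auto simp: powr_less_one)

text \<open>
  The sums of the geometric series that are formed by the changes of the values and of the slopes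
  from one scale to the next. Slopes occur only for \<open>1 < \<gamma>\<close>, where the second series converges.
\<close>

definition value_const :: real where
  "value_const = compare_const / (1 - 2 powr - \<gamma>)"

definition slope_const :: real where
  "slope_const = (if 1 < \<gamma> then 2 * compare_const / (1 - 2 powr (1 - \<gamma>)) else 0)"

lemma value_const_nonneg: "0 \<le> value_const"
  using compare_const_pos ratio by (simp add: value_const_def)

lemma slope_const_nonneg: "0 \<le> slope_const"
  using compare_const_pos by (simp add: slope_const_def powr_less_one less_imp_le)

definition coarse_const :: real where
  "coarse_const = sqrt (2 * coeff_const) * (1 / sqrt (\<kappa> ^ Suc DIM('a) * vol r0) + r0 powr \<gamma>)"

lemma coarse_const_pos: "0 < coarse_const"
  using coeff_const_pos r0_pos \<kappa>_pos vol_pos[OF r0_pos]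
  by (simp add: coarse_const_def add_pos_pos)

definition sup_const :: real where
  "sup_const = coarse_const + value_const * r0 powr \<gamma> + (coarse_const + slope_const * r0 powr \<gamma>) / r0"

lemma sup_const_nonneg: "0 \<le> sup_const"
  using coarse_const_pos value_const_nonneg slope_const_nonneg r0_pos by (simp add: sup_const_def)

text \<open>
  The first summand belongs to pairs of points at a distance less than \<open>r0 / 2\<close>, which are compared
  at a scale of the order of their distance; the second one to all other pairs, for which the bounds on \<open>v\<close> and \<open>G\<close> suffice.
  The same holds for \<open>gradient_const\<close>.
\<close>

definition taylor_const :: real where
  "taylor_const = (compare_const + 2 * value_const + slope_const) * 4 powr \<gamma>
     + sup_const * (2 + r0 / 2) * (2 / r0) powr \<gamma>"

lemma taylor_const_nonneg: "0 \<le> taylor_const"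
  using compare_const_pos value_const_nonneg slope_const_nonneg sup_const_nonneg r0_pos
  by (simp add: taylor_const_def)

definition gradient_const :: real where
  "gradient_const = (2 * compare_const + 2 * slope_const) * 4 powr (\<gamma> - 1)
     + 2 * sup_const * (2 / r0) powr (\<gamma> - 1)"

lemma gradient_const_nonneg: "0 \<le> gradient_const"
  using compare_const_pos slope_const_nonneg sup_const_nonneg r0_pos by (simp add: gradient_const_def)

end

text \<open>
  Both parts of the theorem follow from one iteration. For constants, all slopes vanish and
  \<open>\<gamma>\<close> is \<open>\<beta>\<close>; for affine functions, \<open>\<gamma> = 1 + \<beta> > 1\<close> makes the slopes converge.
\<close>

locale campanato_fits = campanato_exponent S r0 \<kappa> \<gamma>
  for S :: "(real \<times> 'a::euclidean_space) set" and r0 \<kappa> \<gamma> :: real +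
  fixes u :: "real \<times> 'a \<Rightarrow> real" and E :: real
    and a :: "real \<times> 'a \<Rightarrow> nat \<Rightarrow> real" and A :: "real \<times> 'a \<Rightarrow> nat \<Rightarrow> 'a"
  assumes u: "square_integrable S u" and E_pos: "0 < E"
    and slopes: "1 < \<gamma> \<or> (\<forall>p k. A p k = 0)"
    and fit: "\<And>p k. p \<in> closure S \<Longrightarrow> fits u (E * (r0 / 2 ^ k) powr \<gamma>) (r0 / 2 ^ k) p (a p k) (A p k)"
begin

definition \<rho> :: "nat \<Rightarrow> real" where "\<rho> k = r0 / 2 ^ k"
definition e :: "nat \<Rightarrow> real" where "e k = E * \<rho> k powr \<gamma>"
definition v :: "real \<times> 'a \<Rightarrow> real" where "v p = lim (a p)"
definition G :: "real \<times> 'a \<Rightarrow> 'a" where "G p = lim (A p)"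

lemma \<rho>_pos: "0 < \<rho> k" and \<rho>_le: "\<rho> k \<le> r0" and \<rho>_Suc: "\<rho> (Suc k) = \<rho> k / 2" and \<rho>_0: "\<rho> 0 = r0"
proof -
  have "(1::real) \<le> 2 ^ k" by simp
  then show "\<rho> k \<le> r0" using r0_pos unfolding \<rho>_def by (simp add: divide_le_eq mult_le_cancel_left1)
qed (use r0_pos in \<open>simp_all add: \<rho>_def\<close>)

lemma e_pos: "0 < e k"
  using E_pos \<rho>_pos[of k] by (simp add: e_def)

lemma e_eq: "e k = e 0 * (2 powr - \<gamma>) ^ k"
proof -
  have "\<rho> k powr \<gamma> = r0 powr \<gamma> / (2 ^ k) powr \<gamma>"
    unfolding \<rho>_def using r0_pos by (simp add: powr_divide)
  also have "(2 ^ k) powr \<gamma> = (2 powr \<gamma>) ^ k"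
    by (simp add: powr_powr powr_power mult.commute flip: powr_realpow)
  also have "r0 powr \<gamma> / (2 powr \<gamma>) ^ k = r0 powr \<gamma> * (2 powr - \<gamma>) ^ k"
    by (simp add: powr_minus power_inverse divide_inverse)
  finally show ?thesis by (simp add: e_def \<rho>_0)
qed

lemma e_over_\<rho>_eq: "e k / \<rho> k = e 0 / r0 * (2 powr (1 - \<gamma>)) ^ k"
proof -
  have base: "2 powr - \<gamma> * 2 = 2 powr (1 - \<gamma>)"
    by (simp add: powr_diff powr_minus divide_inverse)
  have "e k / \<rho> k = e 0 / r0 * ((2 powr - \<gamma>) ^ k * 2 ^ k)"
    unfolding e_eq[of k] \<rho>_def by simp
  also have "(2 powr - \<gamma>) ^ k * 2 ^ k = (2 powr (1 - \<gamma>)) ^ k"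
    unfolding base[symmetric] by (simp only: power_mult_distrib)
  finally show ?thesis .
qed

lemma e_Suc_le: "e (Suc k) \<le> e k"
proof -
  have "e (Suc k) = 2 powr - \<gamma> * e k" unfolding e_eq[of "Suc k"] e_eq[of k] by simp
  also have "\<dots> \<le> 1 * e k" using ratio e_pos[of k] by (intro mult_right_mono) auto
  finally show ?thesis by simp
qed

lemma fit_\<rho>: "p \<in> closure S \<Longrightarrow> fits u (e k) (\<rho> k) p (a p k) (A p k)"
  using fit by (simp add: e_def \<rho>_def)

text \<open>
  The two cases needed are \<open>q = p\<close>, which gives convergence along the scales, and \<open>q\<close> near \<open>p\<close>, which
  gives the regularity of the limits.
\<close>

lemma compare_levels:
  assumes "p \<in> closure S" "q \<in> closure S" "parabolic_dist p q < \<rho> k / 2"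
  shows "\<bar>a q (Suc k) - affine_at (a p k) (A p k) p q\<bar> \<le> compare_const * e k"
    and "norm (A q (Suc k) - A p k) \<le> 2 * compare_const * (e k / \<rho> k)"
proof -
  have *: "\<bar>affine_at (a p k) (A p k) p q - a q (Suc k)\<bar> + \<rho> k / 2 * norm (A p k - A q (Suc k))
      \<le> compare_const * e k"
    using assms fit_\<rho>[of p k] fit_\<rho>[of q "Suc k"] e_Suc_le e_pos[of "Suc k"]
    by (intro fits_compare[OF u]) (auto simp: \<rho>_pos \<rho>_le \<rho>_Suc)
  have nn: "0 \<le> \<rho> k / 2 * norm (A p k - A q (Suc k))" using \<rho>_pos[of k] by simp
  show "\<bar>a q (Suc k) - affine_at (a p k) (A p k) p q\<bar> \<le> compare_const * e k"
    using * nn by (simp add: abs_minus_commute)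
  have "\<rho> k / 2 * norm (A p k - A q (Suc k)) \<le> compare_const * e k"
    using * by linarith
  then show "norm (A q (Suc k) - A p k) \<le> 2 * compare_const * (e k / \<rho> k)"
    using \<rho>_pos[of k] by (simp add: norm_minus_commute field_simps)
qed

lemma parabolic_dist_self: "parabolic_dist p p < \<rho> k / 2"
  using \<rho>_pos[of k] by (simp add: parabolic_dist_eq)

lemma v_approx:
  assumes "p \<in> closure S"
  shows "\<bar>v p - a p k\<bar> \<le> value_const * e k"
proof -
  have "norm (a p (Suc k) - a p k) \<le> (compare_const * e 0) * (2 powr - \<gamma>) ^ k" for k
    using compare_levels(1)[OF assms assms parabolic_dist_self, of k] by (simp add: e_eq[of k])
  from geometric_telescope(2)[OF ratio this, of k] show ?thesis
    by (simp add: v_def value_const_def e_eq[of k])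
qed

lemma G_approx:
  assumes "p \<in> closure S"
  shows "norm (G p - A p k) \<le> slope_const * (e k / \<rho> k)"
proof (cases "1 < \<gamma>")
  case True
  have "norm (A p (Suc k) - A p k) \<le> (2 * compare_const * (e 0 / r0)) * (2 powr (1 - \<gamma>)) ^ k" for k
    using compare_levels(2)[OF assms assms parabolic_dist_self, of k] unfolding e_over_\<rho>_eq[of k]
    by (simp only: mult.assoc)
  from geometric_telescope(2)[OF _ _ this, of k] True show ?thesis
    by (simp add: G_def slope_const_def e_over_\<rho>_eq[of k] powr_less_one mult_ac)
next
  case False
  then have "A p k = 0" for k using slopes by blast
  then have "A p = (\<lambda>k. 0)" by (intro ext)
  then show ?thesis using False by (simp add: G_def slope_const_def)
qed

lemma G_zero: "(\<And>k. A p k = 0) \<Longrightarrow> G p = 0"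
proof -
  assume "\<And>k. A p k = 0"
  then have "A p = (\<lambda>k. 0)" by (intro ext)
  then show "G p = 0" by (simp add: G_def)
qed

lemma v_near_affine:
  assumes "p \<in> closure S" "q \<in> closure S" "parabolic_dist p q < \<rho> k / 2"
  shows "\<bar>v q - affine_at (a p k) (A p k) p q\<bar> \<le> (compare_const + value_const) * e k"
proof -
  have "\<bar>v q - a q (Suc k)\<bar> \<le> value_const * e (Suc k)" by (rule v_approx[OF assms(2)])
  also have "\<dots> \<le> value_const * e k" by (intro mult_left_mono e_Suc_le value_const_nonneg)
  finally show ?thesis using compare_levels(1)[OF assms] by (simp add: algebra_simps)
qed

lemma taylor_at_scale:
  assumes "p \<in> closure S" "q \<in> closure S" "parabolic_dist p q < \<rho> k / 2"
  shows "\<bar>v q - v p - G p \<bullet> (snd q - snd p)\<bar> \<le> (compare_const + 2 * value_const + slope_const) * e k"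
proof -
  have "norm (snd q - snd p) \<le> \<rho> k"
    using parabolic_dist_space[of p q] assms(3) \<rho>_pos[of k] by (simp add: norm_minus_commute)
  then have "\<bar>(G p - A p k) \<bullet> (snd q - snd p)\<bar> \<le> slope_const * (e k / \<rho> k) * \<rho> k"
    using G_approx[OF assms(1), of k] slope_const_nonneg e_pos[of k] \<rho>_pos[of k]
    by (intro order_trans[OF Cauchy_Schwarz_ineq2] mult_mono) auto
  then have "\<bar>(G p - A p k) \<bullet> (snd q - snd p)\<bar> \<le> slope_const * e k"
    using \<rho>_pos[of k] by simp
  moreover have "v q - v p - G p \<bullet> (snd q - snd p) =
      (v q - affine_at (a p k) (A p k) p q) - (v p - a p k) - (G p - A p k) \<bullet> (snd q - snd p)"
    by (simp add: affine_at_def inner_diff_left)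
  ultimately show ?thesis
    using v_near_affine[OF assms] v_approx[OF assms(1), of k] by (simp add: algebra_simps)
qed

lemma G_at_scale:
  assumes "p \<in> closure S" "q \<in> closure S" "parabolic_dist p q < \<rho> k / 2" "1 < \<gamma>"
  shows "norm (G q - G p) \<le> (2 * compare_const + 2 * slope_const) * (e k / \<rho> k)"
proof -
  have "e (Suc k) / \<rho> (Suc k) = (e k / \<rho> k) * 2 powr (1 - \<gamma>)"
    unfolding e_over_\<rho>_eq[of "Suc k"] e_over_\<rho>_eq[of k] by simp
  also have "\<dots> \<le> (e k / \<rho> k) * 1"
    using assms(4) e_pos[of k] \<rho>_pos[of k] by (intro mult_left_mono) (auto simp: powr_less_one less_imp_le)
  finally have "slope_const * (e (Suc k) / \<rho> (Suc k)) \<le> slope_const * (e k / \<rho> k)"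
    using slope_const_nonneg by (intro mult_left_mono) auto
  then have 1: "norm (G q - A q (Suc k)) \<le> slope_const * (e k / \<rho> k)"
    using G_approx[OF assms(2), of "Suc k"] by linarith
  have 2: "norm (A q (Suc k) - A p k) \<le> 2 * compare_const * (e k / \<rho> k)"
    by (rule compare_levels(2)[OF assms(1-3)])
  have 3: "norm (A p k - G p) \<le> slope_const * (e k / \<rho> k)"
    using G_approx[OF assms(1), of k] by (simp add: norm_minus_commute)
  have "G q - G p = (G q - A q (Suc k)) + (A q (Suc k) - A p k) + (A p k - G p)" by simp
  then have "norm (G q - G p) \<le> norm (G q - A q (Suc k)) + norm (A q (Suc k) - A p k) + norm (A p k - G p)"
    by (metis norm_triangle_mono order_refl norm_triangle_ineq)
  then show ?thesis using 1 2 3 by (simp add: algebra_simps)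
qed

text \<open>
  At this scale the cylinder around \<open>p\<close> contains one of half the radius around \<open>q\<close>, and the errors
  are of the order of a power of the distance.
\<close>

lemma scale_of_distance:
  assumes "0 < d" "d < r0 / 2"
  obtains k where "d < \<rho> k / 2" "\<rho> k \<le> 4 * d"
proof -
  have "\<exists>k. \<rho> k \<le> 4 * d"
  proof -
    obtain k where "r0 / (4 * d) < 2 ^ k" using real_arch_pow[of 2 "r0 / (4 * d)"] by auto
    then have "\<rho> k \<le> 4 * d" using assms by (simp add: \<rho>_def field_simps)
    then show ?thesis ..
  qed
  then have l: "\<rho> (LEAST k. \<rho> k \<le> 4 * d) \<le> 4 * d" by (rule LeastI_ex)
  moreover have "d < \<rho> (LEAST k. \<rho> k \<le> 4 * d) / 2"
  proof (cases "LEAST k. \<rho> k \<le> 4 * d")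
    case 0
    then show ?thesis using assms by (simp add: \<rho>_0)
  next
    case (Suc j)
    then have "\<not> \<rho> j \<le> 4 * d" using not_less_Least[of j "\<lambda>k. \<rho> k \<le> 4 * d"] by simp
    then show ?thesis using Suc by (simp add: \<rho>_Suc)
  qed
  ultimately show ?thesis by (rule that[rotated])
qed

definition total :: real where
  "total = E + sqrt (L2_norm_sq S u)"

lemma total_ge: "E \<le> total" "sqrt (L2_norm_sq S u) \<le> total" "0 < total"
  using E_pos L2_norm_sq_nonneg[of S u] by (auto simp: total_def add_pos_nonneg)

text \<open>
  At the largest scale there is nothing to compare with, and the fit is bounded by \<open>u\<close> itself and the
  error.
\<close>

lemma coarse_coefficients:
  assumes p: "p \<in> closure S"
  shows "\<bar>a p 0\<bar> + r0 * norm (A p 0) \<le> coarse_const * total"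
proof -
  let ?X = "\<bar>a p 0\<bar> + r0 * norm (A p 0)" and ?D = "cyl r0 p" and ?c = "\<kappa> ^ Suc DIM('a) * vol r0"
  have size: "0 < csize r0 p" "?c \<le> csize r0 p"
    using size_pos[OF p] vol_le_size[OF p] r0_pos by auto
  have c: "0 < ?c" using \<kappa>_pos vol_pos[OF r0_pos] by simp
  have eq: "affine_at (a p 0) (A p 0) p = (\<lambda>w. u w - (u w - affine_at (a p 0) (A p 0) p w))" by simp
  have uD: "square_integrable ?D u" "L2_norm_sq ?D u \<le> L2_norm_sq S u"
    using square_integrable_subset[OF u cyl_subset cyl_sets sets_S] by auto
  have "?X\<^sup>2 * csize r0 p \<le> coeff_const * L2_norm_sq ?D (affine_at (a p 0) (A p 0) p)"
    using r0_pos by (intro affine_coefficients_le[OF p]) auto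
  also have "\<dots> \<le> coeff_const * (2 * L2_norm_sq ?D u
      + 2 * L2_norm_sq ?D (\<lambda>w. u w - affine_at (a p 0) (A p 0) p w))"
    using coeff_const_pos uD(1) residual_square_integrable[OF u]
    by (subst eq) (intro mult_left_mono square_integrable_diff(2), auto)
  also have "\<dots> \<le> coeff_const * (2 * L2_norm_sq S u + 2 * ((e 0)\<^sup>2 * csize r0 p))"
    using coeff_const_pos uD(2) fit_\<rho>[OF p, of 0] by (intro mult_left_mono) (auto simp: fits_def \<rho>_0)
  also have "\<dots> \<le> coeff_const * (2 * (L2_norm_sq S u / ?c * csize r0 p) + 2 * ((e 0)\<^sup>2 * csize r0 p))"
  proof -
    have "L2_norm_sq S u = L2_norm_sq S u / ?c * ?c" using c by (metis less_irrefl nonzero_eq_divide_eq)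
    also have "\<dots> \<le> L2_norm_sq S u / ?c * csize r0 p"
      using size(2) c L2_norm_sq_nonneg by (intro mult_left_mono divide_nonneg_pos) auto
    finally show ?thesis using coeff_const_pos by (intro mult_left_mono) auto
  qed
  also have "\<dots> = (2 * coeff_const * (L2_norm_sq S u / ?c + (e 0)\<^sup>2)) * csize r0 p"
    by (simp add: algebra_simps)
  finally have "?X\<^sup>2 \<le> 2 * coeff_const * (L2_norm_sq S u / ?c + (e 0)\<^sup>2)"
    using size(1) by (rule mult_right_le_imp_le)
  then have "?X \<le> sqrt (2 * coeff_const * (L2_norm_sq S u / ?c + (e 0)\<^sup>2))" by (rule real_le_rsqrt)
  also have "\<dots> = sqrt (2 * coeff_const) * sqrt (L2_norm_sq S u / ?c + (e 0)\<^sup>2)" by (rule real_sqrt_mult)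
  also have "\<dots> \<le> sqrt (2 * coeff_const) * (sqrt (L2_norm_sq S u / ?c) + sqrt ((e 0)\<^sup>2))"
    using coeff_const_pos divide_nonneg_pos[OF L2_norm_sq_nonneg c]
    by (intro mult_left_mono sqrt_add_le_add_sqrt) auto
  also have "\<dots> = sqrt (2 * coeff_const) * (sqrt (L2_norm_sq S u) * (1 / sqrt ?c) + E * r0 powr \<gamma>)"
    using e_pos[of 0] by (simp add: real_sqrt_divide e_def \<rho>_0)
  also have "\<dots> \<le> sqrt (2 * coeff_const) * (total * (1 / sqrt ?c) + total * r0 powr \<gamma>)"
    using coeff_const_pos c total_ge by (intro mult_left_mono add_mono mult_right_mono) auto
  also have "\<dots> = coarse_const * total" by (simp add: coarse_const_def algebra_simps)
  finally show ?thesis .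
qed

lemma e_0_le: "e 0 \<le> r0 powr \<gamma> * total"
  unfolding e_def \<rho>_0 mult.commute[of E] using total_ge(1) by (intro mult_left_mono) auto

lemma v_bounded:
  assumes "p \<in> closure S"
  shows "\<bar>v p\<bar> \<le> sup_const * total"
proof -
  have "0 \<le> r0 * norm (A p 0)" using r0_pos by simp
  then have "\<bar>v p\<bar> \<le> coarse_const * total + value_const * e 0"
    using coarse_coefficients[OF assms] v_approx[OF assms, of 0] by linarith
  also have "\<dots> \<le> coarse_const * total + value_const * (r0 powr \<gamma> * total)"
    by (intro add_left_mono mult_left_mono e_0_le value_const_nonneg)
  also have "\<dots> = (coarse_const + value_const * r0 powr \<gamma>) * total" by (simp add: algebra_simps)
  also have "\<dots> \<le> sup_const * total"
    using total_ge coarse_const_pos slope_const_nonneg r0_pos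
    by (intro mult_right_mono) (auto simp: sup_const_def)
  finally show ?thesis .
qed

lemma G_bounded:
  assumes "p \<in> closure S"
  shows "norm (G p) \<le> sup_const * total"
proof -
  have "norm (G p) \<le> norm (A p 0) + norm (G p - A p 0)"
    using norm_triangle_sub[of "G p" "A p 0"] by simp
  also have "norm (A p 0) \<le> coarse_const * total / r0"
    using coarse_coefficients[OF assms] r0_pos by (simp add: field_simps)
  also have "norm (G p - A p 0) \<le> slope_const * (e 0 / r0)"
    using G_approx[OF assms, of 0] by (simp add: \<rho>_0)
  also have "slope_const * (e 0 / r0) \<le> slope_const * (r0 powr \<gamma> * total / r0)"
    using r0_pos by (intro mult_left_mono divide_right_mono e_0_le slope_const_nonneg) auto
  also have "coarse_const * total / r0 + slope_const * (r0 powr \<gamma> * total / r0)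
      = (coarse_const + slope_const * r0 powr \<gamma>) / r0 * total"
    by (simp add: add_divide_distrib algebra_simps)
  also have "\<dots> \<le> sup_const * total"
    using total_ge coarse_const_pos value_const_nonneg r0_pos
    by (intro mult_right_mono) (auto simp: sup_const_def)
  finally show ?thesis by simp
qed

lemma taylor:
  assumes p: "p \<in> closure S" and q: "q \<in> closure S"
  shows "\<bar>v q - v p - G p \<bullet> (snd q - snd p)\<bar> \<le> taylor_const * total * parabolic_dist p q powr \<gamma>"
proof -
  define d where "d = parabolic_dist p q"
  have d0: "0 \<le> d" by (simp add: d_def parabolic_dist_nonneg)
  have parts: "0 \<le> (compare_const + 2 * value_const + slope_const) * 4 powr \<gamma>"
      "0 \<le> sup_const * (2 + r0 / 2) * (2 / r0) powr \<gamma>"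
    using compare_const_pos value_const_nonneg slope_const_nonneg sup_const_nonneg r0_pos by auto
  consider "d = 0" | "0 < d" "d < r0 / 2" | "r0 / 2 \<le> d" using d0 by linarith
  then show ?thesis
  proof cases
    case 1
    then have "p = q" by (simp add: d_def parabolic_dist_eq_0_iff)
    then show ?thesis using taylor_const_nonneg total_ge by simp
  next
    case 2
    then obtain k where k: "d < \<rho> k / 2" "\<rho> k \<le> 4 * d" by (rule scale_of_distance)
    have "e k \<le> total * (4 * d) powr \<gamma>"
      unfolding e_def using k(2) \<rho>_pos[of k] total_ge \<gamma>_pos by (intro mult_mono powr_mono2) auto
    then have "e k \<le> 4 powr \<gamma> * total * d powr \<gamma>" by (simp add: powr_mult mult_ac)
    then have "\<bar>v q - v p - G p \<bullet> (snd q - snd p)\<bar>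
        \<le> (compare_const + 2 * value_const + slope_const) * (4 powr \<gamma> * total * d powr \<gamma>)"
      using compare_const_pos value_const_nonneg slope_const_nonneg
      by (intro order_trans[OF taylor_at_scale[OF p q k(1)[unfolded d_def]]] mult_left_mono) auto
    also have "\<dots> = (compare_const + 2 * value_const + slope_const) * 4 powr \<gamma> * total * d powr \<gamma>"
      by simp
    also have "\<dots> \<le> taylor_const * total * d powr \<gamma>"
      using parts(2) total_ge by (intro mult_right_mono) (auto simp: taylor_const_def)
    finally show ?thesis by (simp add: d_def)
  next
    case 3
    define x where "x = (2 / r0 * d) powr \<gamma>"
    have one: "1 \<le> 2 / r0 * d" using 3 r0_pos by (simp add: field_simps)
    have x1: "1 \<le> x" unfolding x_def using one \<gamma>_pos by (intro ge_one_powr_ge_zero) auto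
    have G: "\<bar>G p \<bullet> (snd q - snd p)\<bar> \<le> sup_const * total * (r0 / 2 * x)"
    proof (cases "1 < \<gamma>")
      case True
      have "(2 / r0 * d) powr 1 \<le> x"
        unfolding x_def using one True by (intro powr_mono) auto
      then have "d \<le> r0 / 2 * x" using one r0_pos by (simp add: field_simps)
      moreover have "norm (snd q - snd p) \<le> d"
        using parabolic_dist_space[of p q] by (simp add: d_def norm_minus_commute)
      ultimately have "norm (snd q - snd p) \<le> r0 / 2 * x" by linarith
      then show ?thesis using G_bounded[OF p] sup_const_nonneg total_ge
        by (intro order_trans[OF Cauchy_Schwarz_ineq2] mult_mono) auto
    next
      case False
      then have "G p = 0" using slopes by (intro G_zero) blast
      then show ?thesis using sup_const_nonneg total_ge x1 r0_pos by simp
    qed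
    have "\<bar>v q\<bar> \<le> sup_const * total * x" "\<bar>v p\<bar> \<le> sup_const * total * x"
      using v_bounded[OF p] v_bounded[OF q] mult_left_mono[OF x1, of "sup_const * total"]
        sup_const_nonneg total_ge by auto
    with G have "\<bar>v q - v p - G p \<bullet> (snd q - snd p)\<bar>
        \<le> sup_const * total * x + sup_const * total * x + sup_const * total * (r0 / 2 * x)"
      by linarith
    also have "\<dots> = sup_const * (2 + r0 / 2) * total * x" by (simp add: algebra_simps)
    finally have "\<bar>v q - v p - G p \<bullet> (snd q - snd p)\<bar> \<le> sup_const * (2 + r0 / 2) * total * x" .
    also have "x = (2 / r0) powr \<gamma> * d powr \<gamma>"
      unfolding x_def by (rule powr_mult)
    also have "sup_const * (2 + r0 / 2) * total * ((2 / r0) powr \<gamma> * d powr \<gamma>)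
        = sup_const * (2 + r0 / 2) * (2 / r0) powr \<gamma> * total * d powr \<gamma>" by simp
    also have "\<dots> \<le> taylor_const * total * d powr \<gamma>"
      using parts(1) total_ge by (intro mult_right_mono) (auto simp: taylor_const_def)
    finally show ?thesis by (simp add: d_def)
  qed
qed

lemma G_holder:
  assumes p: "p \<in> closure S" and q: "q \<in> closure S" and \<gamma>: "1 < \<gamma>"
  shows "norm (G q - G p) \<le> gradient_const * total * parabolic_dist p q powr (\<gamma> - 1)"
proof -
  define d where "d = parabolic_dist p q"
  have d0: "0 \<le> d" by (simp add: d_def parabolic_dist_nonneg)
  have parts: "0 \<le> (2 * compare_const + 2 * slope_const) * 4 powr (\<gamma> - 1)"
      "0 \<le> 2 * sup_const * (2 / r0) powr (\<gamma> - 1)"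
    using compare_const_pos slope_const_nonneg sup_const_nonneg r0_pos by auto
  consider "d = 0" | "0 < d" "d < r0 / 2" | "r0 / 2 \<le> d" using d0 by linarith
  then show ?thesis
  proof cases
    case 1
    then have "p = q" by (simp add: d_def parabolic_dist_eq_0_iff)
    then show ?thesis using gradient_const_nonneg total_ge by simp
  next
    case 2
    then obtain k where k: "d < \<rho> k / 2" "\<rho> k \<le> 4 * d" by (rule scale_of_distance)
    have "e k / \<rho> k = E * \<rho> k powr (\<gamma> - 1)"
      using \<rho>_pos[of k] by (simp add: e_def powr_diff)
    also have "\<dots> \<le> total * (4 * d) powr (\<gamma> - 1)"
      using k(2) \<rho>_pos[of k] total_ge \<gamma> by (intro mult_mono powr_mono2) auto
    finally have "e k / \<rho> k \<le> 4 powr (\<gamma> - 1) * total * d powr (\<gamma> - 1)" by (simp add: powr_mult mult_ac)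
    then have "norm (G q - G p)
        \<le> (2 * compare_const + 2 * slope_const) * (4 powr (\<gamma> - 1) * total * d powr (\<gamma> - 1))"
      using compare_const_pos slope_const_nonneg
      by (intro order_trans[OF G_at_scale[OF p q k(1)[unfolded d_def] \<gamma>]] mult_left_mono) auto
    also have "\<dots> = (2 * compare_const + 2 * slope_const) * 4 powr (\<gamma> - 1) * total * d powr (\<gamma> - 1)"
      by simp
    also have "\<dots> \<le> gradient_const * total * d powr (\<gamma> - 1)"
      using parts(2) total_ge by (intro mult_right_mono) (auto simp: gradient_const_def)
    finally show ?thesis by (simp add: d_def)
  next
    case 3
    have one: "1 \<le> 2 / r0 * d" using 3 r0_pos by (simp add: field_simps)
    have x1: "1 \<le> (2 / r0 * d) powr (\<gamma> - 1)" using one \<gamma> by (intro ge_one_powr_ge_zero) auto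
    have "norm (G q - G p) \<le> 2 * sup_const * total * 1"
      using norm_triangle_ineq4[of "G q" "G p"] G_bounded[OF p] G_bounded[OF q] by linarith
    also have "\<dots> \<le> 2 * sup_const * total * (2 / r0 * d) powr (\<gamma> - 1)"
      using x1 sup_const_nonneg total_ge by (intro mult_left_mono) auto
    also have "(2 / r0 * d) powr (\<gamma> - 1) = (2 / r0) powr (\<gamma> - 1) * d powr (\<gamma> - 1)"
      by (rule powr_mult)
    also have "2 * sup_const * total * ((2 / r0) powr (\<gamma> - 1) * d powr (\<gamma> - 1))
        = 2 * sup_const * (2 / r0) powr (\<gamma> - 1) * total * d powr (\<gamma> - 1)" by simp
    also have "\<dots> \<le> gradient_const * total * d powr (\<gamma> - 1)"
      using parts(1) total_ge by (intro mult_right_mono) (auto simp: gradient_const_def)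
    finally show ?thesis by (simp add: d_def)
  qed
qed

lemma tendsto_parabolic_dist_powr:
  assumes "0 < \<alpha>"
  shows "((\<lambda>q. c * parabolic_dist p q powr \<alpha>) \<longlongrightarrow> 0) (at p within X)"
proof -
  have "((\<lambda>q. c * parabolic_dist p q powr \<alpha>) \<longlongrightarrow> c * 0 powr \<alpha>) (at p within X)"
    using assms by (intro tendsto_mult tendsto_const tendsto_powr2 tendsto_parabolic_dist)
      (auto simp: parabolic_dist_nonneg)
  then show ?thesis by simp
qed

lemma continuous_v: "continuous_on (closure S) v"
  unfolding continuous_on_def
proof
  fix p assume p: "p \<in> closure S"
  have "((\<lambda>q. v q - v p - G p \<bullet> (snd q - snd p)) \<longlongrightarrow> 0) (at p within closure S)"
    by (rule Lim_null_comparison[OF _ tendsto_parabolic_dist_powr[OF \<gamma>_pos, of "taylor_const * total"]])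
      (use taylor[OF p] in \<open>auto simp: eventually_at_filter\<close>)
  moreover have "((\<lambda>q. v p + G p \<bullet> (snd q - snd p)) \<longlongrightarrow> v p + G p \<bullet> (snd p - snd p)) (at p within closure S)"
    by (intro tendsto_intros)
  ultimately have "((\<lambda>q. (v q - v p - G p \<bullet> (snd q - snd p)) + (v p + G p \<bullet> (snd q - snd p)))
      \<longlongrightarrow> 0 + (v p + G p \<bullet> (snd p - snd p))) (at p within closure S)"
    by (rule tendsto_add)
  then show "(v \<longlongrightarrow> v p) (at p within closure S)" by simp
qed

lemma continuous_G:
  assumes "1 < \<gamma>"
  shows "continuous_on (closure S) G"
  unfolding continuous_on_def
proof
  fix p assume p: "p \<in> closure S"
  have \<gamma>1: "0 < \<gamma> - 1" using assms by simp
  have "((\<lambda>q. G q - G p) \<longlongrightarrow> 0) (at p within closure S)"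
    by (rule Lim_null_comparison[OF _ tendsto_parabolic_dist_powr[OF \<gamma>1, of "gradient_const * total"]])
      (use G_holder[OF p _ assms] in \<open>auto simp: eventually_at_filter\<close>)
  then show "(G \<longlongrightarrow> G p) (at p within closure S)" by (rule LIM_zero_cancel)
qed

lemma v_measurable: "X \<subseteq> S \<Longrightarrow> X \<in> sets lebesgue \<Longrightarrow> v \<in> borel_measurable (lebesgue_on X)"
  using continuous_on_subset[OF continuous_v] closure_subset[of S]
  by (intro continuous_imp_measurable_on_sets_lebesgue) auto

text \<open>
  On a cylinder of radius \<open>\<rho> (Suc k)\<close> both \<open>u\<close> and \<open>v\<close> are within \<open>O(e k)\<close> of the fit at the next larger
  scale, \<open>u\<close> in mean square and \<open>v\<close> uniformly.
\<close>

lemma v_ae_eq: "AE q in lebesgue_on S. u q = v q"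
proof -
  define C where "C = 2 * 2 ^ (DIM('a) + 2) + 2 * (compare_const + value_const)\<^sup>2"
  have "AE q in lebesgue_on S. \<bar>v q\<bar> \<le> sup_const * total"
  proof (rule AE_I2)
    fix q assume "q \<in> space (lebesgue_on S)"
    then have "q \<in> closure S" using closure_subset by auto
    then show "\<bar>v q\<bar> \<le> sup_const * total" by (rule v_bounded)
  qed
  then have vS: "square_integrable S v"
    using v_measurable[OF order_refl sets_S] S_lmeasurable by (intro square_integrable_bounded)
  have uv: "square_integrable S (\<lambda>q. u q - v q)" by (rule square_integrable_diff(1)[OF u vS])
  have small: "L2_norm_sq (cyl (\<rho> (Suc k)) p) (\<lambda>q. u q - v q) \<le> C * (e k)\<^sup>2 * vol (\<rho> (Suc k))"
    if "p \<in> S" for k p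
  proof -
    let ?P = "affine_at (a p k) (A p k) p" and ?D = "cyl (\<rho> (Suc k)) p"
    have p: "p \<in> closure S" using that closure_subset by blast
    have near: "parabolic_dist p q < \<rho> k / 2" "q \<in> closure S" if "q \<in> ?D" for q
      using that \<rho>_pos[of "Suc k"] closure_subset
      by (auto simp: cyl_def in_parabolic_cylinder_iff \<rho>_Suc)
    have "?D \<subseteq> cyl (\<rho> k) p"
      unfolding \<rho>_Suc by (rule cyl_mono[OF \<rho>_pos parabolic_dist_self])
    then have "L2_norm_sq ?D (\<lambda>q. u q - ?P q) \<le> L2_norm_sq (cyl (\<rho> k) p) (\<lambda>q. u q - ?P q)"
      using residual_square_integrable[OF u] cyl_sets by (intro square_integrable_subset(2))
    also have "\<dots> \<le> (e k)\<^sup>2 * csize (\<rho> k) p" using fit_\<rho>[OF p] by (simp add: fits_def)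
    also have "\<dots> \<le> (e k)\<^sup>2 * vol (\<rho> k)" by (intro mult_left_mono size_le_vol \<rho>_pos) auto
    also have "vol (\<rho> k) = 2 ^ (DIM('a) + 2) * vol (\<rho> (Suc k))" unfolding \<rho>_Suc by (rule vol_half)
    finally have 1: "L2_norm_sq ?D (\<lambda>q. u q - ?P q) \<le> (e k)\<^sup>2 * (2 ^ (DIM('a) + 2) * vol (\<rho> (Suc k)))" .
    have bound: "AE q in lebesgue_on ?D. \<bar>v q - ?P q\<bar> \<le> (compare_const + value_const) * e k"
      using v_near_affine[OF p] near by (intro AE_I2) auto
    have meas: "(\<lambda>q. v q - ?P q) \<in> borel_measurable (lebesgue_on ?D)"
      by (intro borel_measurable_diff v_measurable cyl_subset cyl_sets
          continuous_imp_measurable_on_sets_lebesgue continuous_affine_at)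
    note vP = square_integrable_bounded[OF cyl_lmeasurable meas bound]
    have "L2_norm_sq ?D (\<lambda>q. v q - ?P q) \<le> ((compare_const + value_const) * e k)\<^sup>2 * csize (\<rho> (Suc k)) p"
      by (rule vP(2))
    also have "\<dots> \<le> ((compare_const + value_const) * e k)\<^sup>2 * vol (\<rho> (Suc k))"
      by (intro mult_left_mono size_le_vol \<rho>_pos) auto
    finally have 2: "L2_norm_sq ?D (\<lambda>q. v q - ?P q)
        \<le> ((compare_const + value_const) * e k)\<^sup>2 * vol (\<rho> (Suc k))" .
    have "L2_norm_sq ?D (\<lambda>q. u q - v q) = L2_norm_sq ?D (\<lambda>q. (u q - ?P q) - (v q - ?P q))" by simp
    also have "\<dots> \<le> 2 * L2_norm_sq ?D (\<lambda>q. u q - ?P q) + 2 * L2_norm_sq ?D (\<lambda>q. v q - ?P q)"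
      by (rule square_integrable_diff(2)[OF residual_square_integrable[OF u] vP(1)])
    also have "\<dots> \<le> C * (e k)\<^sup>2 * vol (\<rho> (Suc k))"
    proof -
      let ?X = "(e k)\<^sup>2 * vol (\<rho> (Suc k))"
      have "C * (e k)\<^sup>2 * vol (\<rho> (Suc k))
          = 2 * (2 ^ (DIM('a) + 2) * ?X) + 2 * ((compare_const + value_const)\<^sup>2 * ?X)"
        unfolding C_def by (simp only: ring_distribs mult.assoc)
      moreover have "L2_norm_sq ?D (\<lambda>q. u q - ?P q) \<le> 2 ^ (DIM('a) + 2) * ?X"
        using 1 by (simp only: mult.left_commute)
      moreover have "L2_norm_sq ?D (\<lambda>q. v q - ?P q) \<le> (compare_const + value_const)\<^sup>2 * ?X"
        using 2 by (simp only: power_mult_distrib mult.assoc)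
      ultimately show ?thesis by linarith
    qed
    finally show ?thesis .
  qed
  have "(\<lambda>k. C * (e 0 * (2 powr - \<gamma>) ^ k)\<^sup>2) \<longlonglongrightarrow> C * (e 0 * 0)\<^sup>2"
    using ratio by (intro tendsto_intros LIMSEQ_power_zero) auto
  moreover have seq: "C * (e k)\<^sup>2 = C * (e 0 * (2 powr - \<gamma>) ^ k)\<^sup>2" for k
    by (subst e_eq[of k]) (rule refl)
  ultimately have "(\<lambda>k. C * (e k)\<^sup>2) \<longlonglongrightarrow> 0" unfolding seq by simp
  then have "AE q in lebesgue_on S. u q - v q = 0"
    by (rule ae_zero_if_small_on_cylinders[where \<rho> = "\<lambda>k. \<rho> (Suc k)" and \<epsilon> = "\<lambda>k. C * (e k)\<^sup>2",
          OF uv \<rho>_pos \<rho>_le _ small])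
  then show ?thesis by simp
qed

end

section \<open>From the Campanato bound to a regular representative\<close>

context cylinder_domain
begin

lemma mean_sq_excess_eq:
  "mean_sq_excess \<P> S u r p
    = (INF P\<in>\<P>. 1 / csize r p * L2_norm_sq (cyl r p) (\<lambda>q. u q - P (snd q)))"
  unfolding mean_sq_excess_def L2_norm_sq_def cyl_def by (simp add: case_prod_unfold)

lemma excess_bdd_below:
  "bdd_below ((\<lambda>P. 1 / csize r p * L2_norm_sq (cyl r p) (\<lambda>q. u q - P (snd q))) ` \<P>)"
  by (rule bdd_belowI[of _ 0]) (auto intro!: divide_nonneg_nonneg L2_norm_sq_nonneg)

lemma mean_sq_excess_nonneg:
  "\<P> \<noteq> {} \<Longrightarrow> 0 \<le> mean_sq_excess \<P> S u r p"
  unfolding mean_sq_excess_eq by (rule cINF_greatest) (auto intro!: divide_nonneg_nonneg L2_norm_sq_nonneg)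

lemma mean_sq_excess_le:
  assumes "P \<in> \<P>" "continuous_on UNIV P" "u \<in> borel_measurable (lebesgue_on S)"
    and "p \<in> closure S" "0 < r" "r \<le> r0"
    and "AE q in lebesgue_on (cyl r p). \<bar>u q - P (snd q)\<bar> \<le> B"
  shows "mean_sq_excess \<P> S u r p \<le> B\<^sup>2"
proof -
  have size: "0 < csize r p" using assms by (intro size_pos)
  have "u \<in> borel_measurable (lebesgue_on (cyl r p))"
    using measurable_restrict_mono[OF assms(3) cyl_subset] .
  moreover have "continuous_on UNIV (\<lambda>q::real \<times> 'a. P (snd q))"
    using assms(2) by (intro continuous_on_compose2[OF assms(2)] continuous_intros) auto
  then have "(\<lambda>q. P (snd q)) \<in> borel_measurable (lebesgue_on (cyl r p))"
    using cyl_sets by (intro continuous_imp_measurable_on_sets_lebesgue) (auto intro: continuous_on_subset)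
  ultimately have "(\<lambda>q. u q - P (snd q)) \<in> borel_measurable (lebesgue_on (cyl r p))" by simp
  then have "L2_norm_sq (cyl r p) (\<lambda>q. u q - P (snd q)) \<le> B\<^sup>2 * csize r p"
    by (rule square_integrable_bounded(2)[OF cyl_lmeasurable _ assms(7)])
  then have "1 / csize r p * L2_norm_sq (cyl r p) (\<lambda>q. u q - P (snd q)) \<le> B\<^sup>2"
    using size by (simp add: pos_divide_le_eq)
  moreover have "mean_sq_excess \<P> S u r p \<le> 1 / csize r p * L2_norm_sq (cyl r p) (\<lambda>q. u q - P (snd q))"
    unfolding mean_sq_excess_eq by (rule cINF_lower[OF excess_bdd_below assms(1)])
  ultimately show ?thesis by linarith
qed

lemma campanato_bound_mono:
  assumes "campanato_bound \<P> \<gamma> r0 S u C" "C \<le> C'"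
  shows "campanato_bound \<P> \<gamma> r0 S u C'"
  unfolding campanato_bound_def
proof (intro ballI allI impI)
  fix p r assume pr: "p \<in> closure S" "0 < r \<and> r \<le> r0"
  have "mean_sq_excess \<P> S u r p \<le> C * r powr (2 * \<gamma>)"
    using assms(1) pr unfolding campanato_bound_def by blast
  also have "\<dots> \<le> C' * r powr (2 * \<gamma>)" using assms(2) by (intro mult_right_mono) auto
  finally show "mean_sq_excess \<P> S u r p \<le> C' * r powr (2 * \<gamma>)" .
qed

text \<open>
  The admissible constants form a closed half-line: the bound is a family of inequalities that are
  linear in \<open>C\<close> with positive coefficients.
\<close>

lemma campanato_Least:
  assumes "campanato_bound \<P> \<gamma> r0 S u C" "\<P> \<noteq> {}" "S \<noteq> {}"
  defines "m \<equiv> (LEAST C. campanato_bound \<P> \<gamma> r0 S u C)"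
  shows "campanato_bound \<P> \<gamma> r0 S u m" and "m \<le> C" and "0 \<le> m"
proof -
  define X where "X = {C. campanato_bound \<P> \<gamma> r0 S u C}"
  obtain p where p: "p \<in> closure S" using assms(3) closure_subset by blast
  have nonneg: "0 \<le> c" if "c \<in> X" for c
  proof -
    have "0 \<le> mean_sq_excess \<P> S u r0 p" by (rule mean_sq_excess_nonneg[OF assms(2)])
    also have "\<dots> \<le> c * r0 powr (2 * \<gamma>)"
      using that p r0_pos unfolding X_def campanato_bound_def by blast
    finally show ?thesis using r0_pos by (simp add: zero_le_mult_iff)
  qed
  have bdd: "bdd_below X" using nonneg by (intro bdd_belowI[of _ 0])
  have ne: "X \<noteq> {}" using assms(1) by (auto simp: X_def)
  have Inf: "campanato_bound \<P> \<gamma> r0 S u (Inf X)"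
    unfolding campanato_bound_def
  proof (intro ballI allI impI)
    fix q r assume qr: "q \<in> closure S" "0 < r \<and> r \<le> r0"
    have pos: "0 < r powr (2 * \<gamma>)" using qr by simp
    have "mean_sq_excess \<P> S u r q / r powr (2 * \<gamma>) \<le> Inf X"
    proof (rule cInf_greatest[OF ne])
      fix c assume "c \<in> X"
      then have "mean_sq_excess \<P> S u r q \<le> c * r powr (2 * \<gamma>)"
        using qr unfolding X_def campanato_bound_def by blast
      then show "mean_sq_excess \<P> S u r q / r powr (2 * \<gamma>) \<le> c" using pos by (simp add: pos_divide_le_eq)
    qed
    then show "mean_sq_excess \<P> S u r q \<le> Inf X * r powr (2 * \<gamma>)" using pos by (simp add: pos_divide_le_eq)
  qed
  have "m = Inf X"
    unfolding m_def
  proof (rule Least_equality)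
    fix y assume "campanato_bound \<P> \<gamma> r0 S u y"
    then show "Inf X \<le> y" using bdd by (intro cInf_lower) (auto simp: X_def)
  qed (rule Inf)
  then show "campanato_bound \<P> \<gamma> r0 S u m" "m \<le> C" "0 \<le> m"
    using Inf cInf_lower[OF _ bdd, of C] cInf_greatest[OF ne nonneg] assms(1) by (auto simp: X_def)
qed

text \<open>
  For positive \<open>C\<close>, the factor 2 leaves room above the infimum.
\<close>

lemma campanato_near_minimizer:
  assumes "campanato_bound \<P> \<gamma> r0 S u C" "0 < C" "\<P> \<noteq> {}" "p \<in> closure S" "0 < r" "r \<le> r0"
  shows "\<exists>P\<in>\<P>. L2_norm_sq (cyl r p) (\<lambda>q. u q - P (snd q)) \<le> (sqrt (2 * C) * r powr \<gamma>)\<^sup>2 * csize r p"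
proof -
  have size: "0 < csize r p" using assms by (intro size_pos)
  have "mean_sq_excess \<P> S u r p \<le> C * r powr (2 * \<gamma>)"
    using assms unfolding campanato_bound_def by blast
  also have "\<dots> < 2 * C * r powr (2 * \<gamma>)" using assms by simp
  also have "2 * C * r powr (2 * \<gamma>) = (sqrt (2 * C) * r powr \<gamma>)\<^sup>2"
    using assms by (simp add: power_mult_distrib powr_power)
  finally obtain P where P: "P \<in> \<P>"
    "1 / csize r p * L2_norm_sq (cyl r p) (\<lambda>q. u q - P (snd q)) < (sqrt (2 * C) * r powr \<gamma>)\<^sup>2"
    unfolding mean_sq_excess_eq cINF_less_iff[OF assms(3) excess_bdd_below] by blast
  then have "L2_norm_sq (cyl r p) (\<lambda>q. u q - P (snd q)) \<le> (sqrt (2 * C) * r powr \<gamma>)\<^sup>2 * csize r p"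
    using size by (simp add: pos_divide_less_eq less_imp_le)
  then show ?thesis using P(1) by blast
qed

end

lemma constant_polys_nonempty: "constant_polys \<noteq> {}" and affine_polys_nonempty: "affine_polys \<noteq> {}"
  by (auto simp: constant_polys_def affine_polys_def)

context campanato_exponent
begin

definition total_norm :: "(real \<times> 'a \<Rightarrow> real) \<Rightarrow> real \<Rightarrow> real" where
  "total_norm u C = sqrt (2 * C) + sqrt (L2_norm_sq S u)"

lemma campanato_constant_representative:
  assumes u: "square_integrable S u" and C: "0 < C"
    and bound: "campanato_bound constant_polys \<gamma> r0 S u C"
  shows "\<exists>v. continuous_on (closure S) v \<and> (AE q in lebesgue_on S. u q = v q) \<and>
    (\<forall>p\<in>closure S. \<bar>v p\<bar> \<le> sup_const * total_norm u C) \<and>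
    (\<forall>p\<in>closure S. \<forall>q\<in>closure S.
      \<bar>v q - v p\<bar> \<le> taylor_const * total_norm u C * parabolic_dist p q powr \<gamma>)"
proof -
  have "\<exists>c. fits u (sqrt (2 * C) * (r0 / 2 ^ k) powr \<gamma>) (r0 / 2 ^ k) p c 0" if p: "p \<in> closure S" for p k
  proof -
    have "r0 / 2 ^ k \<le> r0" using r0_pos by (simp add: divide_le_eq mult_le_cancel_left1)
    then obtain P where "P \<in> constant_polys" and P: "L2_norm_sq (cyl (r0 / 2 ^ k) p) (\<lambda>q. u q - P (snd q))
        \<le> (sqrt (2 * C) * (r0 / 2 ^ k) powr \<gamma>)\<^sup>2 * csize (r0 / 2 ^ k) p"
      using campanato_near_minimizer[OF bound C constant_polys_nonempty p, of "r0 / 2 ^ k"] r0_pos by auto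
    then obtain c where "P = (\<lambda>z. c)" by (auto simp: constant_polys_def)
    then show ?thesis using P by (intro exI[of _ c]) (simp add: fits_def affine_at_def)
  qed
  then obtain a where a: "\<And>p k. p \<in> closure S \<Longrightarrow>
      fits u (sqrt (2 * C) * (r0 / 2 ^ k) powr \<gamma>) (r0 / 2 ^ k) p (a p k) 0" by metis
  interpret f: campanato_fits S r0 \<kappa> \<gamma> u "sqrt (2 * C)" a "\<lambda>p k. 0"
    by unfold_locales (use u C a in auto)
  have G: "f.G p = 0" for p by (rule f.G_zero) simp
  have total: "f.total = total_norm u C" by (simp add: f.total_def total_norm_def)
  show ?thesis
    using f.continuous_v f.v_ae_eq f.v_bounded f.taylor unfolding G total
    by (intro exI[of _ f.v] conjI ballI) simp_all
qed

lemma campanato_affine_representative: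
  assumes u: "square_integrable S u" and C: "0 < C" and \<gamma>: "1 < \<gamma>"
    and bound: "campanato_bound affine_polys \<gamma> r0 S u C"
  shows "\<exists>v G. continuous_on (closure S) v \<and> continuous_on (closure S) G \<and>
    (AE q in lebesgue_on S. u q = v q) \<and>
    (\<forall>p\<in>closure S. \<bar>v p\<bar> \<le> sup_const * total_norm u C \<and> norm (G p) \<le> sup_const * total_norm u C) \<and>
    (\<forall>p\<in>closure S. \<forall>q\<in>closure S.
      \<bar>v q - v p - G p \<bullet> (snd q - snd p)\<bar> \<le> taylor_const * total_norm u C * parabolic_dist p q powr \<gamma> \<and>
      norm (G q - G p) \<le> gradient_const * total_norm u C * parabolic_dist p q powr (\<gamma> - 1))"
proof -
  have "\<exists>c B. fits u (sqrt (2 * C) * (r0 / 2 ^ k) powr \<gamma>) (r0 / 2 ^ k) p c B" if p: "p \<in> closure S" for p k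
  proof -
    have "r0 / 2 ^ k \<le> r0" using r0_pos by (simp add: divide_le_eq mult_le_cancel_left1)
    then obtain P where "P \<in> affine_polys" and P: "L2_norm_sq (cyl (r0 / 2 ^ k) p) (\<lambda>q. u q - P (snd q))
        \<le> (sqrt (2 * C) * (r0 / 2 ^ k) powr \<gamma>)\<^sup>2 * csize (r0 / 2 ^ k) p"
      using campanato_near_minimizer[OF bound C affine_polys_nonempty p, of "r0 / 2 ^ k"] r0_pos by auto
    then obtain A0 A1 where "P = (\<lambda>z. A0 + A1 \<bullet> z)" by (auto simp: affine_polys_def)
    then have "affine_at (A0 + A1 \<bullet> snd p) A1 p = (\<lambda>q. P (snd q))"
      by (intro ext) (simp add: affine_at_def inner_diff_right)
    then have "fits u (sqrt (2 * C) * (r0 / 2 ^ k) powr \<gamma>) (r0 / 2 ^ k) p (A0 + A1 \<bullet> snd p) A1"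
      using P unfolding fits_def by simp
    then show ?thesis by blast
  qed
  then obtain a A where a: "\<And>p k. p \<in> closure S \<Longrightarrow>
      fits u (sqrt (2 * C) * (r0 / 2 ^ k) powr \<gamma>) (r0 / 2 ^ k) p (a p k) (A p k)" by metis
  interpret f: campanato_fits S r0 \<kappa> \<gamma> u "sqrt (2 * C)" a A
    by unfold_locales (use u C a \<gamma> in auto)
  have total: "f.total = total_norm u C" by (simp add: f.total_def total_norm_def)
  show ?thesis
    using f.continuous_v f.continuous_G[OF \<gamma>] f.v_ae_eq f.v_bounded f.G_bounded f.taylor f.G_holder[OF _ _ \<gamma>]
    unfolding total by (intro exI[of _ f.v] exI[of _ f.G] conjI ballI)
qed

end

section \<open>The Hoelder norms\<close>

lemma nested_SUP_nonneg:
  assumes "S \<noteq> {}" "\<And>p q. p \<in> S \<Longrightarrow> q \<in> S \<Longrightarrow> 0 \<le> (f p q :: ereal)"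
  shows "0 \<le> (SUP p\<in>S. SUP q\<in>S. f p q)"
proof -
  obtain p where "p \<in> S" using assms(1) by blast
  then show ?thesis using assms(2) by (intro SUP_upper2[of p] SUP_upper2[of p]) auto
qed

lemma nested_SUP_upper:
  assumes "p \<in> S" "q \<in> T"
  shows "f p q \<le> (SUP p\<in>S. SUP q\<in>T. (f p q :: ereal))"
  using assms by (intro SUP_upper2[of p] SUP_upper2[of q]) auto

text \<open>
  With \<open>x / 0 = 0\<close>, a bound on the difference quotient is the same as a multiplicative bound, also at
  coinciding points.
\<close>

lemma quotient_le_iff_le_mult:
  fixes w :: real
  assumes "0 \<le> w" "w = 0 \<Longrightarrow> x = 0" "0 \<le> N"
  shows "x / w \<le> N \<longleftrightarrow> x \<le> N * w"
  using assms by (cases "w = 0") (auto simp: pos_divide_le_eq)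

lemma Linf_norm_le:
  assumes "continuous_on S f" "S \<in> sets lebesgue" "\<And>q. q \<in> S \<Longrightarrow> norm (f q) \<le> B"
  shows "Linf_norm S f \<le> ereal B"
  unfolding Linf_norm_def
proof (rule esssup_I)
  have "(\<lambda>p. norm (f p)) \<in> borel_measurable (lebesgue_on S)"
    using assms(1,2) by (intro continuous_imp_measurable_on_sets_lebesgue continuous_on_norm)
  then show "(\<lambda>p. ereal (norm (f p))) \<in> borel_measurable (lebesgue_on S)" by simp
  show "AE p in lebesgue_on S. ereal (norm (f p)) \<le> ereal B"
    using assms(3) by (intro AE_I2) simp
qed

lemma Linf_norm_nonneg:
  assumes "emeasure (lebesgue_on S) S \<noteq> 0"
  shows "0 \<le> Linf_norm S f"
proof -
  have "0 = esssup (lebesgue_on S) (\<lambda>p. 0 :: ereal)"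
    using assms by (simp add: esssup_const)
  also have "\<dots> \<le> Linf_norm S f"
    unfolding Linf_norm_def by (rule esssup_mono) auto
  finally show ?thesis .
qed

lemma Linf_norm_AE:
  assumes "Linf_norm S f \<le> ereal N"
  shows "AE p in lebesgue_on S. norm (f p) \<le> N"
proof -
  have "AE p in lebesgue_on S. ereal (norm (f p)) \<le> Linf_norm S f"
    unfolding Linf_norm_def by (rule esssup_AE)
  then show ?thesis
  proof eventually_elim
    case (elim p)
    then have "ereal (norm (f p)) \<le> ereal N" using assms by (rule order_trans)
    then show ?case by simp
  qed
qed

lemma Linf_norm_cong:
  assumes "\<And>q. q \<in> S \<Longrightarrow> f q = g q"
  shows "Linf_norm S f = Linf_norm S g"
proof -
  have "(\<lambda>p. ereal (norm (f p))) \<in> borel_measurable (lebesgue_on S) \<longleftrightarrow>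
      (\<lambda>p. ereal (norm (g p))) \<in> borel_measurable (lebesgue_on S)"
    using assms by (intro measurable_cong) auto
  moreover have "AE p in lebesgue_on S. ereal (norm (f p)) = ereal (norm (g p))"
    using assms by (intro AE_I2) auto
  ultimately show ?thesis
    unfolding Linf_norm_def esssup_def by (simp add: Limsup_eq)
qed

lemma ereal_sum_split:
  fixes x y :: ereal
  assumes "0 \<le> x" "0 \<le> y" "x + y \<le> ereal N"
  shows "x \<le> ereal N" "y \<le> ereal N"
  using assms by (metis add.commute add_increasing2 order_trans order_refl)+

lemma ereal_nonneg_finite:
  fixes x :: ereal
  assumes "0 \<le> x" "x < \<infinity>"
  obtains N where "0 \<le> N" "x = ereal N"
  using assms by (cases x) auto

context cylinder_domain
begin

lemma emeasure_S_nonzero: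
  assumes "S \<noteq> {}" shows "emeasure (lebesgue_on S) S \<noteq> 0"
proof
  assume "emeasure (lebesgue_on S) S = 0"
  then have "emeasure lebesgue S = 0" using sets_S by (simp add: emeasure_restrict_space)
  then have "S \<in> null_sets lebesgue" using sets_S by auto
  obtain p where "p \<in> S" using assms by blast
  then have "0 < csize r0 p" using closure_subset r0_pos by (intro size_pos) auto
  also have "csize r0 p \<le> measure lebesgue S"
    using cyl_subset cyl_sets S_lmeasurable by (intro measure_mono_fmeasurable) auto
  also have "\<dots> = 0" using \<open>S \<in> null_sets lebesgue\<close> by (rule measure_eq_0_null_sets)
  finally show False by simp
qed

text \<open>
  Both parts of the theorem have this shape, with one estimate in each direction. Since the least
  constant may be 0 while \<open>lower\<close> asks for a positive one, the norm is estimated with a slightly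
  larger constant. The representative found in this way has the norm of the given one by \<open>unique\<close>.
\<close>

lemma campanato_equivalence:
  fixes X :: "(real \<times> 'a \<Rightarrow> real) set" and nrm :: "(real \<times> 'a \<Rightarrow> real) \<Rightarrow> ereal"
  assumes S: "S \<noteq> {}" and \<P>: "\<P> \<noteq> {}"
    and K: "0 \<le> K1" "0 \<le> K2" "0 \<le> K3"
    and upper: "\<And>u v. v \<in> X \<Longrightarrow> square_integrable S u \<Longrightarrow> ae_equal_on S u v \<Longrightarrow>
      \<exists>N\<ge>0. nrm v = ereal N \<and> campanato_bound \<P> \<gamma> r0 S u (K1 * N\<^sup>2) \<and> L2_norm_sq S u \<le> K2 * N\<^sup>2"
    and lower: "\<And>u C. square_integrable S u \<Longrightarrow> 0 < C \<Longrightarrow> campanato_bound \<P> \<gamma> r0 S u C \<Longrightarrow>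
      \<exists>v\<in>X. ae_equal_on S u v \<and> nrm v \<le> ereal (K3 * (sqrt (2 * C) + sqrt (L2_norm_sq S u)))"
    and unique: "\<And>v w. v \<in> X \<Longrightarrow> w \<in> X \<Longrightarrow> ae_equal_on S v w \<Longrightarrow> nrm v = nrm w"
  shows "(\<forall>u. square_integrable S u \<longrightarrow>
         (\<exists>v\<in>X. ae_equal_on S u v) \<longleftrightarrow> (\<exists>C>0. campanato_bound \<P> \<gamma> r0 S u C)) \<and>
      (\<exists>K>0. \<forall>u. \<forall>v\<in>X. square_integrable S u \<and> ae_equal_on S u v \<longrightarrow>
         (let Cmin = (LEAST C. campanato_bound \<P> \<gamma> r0 S u C); N = nrm v
          in ereal (L2_norm_sq S u + Cmin) \<le> ereal K * N\<^sup>2 \<and>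
             N\<^sup>2 \<le> ereal K * ereal (L2_norm_sq S u + Cmin)))"
proof (intro conjI allI impI)
  fix u assume u: "square_integrable S u"
  show "(\<exists>v\<in>X. ae_equal_on S u v) \<longleftrightarrow> (\<exists>C>0. campanato_bound \<P> \<gamma> r0 S u C)"
  proof
    assume "\<exists>v\<in>X. ae_equal_on S u v"
    then obtain N where "0 \<le> N" "campanato_bound \<P> \<gamma> r0 S u (K1 * N\<^sup>2)" using upper[OF _ u] by blast
    then have "campanato_bound \<P> \<gamma> r0 S u (K1 * N\<^sup>2 + 1)" "0 < K1 * N\<^sup>2 + 1"
      using K(1) by (auto intro: campanato_bound_mono add_nonneg_pos)
    then show "\<exists>C>0. campanato_bound \<P> \<gamma> r0 S u C" by blast
  qed (use lower[OF u] in blast)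
next
  define K where "K = K1 + K2 + 4 * K3\<^sup>2 + 1"
  have "ereal (L2_norm_sq S u + m) \<le> ereal K * (nrm v)\<^sup>2 \<and> (nrm v)\<^sup>2 \<le> ereal K * ereal (L2_norm_sq S u + m)"
    if v: "v \<in> X" and u: "square_integrable S u" and uv: "ae_equal_on S u v"
      and m: "m = (LEAST C. campanato_bound \<P> \<gamma> r0 S u C)" for u v m
  proof -
    obtain N where N: "0 \<le> N" "nrm v = ereal N" "campanato_bound \<P> \<gamma> r0 S u (K1 * N\<^sup>2)"
        "L2_norm_sq S u \<le> K2 * N\<^sup>2"
      using upper[OF v u uv] by blast
    have least: "campanato_bound \<P> \<gamma> r0 S u m" "m \<le> K1 * N\<^sup>2" "0 \<le> m"
      using campanato_Least[OF N(3) \<P> S] m by auto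
    have "L2_norm_sq S u + m \<le> (K1 + K2) * N\<^sup>2" using N(4) least(2) by (simp add: algebra_simps)
    also have "\<dots> \<le> K * N\<^sup>2" by (intro mult_right_mono) (simp_all add: K_def)
    finally have 1: "L2_norm_sq S u + m \<le> K * N\<^sup>2" .
    have "N\<^sup>2 \<le> 4 * K3\<^sup>2 * (L2_norm_sq S u + m) + \<epsilon>" if \<epsilon>: "0 < \<epsilon>" for \<epsilon>
    proof -
      define \<delta> where "\<delta> = \<epsilon> / (4 * K3\<^sup>2 + 1)"
      have den: "0 < 4 * K3\<^sup>2 + 1" by (intro add_nonneg_pos) auto
      have \<delta>: "0 < \<delta>" "4 * K3\<^sup>2 * \<delta> \<le> \<epsilon>"
        using \<epsilon> den by (auto simp: \<delta>_def divide_simps)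
      define s where "s = sqrt (2 * (m + \<delta>)) + sqrt (L2_norm_sq S u)"
      obtain w where w: "w \<in> X" "ae_equal_on S u w" "nrm w \<le> ereal (K3 * s)"
        using lower[OF u, of "m + \<delta>"] campanato_bound_mono[OF least(1), of "m + \<delta>"] \<delta> least(3)
        unfolding s_def by auto
      have "ae_equal_on S v w"
        using uv w(2) unfolding ae_equal_on_def by eventually_elim simp
      then have "nrm v = nrm w" by (rule unique[OF v w(1)])
      then have "ereal N \<le> ereal (K3 * s)" using w(3) unfolding N(2) by (rule ord_eq_le_trans)
      then have "N \<le> K3 * s" by simp
      then have "N\<^sup>2 \<le> (K3 * s)\<^sup>2" using N(1) by (intro power_mono)
      also have "\<dots> = K3\<^sup>2 * s\<^sup>2" by (simp add: power_mult_distrib)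
      also have "s\<^sup>2 \<le> 2 * (sqrt (2 * (m + \<delta>)))\<^sup>2 + 2 * (sqrt (L2_norm_sq S u))\<^sup>2"
        unfolding s_def using sum_squares_bound[of "sqrt (2 * (m + \<delta>))" "sqrt (L2_norm_sq S u)"]
        by (simp add: power2_sum)
      also have "\<dots> = 4 * (m + \<delta>) + 2 * L2_norm_sq S u"
        using \<delta> least(3) L2_norm_sq_nonneg[of S u] by simp
      also have "\<dots> \<le> 4 * (L2_norm_sq S u + m + \<delta>)" using L2_norm_sq_nonneg[of S u] by simp
      also have "K3\<^sup>2 * (4 * (L2_norm_sq S u + m + \<delta>)) = 4 * K3\<^sup>2 * (L2_norm_sq S u + m) + 4 * K3\<^sup>2 * \<delta>"
        by (simp add: algebra_simps)
      also have "\<dots> \<le> 4 * K3\<^sup>2 * (L2_norm_sq S u + m) + \<epsilon>" using \<delta> by simp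
      finally show ?thesis by (simp add: mult_left_mono)
    qed
    then have "N\<^sup>2 \<le> 4 * K3\<^sup>2 * (L2_norm_sq S u + m)" by (rule field_le_epsilon)
    also have "\<dots> \<le> K * (L2_norm_sq S u + m)"
      using K least(3) L2_norm_sq_nonneg[of S u] by (intro mult_right_mono) (auto simp: K_def)
    finally have 2: "N\<^sup>2 \<le> K * (L2_norm_sq S u + m)" .
    show ?thesis using 1 2 unfolding N(2) by (simp add: power2_eq_square)
  qed
  moreover have "0 < K" using K by (simp add: K_def add_nonneg_pos)
  ultimately show "\<exists>K>0. \<forall>u. \<forall>v\<in>X. square_integrable S u \<and> ae_equal_on S u v \<longrightarrow>
         (let Cmin = (LEAST C. campanato_bound \<P> \<gamma> r0 S u C); N = nrm v
          in ereal (L2_norm_sq S u + Cmin) \<le> ereal K * N\<^sup>2 \<and>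
             N\<^sup>2 \<le> ereal K * ereal (L2_norm_sq S u + Cmin))"
    unfolding Let_def by (intro exI[of _ K]) blast
qed

lemma L2_norm_sq_le_sup:
  assumes "square_integrable S u" "AE q in lebesgue_on S. \<bar>u q\<bar> \<le> B"
  shows "L2_norm_sq S u \<le> measure lebesgue S * B\<^sup>2"
  using square_integrable_bounded(2)[OF S_lmeasurable _ assms(2)] assms(1)
  by (simp add: square_integrable_def mult.commute)

end

lemma parabolic_quotient_le_iff:
  fixes f :: "real \<times> 'a::euclidean_space \<Rightarrow> 'b::real_normed_vector"
  assumes "0 \<le> N"
  shows "norm (f p - f q) / parabolic_dist p q powr \<beta> \<le> N
    \<longleftrightarrow> norm (f p - f q) \<le> N * parabolic_dist p q powr \<beta>"
  using assms by (intro quotient_le_iff_le_mult) (simp_all add: parabolic_dist_eq_0_iff)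

lemma holder_norm_finite:
  assumes "cylinder_domain (I \<times> \<Omega>) r0 \<kappa>" "I \<times> \<Omega> \<noteq> {}" "v \<in> holder_space \<beta> I \<Omega>"
  shows "\<exists>N\<ge>0. holder_norm \<beta> I \<Omega> v = ereal N \<and>
    (AE q in lebesgue_on (I \<times> \<Omega>). \<bar>v q\<bar> \<le> N) \<and>
    (\<forall>p\<in>I \<times> \<Omega>. \<forall>q\<in>I \<times> \<Omega>. \<bar>v p - v q\<bar> \<le> N * parabolic_dist p q powr \<beta>)"
proof -
  interpret cylinder_domain "I \<times> \<Omega>" r0 \<kappa> by fact
  let ?quot = "\<lambda>p q. ereal (\<bar>v p - v q\<bar> / parabolic_dist p q powr \<beta>)"
  let ?L = "Linf_norm (I \<times> \<Omega>) v" and ?H = "SUP p\<in>I \<times> \<Omega>. SUP q\<in>I \<times> \<Omega>. ?quot p q"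
  have L: "0 \<le> ?L" by (rule Linf_norm_nonneg[OF emeasure_S_nonzero[OF assms(2)]])
  have H: "0 \<le> ?H" by (rule nested_SUP_nonneg[OF assms(2)]) simp
  have norm: "holder_norm \<beta> I \<Omega> v = ?L + ?H" by (simp only: holder_norm_def)
  have "0 \<le> holder_norm \<beta> I \<Omega> v" unfolding norm using L H by (rule add_nonneg_nonneg)
  moreover have "holder_norm \<beta> I \<Omega> v < \<infinity>" using assms(3) by (simp add: holder_space_def)
  ultimately obtain N where N: "0 \<le> N" "holder_norm \<beta> I \<Omega> v = ereal N"
    by (rule ereal_nonneg_finite)
  then have "?L + ?H \<le> ereal N" using norm by simp
  note parts = ereal_sum_split[OF L H this]
  have "\<bar>v p - v q\<bar> \<le> N * parabolic_dist p q powr \<beta>" if "p \<in> I \<times> \<Omega>" "q \<in> I \<times> \<Omega>" for p q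
  proof -
    have "?quot p q \<le> ereal N"
      using nested_SUP_upper[OF that, of ?quot] parts(2) by (rule order_trans)
    then have "\<bar>v p - v q\<bar> / parabolic_dist p q powr \<beta> \<le> N" by simp
    then show ?thesis using parabolic_quotient_le_iff[OF N(1), of v p q \<beta>] by simp
  qed
  moreover have "AE q in lebesgue_on (I \<times> \<Omega>). \<bar>v q\<bar> \<le> N" using Linf_norm_AE[OF parts(1)] by simp
  ultimately show ?thesis using N by blast
qed

lemma holder_norm_le:
  assumes "cylinder_domain (I \<times> \<Omega>) r0 \<kappa>" "I \<times> \<Omega> \<noteq> {}"
    and cont: "continuous_on (closure (I \<times> \<Omega>)) v" and B: "0 \<le> B'"
    and bound: "\<And>p. p \<in> I \<times> \<Omega> \<Longrightarrow> \<bar>v p\<bar> \<le> B"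
    and holder: "\<And>p q. p \<in> I \<times> \<Omega> \<Longrightarrow> q \<in> I \<times> \<Omega> \<Longrightarrow> \<bar>v p - v q\<bar> \<le> B' * parabolic_dist p q powr \<beta>"
  shows "holder_norm \<beta> I \<Omega> v \<le> ereal (B + B')"
proof -
  interpret cylinder_domain "I \<times> \<Omega>" r0 \<kappa> by fact
  have "continuous_on (I \<times> \<Omega>) v" using cont closure_subset by (rule continuous_on_subset)
  then have "Linf_norm (I \<times> \<Omega>) v \<le> ereal B" using bound by (intro Linf_norm_le sets_S) auto
  moreover have "(SUP p\<in>I \<times> \<Omega>. SUP q\<in>I \<times> \<Omega>. ereal (\<bar>v p - v q\<bar> / parabolic_dist p q powr \<beta>)) \<le> ereal B'"
  proof (intro SUP_least)
    fix p q assume "p \<in> I \<times> \<Omega>" "q \<in> I \<times> \<Omega>"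
    then have "\<bar>v p - v q\<bar> \<le> B' * parabolic_dist p q powr \<beta>" by (rule holder)
    then show "ereal (\<bar>v p - v q\<bar> / parabolic_dist p q powr \<beta>) \<le> ereal B'"
      using parabolic_quotient_le_iff[OF B, of v p q \<beta>] by simp
  qed
  ultimately have "holder_norm \<beta> I \<Omega> v \<le> ereal B + ereal B'"
    unfolding holder_norm_def by (rule add_mono)
  then show ?thesis by simp
qed

section \<open>Hoelder continuous functions\<close>

lemma cylinder_diameter:
  assumes "0 < r" "q \<in> parabolic_cylinder r p" "q' \<in> parabolic_cylinder r p"
  shows "parabolic_dist q q' < 2 * r"
  using assms parabolic_dist_triangle[of q q' p] parabolic_dist_commute[of p q]
  by (simp add: in_parabolic_cylinder_iff)

text \<open>
  In the easy direction the competitor is the value at an arbitrary point of the cylinder, since the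
  centre may lie outside \<open>I \<times> \<Omega>\<close>.
\<close>

lemma holder_campanato_equivalence:
  fixes I :: "real set" and \<Omega> :: "'a::euclidean_space set"
  assumes dom: "cylinder_domain (I \<times> \<Omega>) r0 \<kappa>" and ne: "I \<times> \<Omega> \<noteq> {}" and \<beta>: "0 < \<beta>"
  shows "(\<forall>u. square_integrable (I \<times> \<Omega>) u \<longrightarrow>
         (\<exists>v\<in>holder_space \<beta> I \<Omega>. ae_equal_on (I \<times> \<Omega>) u v) \<longleftrightarrow>
         (\<exists>C>0. campanato_bound constant_polys \<beta> r0 (I \<times> \<Omega>) u C)) \<and>
      (\<exists>K>0. \<forall>u. \<forall>v\<in>holder_space \<beta> I \<Omega>.
         square_integrable (I \<times> \<Omega>) u \<and> ae_equal_on (I \<times> \<Omega>) u v \<longrightarrow>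
         (let Cmin = (LEAST C. campanato_bound constant_polys \<beta> r0 (I \<times> \<Omega>) u C);
              N = holder_norm \<beta> I \<Omega> v
          in ereal (L2_norm_sq (I \<times> \<Omega>) u + Cmin) \<le> ereal K * N\<^sup>2 \<and>
             N\<^sup>2 \<le> ereal K * ereal (L2_norm_sq (I \<times> \<Omega>) u + Cmin)))"
proof -
  interpret campanato_exponent "I \<times> \<Omega>" r0 \<kappa> \<beta>
    using dom \<beta> by (simp add: campanato_exponent_def campanato_exponent_axioms_def)
  show ?thesis
  proof (rule campanato_equivalence[OF ne constant_polys_nonempty])
    show "0 \<le> (2 powr \<beta>)\<^sup>2" "0 \<le> measure lebesgue (I \<times> \<Omega>)" "0 \<le> sup_const + taylor_const"
      using sup_const_nonneg taylor_const_nonneg by auto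
  next
    fix u v assume v: "v \<in> holder_space \<beta> I \<Omega>" and u: "square_integrable (I \<times> \<Omega>) u"
      and ae: "ae_equal_on (I \<times> \<Omega>) u v"
    obtain N where N: "0 \<le> N" "holder_norm \<beta> I \<Omega> v = ereal N"
        "AE q in lebesgue_on (I \<times> \<Omega>). \<bar>v q\<bar> \<le> N"
      and holder: "\<And>p q. p \<in> I \<times> \<Omega> \<Longrightarrow> q \<in> I \<times> \<Omega> \<Longrightarrow> \<bar>v p - v q\<bar> \<le> N * parabolic_dist p q powr \<beta>"
      using holder_norm_finite[OF dom ne v] by blast
    have uv: "AE q in lebesgue_on (I \<times> \<Omega>). u q = v q" using ae by (simp add: ae_equal_on_def)
    have "AE q in lebesgue_on (I \<times> \<Omega>). \<bar>u q\<bar> \<le> N" using uv N(3) by eventually_elim simp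
    then have "L2_norm_sq (I \<times> \<Omega>) u \<le> measure lebesgue (I \<times> \<Omega>) * N\<^sup>2" by (rule L2_norm_sq_le_sup[OF u])
    moreover have "campanato_bound constant_polys \<beta> r0 (I \<times> \<Omega>) u ((2 powr \<beta>)\<^sup>2 * N\<^sup>2)"
      unfolding campanato_bound_def
    proof (intro ballI allI impI)
      fix p r assume p: "p \<in> closure (I \<times> \<Omega>)" and "0 < r \<and> r \<le> r0"
      then have r: "0 < r" "r \<le> r0" by auto
      have "cyl r p \<noteq> {}" using size_pos[OF p r] by force
      then obtain q0 where q0: "q0 \<in> cyl r p" by blast
      have "AE q in lebesgue_on (cyl r p). u q = v q"
        by (rule AE_lebesgue_on_subset[OF uv cyl_subset cyl_sets sets_S])
      moreover have "AE q in lebesgue_on (cyl r p). q \<in> cyl r p" by (rule AE_I2) simp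
      ultimately have "AE q in lebesgue_on (cyl r p). \<bar>u q - v q0\<bar> \<le> N * (2 * r) powr \<beta>"
      proof eventually_elim
        case (elim q)
        have "parabolic_dist q q0 \<le> 2 * r"
          using cylinder_diameter[OF r(1), of q p q0] elim(2) q0 by (simp add: cyl_def)
        then have "parabolic_dist q q0 powr \<beta> \<le> (2 * r) powr \<beta>"
          using \<beta> by (intro powr_mono2) (auto simp: parabolic_dist_nonneg)
        moreover have "\<bar>v q - v q0\<bar> \<le> N * parabolic_dist q q0 powr \<beta>"
          using elim(2) q0 cyl_subset[of r p] by (intro holder) (rule subsetD, assumption, assumption)+
        ultimately show ?case using N(1) elim(1) by (smt (verit) mult_left_mono)
      qed
      then have "mean_sq_excess constant_polys (I \<times> \<Omega>) u r p \<le> (N * (2 * r) powr \<beta>)\<^sup>2"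
        using u p r by (intro mean_sq_excess_le[where P = "\<lambda>z. v q0"])
          (auto simp: constant_polys_def square_integrable_def)
      also have "\<dots> = (2 powr \<beta>)\<^sup>2 * N\<^sup>2 * r powr (2 * \<beta>)"
        using r by (simp add: powr_mult power_mult_distrib powr_power mult_ac)
      finally show "mean_sq_excess constant_polys (I \<times> \<Omega>) u r p \<le> (2 powr \<beta>)\<^sup>2 * N\<^sup>2 * r powr (2 * \<beta>)" .
    qed
    ultimately show "\<exists>N\<ge>0. holder_norm \<beta> I \<Omega> v = ereal N \<and>
        campanato_bound constant_polys \<beta> r0 (I \<times> \<Omega>) u ((2 powr \<beta>)\<^sup>2 * N\<^sup>2) \<and>
        L2_norm_sq (I \<times> \<Omega>) u \<le> measure lebesgue (I \<times> \<Omega>) * N\<^sup>2"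
      using N by blast
  next
    fix u C assume u: "square_integrable (I \<times> \<Omega>) u" and C: "0 < C"
      and bound: "campanato_bound constant_polys \<beta> r0 (I \<times> \<Omega>) u C"
    let ?M = "total_norm u C"
    obtain v where v: "continuous_on (closure (I \<times> \<Omega>)) v" "AE q in lebesgue_on (I \<times> \<Omega>). u q = v q"
      and sup: "\<And>p. p \<in> closure (I \<times> \<Omega>) \<Longrightarrow> \<bar>v p\<bar> \<le> sup_const * ?M"
      and hol: "\<And>p q. p \<in> closure (I \<times> \<Omega>) \<Longrightarrow> q \<in> closure (I \<times> \<Omega>) \<Longrightarrow>
        \<bar>v q - v p\<bar> \<le> taylor_const * ?M * parabolic_dist p q powr \<beta>"
      using campanato_constant_representative[OF u C bound] by blast
    have M: "0 \<le> ?M" using C L2_norm_sq_nonneg[of "I \<times> \<Omega>" u] by (simp add: total_norm_def)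
    have "holder_norm \<beta> I \<Omega> v \<le> ereal (sup_const * ?M + taylor_const * ?M)"
    proof (rule holder_norm_le[OF dom ne v(1)])
      show "0 \<le> taylor_const * ?M" using M taylor_const_nonneg by simp
      fix p assume "p \<in> I \<times> \<Omega>"
      then have p: "p \<in> closure (I \<times> \<Omega>)" using closure_subset by (rule set_rev_mp)
      then show "\<bar>v p\<bar> \<le> sup_const * ?M" by (rule sup)
      fix q assume "q \<in> I \<times> \<Omega>"
      then have "q \<in> closure (I \<times> \<Omega>)" using closure_subset by (rule set_rev_mp)
      then show "\<bar>v p - v q\<bar> \<le> taylor_const * ?M * parabolic_dist p q powr \<beta>"
        using hol[of q p] p parabolic_dist_commute[of p q] by simp
    qed
    then have le: "holder_norm \<beta> I \<Omega> v
        \<le> ereal ((sup_const + taylor_const) * (sqrt (2 * C) + sqrt (L2_norm_sq (I \<times> \<Omega>) u)))"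
      by (simp add: total_norm_def distrib_right)
    then have "v \<in> holder_space \<beta> I \<Omega>"
      using v(1) le_less_trans[OF le, of \<infinity>] by (simp add: holder_space_def)
    then show "\<exists>v\<in>holder_space \<beta> I \<Omega>. ae_equal_on (I \<times> \<Omega>) u v \<and> holder_norm \<beta> I \<Omega> v
        \<le> ereal ((sup_const + taylor_const) * (sqrt (2 * C) + sqrt (L2_norm_sq (I \<times> \<Omega>) u)))"
      using v(2) le by (auto simp: ae_equal_on_def)
  next
    fix v w assume v: "v \<in> holder_space \<beta> I \<Omega>" and w: "w \<in> holder_space \<beta> I \<Omega>"
      and ae: "ae_equal_on (I \<times> \<Omega>) v w"
    have cont: "continuous_on (I \<times> \<Omega>) f" if "f \<in> holder_space \<beta> I \<Omega>" for f
      by (rule continuous_on_subset[OF _ closure_subset]) (use that in \<open>simp add: holder_space_def\<close>)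
    have eq: "v q = w q" if "q \<in> I \<times> \<Omega>" for q
    proof -
      have "continuous_on (I \<times> \<Omega>) (\<lambda>q. v q - w q)"
        by (intro continuous_on_diff cont v w)
      moreover have "AE q in lebesgue_on (I \<times> \<Omega>). v q - w q = 0" using ae by (simp add: ae_equal_on_def)
      ultimately show ?thesis using ae_zero_continuous_imp_zero[of "\<lambda>q. v q - w q" q] that by simp
    qed
    have "Linf_norm (I \<times> \<Omega>) v = Linf_norm (I \<times> \<Omega>) w" using eq by (rule Linf_norm_cong)
    moreover have "(SUP p\<in>I \<times> \<Omega>. SUP q\<in>I \<times> \<Omega>. ereal (\<bar>v p - v q\<bar> / parabolic_dist p q powr \<beta>)) =
        (SUP p\<in>I \<times> \<Omega>. SUP q\<in>I \<times> \<Omega>. ereal (\<bar>w p - w q\<bar> / parabolic_dist p q powr \<beta>))"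
      using eq by (intro SUP_cong) (auto simp del: SUP_eq_iff)
    ultimately show "holder_norm \<beta> I \<Omega> v = holder_norm \<beta> I \<Omega> w" by (simp only: holder_norm_def)
  qed
qed

section \<open>Hoelder continuous gradients\<close>

lemma space_gradient_eqI:
  assumes "GDERIV (\<lambda>y. u (t, y)) x :> D"
  shows "space_gradient u (t, x) = D"
proof -
  have "D' = D" if "GDERIV (\<lambda>y. u (t, y)) x :> D'" for D'
  proof -
    have "(\<lambda>h. h \<bullet> D') = (\<lambda>h. h \<bullet> D)"
      using that assms unfolding gderiv_def by (rule has_derivative_unique)
    then have "(D' - D) \<bullet> D' = (D' - D) \<bullet> D" by (rule fun_cong)
    then have "(D' - D) \<bullet> (D' - D) = 0" by (simp add: inner_diff_right)
    then show ?thesis by simp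
  qed
  with assms show ?thesis unfolding space_gradient_def prod.case by (rule the_equality)
qed

lemma space_gradient_cong:
  assumes "open \<Omega>" "x \<in> \<Omega>" "\<And>y. y \<in> \<Omega> \<Longrightarrow> v (t, y) = w (t, y)"
  shows "space_gradient v (t, x) = space_gradient w (t, x)"
proof -
  have "GDERIV (\<lambda>y. v (t, y)) x :> D \<longleftrightarrow> GDERIV (\<lambda>y. w (t, y)) x :> D" for D
    unfolding gderiv_def
    using has_derivative_transform_within_open[OF _ assms(1,2), of "\<lambda>y. v (t, y)" _ UNIV "\<lambda>y. w (t, y)"]
      has_derivative_transform_within_open[OF _ assms(1,2), of "\<lambda>y. w (t, y)" _ UNIV "\<lambda>y. v (t, y)"]
      assms(3) by auto
  then have "(\<lambda>D. GDERIV (\<lambda>y. v (t, y)) x :> D) = (\<lambda>D. GDERIV (\<lambda>y. w (t, y)) x :> D)" by (intro ext)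
  then show ?thesis unfolding space_gradient_def prod.case by (rule arg_cong)
qed

lemma gradient_increment_segment:
  fixes f :: "'a::euclidean_space \<Rightarrow> real"
  assumes f: "\<And>y. y \<in> closed_segment a b \<Longrightarrow> GDERIV f y :> g y"
    and L: "\<And>y. y \<in> closed_segment a b \<Longrightarrow> norm (g y - c) \<le> L"
  shows "\<bar>f b - f a - c \<bullet> (b - a)\<bar> \<le> L * norm (b - a)"
proof -
  have "norm ((f b - c \<bullet> b) - (f a - c \<bullet> a)) \<le> L * norm (b - a)"
  proof (rule differentiable_bound[OF convex_closed_segment])
    fix y assume y: "y \<in> closed_segment a b"
    have "(f has_derivative (\<lambda>h. h \<bullet> g y)) (at y within closed_segment a b)"
      using f[OF y] unfolding gderiv_def by (rule has_derivative_at_withinI)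
    then show "((\<lambda>y. f y - c \<bullet> y) has_derivative (\<lambda>h. h \<bullet> g y - c \<bullet> h)) (at y within closed_segment a b)"
      by (intro derivative_intros)
    show "onorm (\<lambda>h. h \<bullet> g y - c \<bullet> h) \<le> L"
    proof (rule onorm_le)
      fix h
      have "h \<bullet> g y - c \<bullet> h = (g y - c) \<bullet> h" using inner_commute[of h "g y"] by (simp add: inner_diff_left)
      also have "norm \<dots> \<le> norm (g y - c) * norm h" using Cauchy_Schwarz_ineq2 by simp
      also have "\<dots> \<le> L * norm h" using L[OF y] by (intro mult_right_mono) auto
      finally show "norm (h \<bullet> g y - c \<bullet> h) \<le> L * norm h" .
    qed
  qed auto
  then show ?thesis by (simp add: inner_diff_right algebra_simps)
qed

text \<open>
  In a domain that is not convex the first-order Taylor estimate is obtained by adding up the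
  increments along a path whose length is comparable with the scale.
\<close>

lemma short_path_taylor:
  fixes f :: "'a::euclidean_space \<Rightarrow> real"
  assumes paths: "short_paths_upto \<Omega> \<epsilon> x" and r: "0 < r" "r \<le> \<epsilon>" and L: "0 \<le> L"
    and y: "y \<in> \<Omega> \<inter> ball x r" and z: "z \<in> \<Omega> \<inter> ball x r"
    and f: "\<And>w. w \<in> \<Omega> \<Longrightarrow> GDERIV f w :> g w"
    and g: "\<And>w. w \<in> \<Omega> \<inter> ball x (r / \<epsilon>) \<Longrightarrow> norm (g w - c) \<le> L"
  shows "\<bar>f z - f y - c \<bullet> (z - y)\<bar> \<le> 6 * r / \<epsilon> * L"
proof -
  obtain a b where ab: "closed_segment y a \<union> closed_segment a b \<union> closed_segment b z \<subseteq> \<Omega> \<inter> ball x (r / \<epsilon>)"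
    using paths r y z unfolding short_paths_upto_def by meson
  have seg: "\<bar>f q - f p - c \<bullet> (q - p)\<bar> \<le> L * (2 * r / \<epsilon>)"
    if sub: "closed_segment p q \<subseteq> \<Omega> \<inter> ball x (r / \<epsilon>)" for p q
  proof -
    have "p \<in> ball x (r / \<epsilon>)" "q \<in> ball x (r / \<epsilon>)" using sub by auto
    then have len: "norm (q - p) \<le> 2 * r / \<epsilon>"
      using dist_triangle[of q p x] by (simp add: dist_commute flip: dist_norm)
    have "\<bar>f q - f p - c \<bullet> (q - p)\<bar> \<le> L * norm (q - p)"
      using sub by (intro gradient_increment_segment[where g = g] f g) auto
    also have "\<dots> \<le> L * (2 * r / \<epsilon>)" using len L by (rule mult_left_mono)
    finally show ?thesis .
  qed
  have s: "closed_segment y a \<subseteq> \<Omega> \<inter> ball x (r / \<epsilon>)"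
      "closed_segment a b \<subseteq> \<Omega> \<inter> ball x (r / \<epsilon>)"
      "closed_segment b z \<subseteq> \<Omega> \<inter> ball x (r / \<epsilon>)"
    using ab by blast+
  have "f z - f y - c \<bullet> (z - y) = (f a - f y - c \<bullet> (a - y)) + (f b - f a - c \<bullet> (b - a)) + (f z - f b - c \<bullet> (z - b))"
    by (simp add: inner_diff_right)
  then have "\<bar>f z - f y - c \<bullet> (z - y)\<bar> \<le> 3 * (L * (2 * r / \<epsilon>))"
    using seg[OF s(1)] seg[OF s(2)] seg[OF s(3)] by linarith
  also have "\<dots> = 6 * r / \<epsilon> * L" by simp
  finally show ?thesis .
qed

lemma holder1_norm_finite:
  assumes "cylinder_domain (I \<times> \<Omega>) r0 \<kappa>" "I \<times> \<Omega> \<noteq> {}" "v \<in> holder1_space \<beta> I \<Omega>"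
  shows "\<exists>N\<ge>0. holder1_norm \<beta> I \<Omega> v = ereal N \<and>
    (AE q in lebesgue_on (I \<times> \<Omega>). \<bar>v q\<bar> \<le> N) \<and>
    (\<forall>x\<in>\<Omega>. \<forall>t\<in>I. \<forall>\<tau>\<in>I. \<bar>v (t, x) - v (\<tau>, x)\<bar> \<le> N * \<bar>t - \<tau>\<bar> powr ((1 + \<beta>) / 2)) \<and>
    (\<forall>p\<in>I \<times> \<Omega>. \<forall>q\<in>I \<times> \<Omega>.
      norm (space_gradient v p - space_gradient v q) \<le> N * parabolic_dist p q powr \<beta>)"
proof -
  interpret cylinder_domain "I \<times> \<Omega>" r0 \<kappa> by fact
  let ?tq = "\<lambda>x t \<tau>. ereal (\<bar>v (t, x) - v (\<tau>, x)\<bar> / \<bar>t - \<tau>\<bar> powr ((1 + \<beta>) / 2))"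
  let ?gq = "\<lambda>p q. ereal (norm (space_gradient v p - space_gradient v q) / parabolic_dist p q powr \<beta>)"
  let ?L = "Linf_norm (I \<times> \<Omega>) v" and ?G = "Linf_norm (I \<times> \<Omega>) (space_gradient v)"
  let ?T = "SUP x\<in>\<Omega>. SUP t\<in>I. SUP \<tau>\<in>I. ?tq x t \<tau>" and ?H = "SUP p\<in>I \<times> \<Omega>. SUP q\<in>I \<times> \<Omega>. ?gq p q"
  have neI: "I \<noteq> {}" and ne\<Omega>: "\<Omega> \<noteq> {}" using assms(2) by auto
  have L: "0 \<le> ?L" and G: "0 \<le> ?G" by (rule Linf_norm_nonneg[OF emeasure_S_nonzero[OF assms(2)]])+
  have T: "0 \<le> ?T"
  proof -
    obtain x where "x \<in> \<Omega>" using ne\<Omega> by blast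
    then show ?thesis by (rule SUP_upper2) (rule nested_SUP_nonneg[OF neI], simp)
  qed
  have H: "0 \<le> ?H" by (rule nested_SUP_nonneg[OF assms(2)]) simp
  have norm: "holder1_norm \<beta> I \<Omega> v = ?L + ?G + ?T + ?H" by (simp only: holder1_norm_def)
  have LG: "0 \<le> ?L + ?G" using L G by (rule add_nonneg_nonneg)
  have LGT: "0 \<le> ?L + ?G + ?T" using LG T by (rule add_nonneg_nonneg)
  have "0 \<le> holder1_norm \<beta> I \<Omega> v" unfolding norm using LGT H by (rule add_nonneg_nonneg)
  moreover have "holder1_norm \<beta> I \<Omega> v < \<infinity>" using assms(3) by (simp add: holder1_space_def)
  ultimately obtain N where N: "0 \<le> N" "holder1_norm \<beta> I \<Omega> v = ereal N"
    by (rule ereal_nonneg_finite)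
  then have "?L + ?G + ?T + ?H \<le> ereal N" using norm by simp
  note s1 = ereal_sum_split[OF LGT H this]
  note s2 = ereal_sum_split[OF LG T s1(1)]
  note s3 = ereal_sum_split[OF L G s2(1)]
  have "\<bar>v (t, x) - v (\<tau>, x)\<bar> \<le> N * \<bar>t - \<tau>\<bar> powr ((1 + \<beta>) / 2)"
    if "x \<in> \<Omega>" "t \<in> I" "\<tau> \<in> I" for x t \<tau>
  proof -
    have "?tq x t \<tau> \<le> (SUP t\<in>I. SUP \<tau>\<in>I. ?tq x t \<tau>)" using that by (intro nested_SUP_upper)
    also have "\<dots> \<le> ?T" using that by (intro SUP_upper)
    also have "\<dots> \<le> ereal N" by (rule s2(2))
    finally have "\<bar>v (t, x) - v (\<tau>, x)\<bar> / \<bar>t - \<tau>\<bar> powr ((1 + \<beta>) / 2) \<le> N" by simp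
    then show ?thesis using N(1) by (subst (asm) quotient_le_iff_le_mult) auto
  qed
  moreover have "norm (space_gradient v p - space_gradient v q) \<le> N * parabolic_dist p q powr \<beta>"
    if "p \<in> I \<times> \<Omega>" "q \<in> I \<times> \<Omega>" for p q
  proof -
    have "?gq p q \<le> ereal N"
      using nested_SUP_upper[OF that, of ?gq] s1(2) by (rule order_trans)
    then show ?thesis using parabolic_quotient_le_iff[OF N(1), of "space_gradient v" p q \<beta>] by simp
  qed
  moreover have "AE q in lebesgue_on (I \<times> \<Omega>). \<bar>v q\<bar> \<le> N" using Linf_norm_AE[OF s3(1)] by simp
  ultimately show ?thesis using N by blast
qed

lemma holder1_norm_le:
  assumes "cylinder_domain (I \<times> \<Omega>) r0 \<kappa>" "I \<times> \<Omega> \<noteq> {}"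
    and cont: "continuous_on (closure (I \<times> \<Omega>)) v" "continuous_on (closure (I \<times> \<Omega>)) G"
    and G: "\<And>p. p \<in> I \<times> \<Omega> \<Longrightarrow> space_gradient v p = G p"
    and B: "0 \<le> Bt" "0 \<le> Bg"
    and bound: "\<And>p. p \<in> I \<times> \<Omega> \<Longrightarrow> \<bar>v p\<bar> \<le> B" "\<And>p. p \<in> I \<times> \<Omega> \<Longrightarrow> norm (G p) \<le> B"
    and time: "\<And>x t \<tau>. x \<in> \<Omega> \<Longrightarrow> t \<in> I \<Longrightarrow> \<tau> \<in> I \<Longrightarrow>
      \<bar>v (t, x) - v (\<tau>, x)\<bar> \<le> Bt * \<bar>t - \<tau>\<bar> powr ((1 + \<beta>) / 2)"
    and holder: "\<And>p q. p \<in> I \<times> \<Omega> \<Longrightarrow> q \<in> I \<times> \<Omega> \<Longrightarrow> norm (G p - G q) \<le> Bg * parabolic_dist p q powr \<beta>"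
  shows "holder1_norm \<beta> I \<Omega> v \<le> ereal (B + B + Bt + Bg)"
proof -
  interpret cylinder_domain "I \<times> \<Omega>" r0 \<kappa> by fact
  have v: "continuous_on (I \<times> \<Omega>) v" and G': "continuous_on (I \<times> \<Omega>) G"
    by (rule continuous_on_subset[OF cont(1) closure_subset],
        rule continuous_on_subset[OF cont(2) closure_subset])
  have 1: "Linf_norm (I \<times> \<Omega>) v \<le> ereal B" using v bound(1) by (intro Linf_norm_le sets_S) auto
  have "Linf_norm (I \<times> \<Omega>) (space_gradient v) = Linf_norm (I \<times> \<Omega>) G" using G by (rule Linf_norm_cong)
  also have "\<dots> \<le> ereal B" using G' bound(2) by (intro Linf_norm_le sets_S) auto
  finally have 2: "Linf_norm (I \<times> \<Omega>) (space_gradient v) \<le> ereal B" .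
  have 3: "(SUP x\<in>\<Omega>. SUP t\<in>I. SUP \<tau>\<in>I.
      ereal (\<bar>v (t, x) - v (\<tau>, x)\<bar> / \<bar>t - \<tau>\<bar> powr ((1 + \<beta>) / 2))) \<le> ereal Bt"
  proof (intro SUP_least)
    fix x t \<tau> assume "x \<in> \<Omega>" "t \<in> I" "\<tau> \<in> I"
    then have "\<bar>v (t, x) - v (\<tau>, x)\<bar> \<le> Bt * \<bar>t - \<tau>\<bar> powr ((1 + \<beta>) / 2)" by (rule time)
    then have "\<bar>v (t, x) - v (\<tau>, x)\<bar> / \<bar>t - \<tau>\<bar> powr ((1 + \<beta>) / 2) \<le> Bt"
      using B by (subst quotient_le_iff_le_mult) auto
    then show "ereal (\<bar>v (t, x) - v (\<tau>, x)\<bar> / \<bar>t - \<tau>\<bar> powr ((1 + \<beta>) / 2)) \<le> ereal Bt" by simp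
  qed
  have 4: "(SUP p\<in>I \<times> \<Omega>. SUP q\<in>I \<times> \<Omega>.
      ereal (norm (space_gradient v p - space_gradient v q) / parabolic_dist p q powr \<beta>)) \<le> ereal Bg"
  proof (intro SUP_least)
    fix p q assume pq: "p \<in> I \<times> \<Omega>" "q \<in> I \<times> \<Omega>"
    then have "norm (G p - G q) \<le> Bg * parabolic_dist p q powr \<beta>" by (rule holder)
    then have "norm (G p - G q) / parabolic_dist p q powr \<beta> \<le> Bg"
      using parabolic_quotient_le_iff[OF B(2), of G p q \<beta>] by simp
    then show "ereal (norm (space_gradient v p - space_gradient v q) / parabolic_dist p q powr \<beta>) \<le> ereal Bg"
      unfolding G[OF pq(1)] G[OF pq(2)] by simp
  qed
  have "holder1_norm \<beta> I \<Omega> v \<le> ereal B + ereal B + ereal Bt + ereal Bg"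
    unfolding holder1_norm_def by (intro add_mono 1 2 3 4)
  then show ?thesis by simp
qed

lemma gderiv_from_taylor:
  fixes f :: "'a::euclidean_space \<Rightarrow> real"
  assumes "open \<Omega>" "x \<in> \<Omega>" and \<gamma>: "1 < \<gamma>"
    and taylor: "\<And>y. y \<in> \<Omega> \<Longrightarrow> \<bar>f y - f x - g \<bullet> (y - x)\<bar> \<le> C * norm (y - x) powr \<gamma>"
  shows "GDERIV f x :> g"
proof -
  obtain e where e: "0 < e" "ball x e \<subseteq> \<Omega>" using assms(1,2) openE by blast
  have lim: "((\<lambda>y. C * norm (y - x) powr (\<gamma> - 1)) \<longlongrightarrow> 0) (at x)"
  proof -
    have "((\<lambda>y. norm (y - x)) \<longlongrightarrow> norm (x - x)) (at x)" by (intro tendsto_intros)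
    then have "((\<lambda>y. C * norm (y - x) powr (\<gamma> - 1)) \<longlongrightarrow> C * 0 powr (\<gamma> - 1)) (at x)"
      using \<gamma> by (intro tendsto_mult tendsto_const tendsto_powr2) auto
    then show ?thesis by simp
  qed
  show ?thesis
    unfolding gderiv_def
  proof (rule has_derivativeI_sandwich[OF e(1) _ _ lim])
    show "bounded_linear (\<lambda>h. h \<bullet> g)" by (rule bounded_linear_inner_left)
    fix y assume y: "y \<noteq> x" "dist y x < e"
    then have "y \<in> \<Omega>" using e(2) by (auto simp: dist_commute)
    then have "\<bar>f y - f x - g \<bullet> (y - x)\<bar> \<le> C * norm (y - x) powr \<gamma>" by (rule taylor)
    also have "norm (y - x) powr \<gamma> = norm (y - x) powr (\<gamma> - 1) * norm (y - x)"
      using y(1) by (simp add: powr_diff)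
    finally show "norm (f y - f x - (y - x) \<bullet> g) / norm (y - x) \<le> C * norm (y - x) powr (\<gamma> - 1)"
      using y(1) by (simp add: inner_commute pos_divide_le_eq mult.assoc)
  qed
qed

text \<open>
  In the easy direction the competitor is the spatial Taylor polynomial at a point \<open>(t0, x0)\<close> of the
  cylinder. Its error at \<open>(\<tau>, z)\<close> splits into the increment of \<open>v\<close> from \<open>t0\<close> to \<open>\<tau>\<close> at the place \<open>z\<close>,
  and the Taylor error at the time \<open>t0\<close>, which is integrated along a short path from \<open>x0\<close> to \<open>z\<close>.
\<close>

lemma holder1_campanato_equivalence:
  fixes I :: "real set" and \<Omega> :: "'a::euclidean_space set"
  assumes dom: "cylinder_domain (I \<times> \<Omega>) r0 \<kappa>" and ne: "I \<times> \<Omega> \<noteq> {}" and \<beta>: "0 < \<beta>" "\<beta> \<le> 1"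
    and \<Omega>: "open \<Omega>" and \<epsilon>: "0 < \<epsilon>" and paths: "\<And>x. x \<in> closure \<Omega> \<Longrightarrow> short_paths_upto \<Omega> \<epsilon> x"
  shows "(\<forall>u. square_integrable (I \<times> \<Omega>) u \<longrightarrow>
         (\<exists>v\<in>holder1_space \<beta> I \<Omega>. ae_equal_on (I \<times> \<Omega>) u v) \<longleftrightarrow>
         (\<exists>C>0. campanato_bound affine_polys (1 + \<beta>) r0 (I \<times> \<Omega>) u C)) \<and>
      (\<exists>K>0. \<forall>u. \<forall>v\<in>holder1_space \<beta> I \<Omega>.
         square_integrable (I \<times> \<Omega>) u \<and> ae_equal_on (I \<times> \<Omega>) u v \<longrightarrow>
         (let Cmin = (LEAST C. campanato_bound affine_polys (1 + \<beta>) r0 (I \<times> \<Omega>) u C);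
              N = holder1_norm \<beta> I \<Omega> v
          in ereal (L2_norm_sq (I \<times> \<Omega>) u + Cmin) \<le> ereal K * N\<^sup>2 \<and>
             N\<^sup>2 \<le> ereal K * ereal (L2_norm_sq (I \<times> \<Omega>) u + Cmin)))"
proof -
  interpret campanato_exponent "I \<times> \<Omega>" r0 \<kappa> "1 + \<beta>"
    using dom \<beta> by (simp add: campanato_exponent_def campanato_exponent_axioms_def)
  \<comment> \<open>summands: the increment in time, the three segments of the path, the scales above \<open>\<epsilon>\<close>\<close>
  define k where "k = 2 + 3 * (2 / \<epsilon>) powr (1 + \<beta>) + (1 / \<epsilon>) powr (1 + \<beta>)"
  have k: "0 \<le> k" "2 + 3 * (2 / \<epsilon>) powr (1 + \<beta>) \<le> k" "(1 / \<epsilon>) powr (1 + \<beta>) \<le> k"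
    by (auto simp: k_def)
  show ?thesis
  proof (rule campanato_equivalence[OF ne affine_polys_nonempty])
    show "0 \<le> k\<^sup>2" "0 \<le> measure lebesgue (I \<times> \<Omega>)"
      "0 \<le> sup_const + sup_const + taylor_const + gradient_const"
      using sup_const_nonneg taylor_const_nonneg gradient_const_nonneg by auto
  next
    fix u v assume v: "v \<in> holder1_space \<beta> I \<Omega>" and u: "square_integrable (I \<times> \<Omega>) u"
      and ae: "ae_equal_on (I \<times> \<Omega>) u v"
    obtain N where N: "0 \<le> N" "holder1_norm \<beta> I \<Omega> v = ereal N"
        "AE q in lebesgue_on (I \<times> \<Omega>). \<bar>v q\<bar> \<le> N"
      and time: "\<And>x t \<tau>. x \<in> \<Omega> \<Longrightarrow> t \<in> I \<Longrightarrow> \<tau> \<in> I \<Longrightarrow>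
        \<bar>v (t, x) - v (\<tau>, x)\<bar> \<le> N * \<bar>t - \<tau>\<bar> powr ((1 + \<beta>) / 2)"
      and holder: "\<And>p q. p \<in> I \<times> \<Omega> \<Longrightarrow> q \<in> I \<times> \<Omega> \<Longrightarrow>
        norm (space_gradient v p - space_gradient v q) \<le> N * parabolic_dist p q powr \<beta>"
      using holder1_norm_finite[OF dom ne v] by blast
    have gder: "GDERIV (\<lambda>y. v (t, y)) x :> space_gradient v (t, x)" if tx: "t \<in> I" "x \<in> \<Omega>" for t x
    proof -
      obtain D where D: "GDERIV (\<lambda>y. v (t, y)) x :> D" using v tx unfolding holder1_space_def by blast
      then show ?thesis using space_gradient_eqI[OF D] by simp
    qed
    have uv: "AE q in lebesgue_on (I \<times> \<Omega>). u q = v q" using ae by (simp add: ae_equal_on_def)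
    have uN: "AE q in lebesgue_on (I \<times> \<Omega>). \<bar>u q\<bar> \<le> N" using uv N(3) by eventually_elim simp
    then have "L2_norm_sq (I \<times> \<Omega>) u \<le> measure lebesgue (I \<times> \<Omega>) * N\<^sup>2" by (rule L2_norm_sq_le_sup[OF u])
    moreover have "campanato_bound affine_polys (1 + \<beta>) r0 (I \<times> \<Omega>) u (k\<^sup>2 * N\<^sup>2)"
      unfolding campanato_bound_def
    proof (intro ballI allI impI)
      fix p r assume p: "p \<in> closure (I \<times> \<Omega>)" and "0 < r \<and> r \<le> r0"
      then have r: "0 < r" "r \<le> r0" by auto
      have "\<exists>P\<in>affine_polys. continuous_on UNIV P \<and>
          (AE q in lebesgue_on (cyl r p). \<bar>u q - P (snd q)\<bar> \<le> k * N * r powr (1 + \<beta>))"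
      proof (cases "r \<le> \<epsilon>")
        case False
        \<comment> \<open>no paths at this scale, but \<open>r\<close> is bounded below and the zero polynomial suffices\<close>
        have "1 \<le> (1 / \<epsilon> * r) powr (1 + \<beta>)"
          using False \<epsilon> \<beta> by (intro ge_one_powr_ge_zero) (auto simp: field_simps)
        also have "\<dots> = (1 / \<epsilon>) powr (1 + \<beta>) * r powr (1 + \<beta>)" by (rule powr_mult)
        also have "\<dots> \<le> k * r powr (1 + \<beta>)" using k(3) by (intro mult_right_mono) auto
        finally have "N * 1 \<le> N * (k * r powr (1 + \<beta>))" using N(1) by (intro mult_left_mono)
        then have le: "N \<le> k * N * r powr (1 + \<beta>)" by (simp add: mult_ac)
        have "AE q in lebesgue_on (cyl r p). \<bar>u q\<bar> \<le> N"
          by (rule AE_lebesgue_on_subset[OF uN cyl_subset cyl_sets sets_S])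
        then have "AE q in lebesgue_on (cyl r p). \<bar>u q - 0\<bar> \<le> k * N * r powr (1 + \<beta>)"
          by eventually_elim (use le in simp)
        moreover have "(\<lambda>z::'a. 0) \<in> affine_polys"
          unfolding affine_polys_def by (intro CollectI exI[of _ 0]) simp
        ultimately show ?thesis by (intro bexI[of _ "\<lambda>z. 0"]) auto
      next
        case True
        obtain t x where tx: "p = (t, x)" "x \<in> closure \<Omega>" using p by (auto simp: closure_Times)
        have "cyl r p \<noteq> {}" using size_pos[OF p r] by force
        then obtain t0 x0 where q0: "(t0, x0) \<in> cyl r p" by (auto simp: ex_in_conv[symmetric])
        then have q0S: "t0 \<in> I" "x0 \<in> \<Omega>" and x0: "x0 \<in> ball x r"
          by (auto simp: cyl_def parabolic_cylinder_def tx(1))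
        define c where "c = space_gradient v (t0, x0)"
        define P where "P = (\<lambda>z. (v (t0, x0) - c \<bullet> x0) + c \<bullet> z)"
        have P_eq: "P z = v (t0, x0) + c \<bullet> (z - x0)" for z by (simp add: P_def inner_diff_right)
        have near: "\<bar>v q - P (snd q)\<bar> \<le> k * N * r powr (1 + \<beta>)" if q: "q \<in> cyl r p" for q
        proof -
          obtain \<tau> z where [simp]: "q = (\<tau>, z)" by force
          have qS: "\<tau> \<in> I" "z \<in> \<Omega>" and z: "z \<in> ball x r"
            using q by (auto simp: cyl_def parabolic_cylinder_def tx(1))
          have "\<bar>\<tau> - t0\<bar> \<le> 2 * r\<^sup>2"
            using q q0 by (auto simp: cyl_def parabolic_cylinder_def tx(1))
          then have "\<bar>\<tau> - t0\<bar> powr ((1 + \<beta>) / 2) \<le> (2 * r\<^sup>2) powr ((1 + \<beta>) / 2)"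
            using \<beta> by (intro powr_mono2) auto
          also have "\<dots> = 2 powr ((1 + \<beta>) / 2) * (r powr 2) powr ((1 + \<beta>) / 2)"
            using r by (simp add: powr_mult)
          also have "\<dots> = 2 powr ((1 + \<beta>) / 2) * r powr (1 + \<beta>)"
            unfolding powr_powr by (simp add: add_divide_distrib)
          also have "\<dots> \<le> 2 powr 1 * r powr (1 + \<beta>)" using \<beta> by (intro mult_right_mono powr_mono) auto
          finally have "\<bar>\<tau> - t0\<bar> powr ((1 + \<beta>) / 2) \<le> 2 * r powr (1 + \<beta>)" by simp
          then have "N * \<bar>\<tau> - t0\<bar> powr ((1 + \<beta>) / 2) \<le> N * (2 * r powr (1 + \<beta>))"
            using N(1) by (rule mult_left_mono)
          then have 1: "\<bar>v (\<tau>, z) - v (t0, z)\<bar> \<le> N * (2 * r powr (1 + \<beta>))"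
            using time[OF qS(2,1) q0S(1)] by linarith
          have "norm (space_gradient v (t0, w) - c) \<le> N * (2 * r / \<epsilon>) powr \<beta>"
            if w: "w \<in> \<Omega> \<inter> ball x (r / \<epsilon>)" and x0': "x0 \<in> ball x (r / \<epsilon>)" for w
          proof -
            have "norm (w - x0) \<le> 2 * r / \<epsilon>"
              using w x0' dist_triangle[of w x0 x] by (simp add: dist_commute flip: dist_norm)
            then have "parabolic_dist (t0, w) (t0, x0) powr \<beta> \<le> (2 * r / \<epsilon>) powr \<beta>"
              unfolding parabolic_dist_same_time using \<beta> by (intro powr_mono2) auto
            then have "N * parabolic_dist (t0, w) (t0, x0) powr \<beta> \<le> N * (2 * r / \<epsilon>) powr \<beta>"
              using N(1) by (rule mult_left_mono)
            then show ?thesis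
              using holder[of "(t0, w)" "(t0, x0)"] w q0S by (simp add: c_def)
          qed
          \<comment> \<open>also for \<open>\<epsilon> > 1\<close>, since a path from \<open>x0\<close> to itself stays in this ball\<close>
          moreover have "x0 \<in> ball x (r / \<epsilon>)"
          proof -
            obtain a b where "closed_segment x0 a \<union> closed_segment a b \<union> closed_segment b x0
                \<subseteq> \<Omega> \<inter> ball x (r / \<epsilon>)"
              using paths[OF tx(2)] r(1) True q0S(2) x0 unfolding short_paths_upto_def by blast
            then show ?thesis using ends_in_segment(1)[of x0 a] by blast
          qed
          ultimately have grad: "\<And>w. w \<in> \<Omega> \<inter> ball x (r / \<epsilon>) \<Longrightarrow>
              norm (space_gradient v (t0, w) - c) \<le> N * (2 * r / \<epsilon>) powr \<beta>" by blast
          have "\<bar>v (t0, z) - v (t0, x0) - c \<bullet> (z - x0)\<bar> \<le> 6 * r / \<epsilon> * (N * (2 * r / \<epsilon>) powr \<beta>)"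
            using x0 z q0S qS N(1) grad
            by (intro short_path_taylor[OF paths[OF tx(2)] r(1) True,
                  where f = "\<lambda>y. v (t0, y)" and g = "\<lambda>y. space_gradient v (t0, y)"] gder) auto
          also have "\<dots> = 3 * N * ((2 * r / \<epsilon>) powr 1 * (2 * r / \<epsilon>) powr \<beta>)" using r \<epsilon> by simp
          also have "\<dots> = 3 * N * (2 / \<epsilon> * r) powr (1 + \<beta>)" by (simp add: powr_add)
          also have "(2 / \<epsilon> * r) powr (1 + \<beta>) = (2 / \<epsilon>) powr (1 + \<beta>) * r powr (1 + \<beta>)" by (rule powr_mult)
          finally have 2: "\<bar>v (t0, z) - v (t0, x0) - c \<bullet> (z - x0)\<bar>
              \<le> 3 * N * ((2 / \<epsilon>) powr (1 + \<beta>) * r powr (1 + \<beta>))" .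
          have "\<bar>v q - P (snd q)\<bar> \<le> \<bar>v (\<tau>, z) - v (t0, z)\<bar> + \<bar>v (t0, z) - v (t0, x0) - c \<bullet> (z - x0)\<bar>"
            by (simp add: P_eq)
          also have "\<dots> \<le> N * (2 * r powr (1 + \<beta>)) + 3 * N * ((2 / \<epsilon>) powr (1 + \<beta>) * r powr (1 + \<beta>))"
            using 1 2 by (rule add_mono)
          also have "\<dots> = (2 + 3 * (2 / \<epsilon>) powr (1 + \<beta>)) * (N * r powr (1 + \<beta>))"
            by (simp add: algebra_simps)
          also have "\<dots> \<le> k * (N * r powr (1 + \<beta>))"
            using k(2) N(1) by (intro mult_right_mono) auto
          finally show ?thesis by (simp add: mult.assoc)
        qed
        have "AE q in lebesgue_on (cyl r p). u q = v q"
          by (rule AE_lebesgue_on_subset[OF uv cyl_subset cyl_sets sets_S])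
        moreover have "AE q in lebesgue_on (cyl r p). q \<in> cyl r p" by (rule AE_I2) simp
        ultimately have "AE q in lebesgue_on (cyl r p). \<bar>u q - P (snd q)\<bar> \<le> k * N * r powr (1 + \<beta>)"
          by eventually_elim (use near in simp)
        moreover have "P \<in> affine_polys" by (auto simp: affine_polys_def P_def)
        moreover have "continuous_on UNIV P" unfolding P_def by (intro continuous_intros)
        ultimately show ?thesis by blast
      qed
      then obtain P where P: "P \<in> affine_polys" "continuous_on UNIV P"
        "AE q in lebesgue_on (cyl r p). \<bar>u q - P (snd q)\<bar> \<le> k * N * r powr (1 + \<beta>)" by blast
      have "u \<in> borel_measurable (lebesgue_on (I \<times> \<Omega>))" using u by (simp add: square_integrable_def)
      then have "mean_sq_excess affine_polys (I \<times> \<Omega>) u r p \<le> (k * N * r powr (1 + \<beta>))\<^sup>2"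
        using P p r by (intro mean_sq_excess_le)
      also have "\<dots> = k\<^sup>2 * N\<^sup>2 * r powr (2 * (1 + \<beta>))"
        using r by (simp add: power_mult_distrib powr_power mult_ac)
      finally show "mean_sq_excess affine_polys (I \<times> \<Omega>) u r p \<le> k\<^sup>2 * N\<^sup>2 * r powr (2 * (1 + \<beta>))" .
    qed
    ultimately show "\<exists>N\<ge>0. holder1_norm \<beta> I \<Omega> v = ereal N \<and>
        campanato_bound affine_polys (1 + \<beta>) r0 (I \<times> \<Omega>) u (k\<^sup>2 * N\<^sup>2) \<and>
        L2_norm_sq (I \<times> \<Omega>) u \<le> measure lebesgue (I \<times> \<Omega>) * N\<^sup>2"
      using N by blast
  next
    fix u C assume u: "square_integrable (I \<times> \<Omega>) u" and C: "0 < C"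
      and bound: "campanato_bound affine_polys (1 + \<beta>) r0 (I \<times> \<Omega>) u C"
    let ?M = "total_norm u C"
    have \<gamma>: "1 < 1 + \<beta>" using \<beta> by simp
    obtain v G where cont: "continuous_on (closure (I \<times> \<Omega>)) v" "continuous_on (closure (I \<times> \<Omega>)) G"
      and ae: "AE q in lebesgue_on (I \<times> \<Omega>). u q = v q"
      and sup: "\<And>p. p \<in> closure (I \<times> \<Omega>) \<Longrightarrow> \<bar>v p\<bar> \<le> sup_const * ?M"
        "\<And>p. p \<in> closure (I \<times> \<Omega>) \<Longrightarrow> norm (G p) \<le> sup_const * ?M"
      and taylor': "\<And>p q. p \<in> closure (I \<times> \<Omega>) \<Longrightarrow> q \<in> closure (I \<times> \<Omega>) \<Longrightarrow>
        \<bar>v q - v p - G p \<bullet> (snd q - snd p)\<bar> \<le> taylor_const * ?M * parabolic_dist p q powr (1 + \<beta>)"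
      and hol': "\<And>p q. p \<in> closure (I \<times> \<Omega>) \<Longrightarrow> q \<in> closure (I \<times> \<Omega>) \<Longrightarrow>
        norm (G q - G p) \<le> gradient_const * ?M * parabolic_dist p q powr (1 + \<beta> - 1)"
      using campanato_affine_representative[OF u C \<gamma> bound] by blast
    have M: "0 \<le> ?M" using C L2_norm_sq_nonneg[of "I \<times> \<Omega>" u] by (simp add: total_norm_def)
    have cl: "p \<in> closure (I \<times> \<Omega>)" if "p \<in> I \<times> \<Omega>" for p
      using that closure_subset by (rule set_rev_mp)
    have gder: "GDERIV (\<lambda>y. v (t, y)) x :> G (t, x)" if tx: "t \<in> I" "x \<in> \<Omega>" for t x
    proof (rule gderiv_from_taylor[OF \<Omega> tx(2) \<gamma>])
      fix y assume "y \<in> \<Omega>"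
      then show "\<bar>v (t, y) - v (t, x) - G (t, x) \<bullet> (y - x)\<bar> \<le> taylor_const * ?M * norm (y - x) powr (1 + \<beta>)"
        using taylor'[of "(t, x)" "(t, y)"] tx cl
        by (simp add: parabolic_dist_same_time norm_minus_commute)
    qed
    have grad: "space_gradient v p = G p" if "p \<in> I \<times> \<Omega>" for p
      using that space_gradient_eqI[OF gder] by auto
    have "holder1_norm \<beta> I \<Omega> v
        \<le> ereal (sup_const * ?M + sup_const * ?M + taylor_const * ?M + gradient_const * ?M)"
    proof (rule holder1_norm_le[OF dom ne cont grad])
      show "0 \<le> taylor_const * ?M" "0 \<le> gradient_const * ?M"
        using M taylor_const_nonneg gradient_const_nonneg by auto
      fix x t \<tau> assume "x \<in> \<Omega>" "t \<in> I" "\<tau> \<in> I"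
      then have "\<bar>v (t, x) - v (\<tau>, x)\<bar> \<le> taylor_const * ?M * parabolic_dist (\<tau>, x) (t, x) powr (1 + \<beta>)"
        using taylor'[of "(\<tau>, x)" "(t, x)"] cl by simp
      also have "parabolic_dist (\<tau>, x) (t, x) powr (1 + \<beta>) = \<bar>t - \<tau>\<bar> powr ((1 + \<beta>) / 2)"
        unfolding parabolic_dist_same_space abs_minus_commute[of \<tau> t]
        by (subst powr_half_sqrt[symmetric]) (simp_all only: powr_powr abs_ge_zero times_divide_eq_left mult_1_left)
      finally show "\<bar>v (t, x) - v (\<tau>, x)\<bar> \<le> taylor_const * ?M * \<bar>t - \<tau>\<bar> powr ((1 + \<beta>) / 2)" .
    next
      fix p q assume "p \<in> I \<times> \<Omega>" "q \<in> I \<times> \<Omega>"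
      then show "norm (G p - G q) \<le> gradient_const * ?M * parabolic_dist p q powr \<beta>"
        using hol'[of q p] cl parabolic_dist_commute[of p q] by simp
    qed (use sup cl in auto)
    then have le: "holder1_norm \<beta> I \<Omega> v \<le> ereal ((sup_const + sup_const + taylor_const + gradient_const)
        * (sqrt (2 * C) + sqrt (L2_norm_sq (I \<times> \<Omega>) u)))"
      by (simp only: total_norm_def distrib_right)
    have "v \<in> holder1_space \<beta> I \<Omega>"
      unfolding holder1_space_def
    proof (intro CollectI conjI ballI)
      show "\<exists>D. GDERIV (\<lambda>y. v (t, y)) x :> D" if "t \<in> I" "x \<in> \<Omega>" for t x
        using gder[OF that] by blast
      show "\<exists>G. continuous_on (closure (I \<times> \<Omega>)) G \<and> (\<forall>p\<in>I \<times> \<Omega>. G p = space_gradient v p)"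
        using cont(2) grad by (intro exI[of _ G]) auto
      show "holder1_norm \<beta> I \<Omega> v < \<infinity>" using le by (rule le_less_trans) simp
    qed (rule cont(1))
    then show "\<exists>v\<in>holder1_space \<beta> I \<Omega>. ae_equal_on (I \<times> \<Omega>) u v \<and> holder1_norm \<beta> I \<Omega> v
        \<le> ereal ((sup_const + sup_const + taylor_const + gradient_const)
          * (sqrt (2 * C) + sqrt (L2_norm_sq (I \<times> \<Omega>) u)))"
      using ae le by (auto simp: ae_equal_on_def)
  next
    fix v w assume v: "v \<in> holder1_space \<beta> I \<Omega>" and w: "w \<in> holder1_space \<beta> I \<Omega>"
      and ae: "ae_equal_on (I \<times> \<Omega>) v w"
    have cont: "continuous_on (I \<times> \<Omega>) f" if "f \<in> holder1_space \<beta> I \<Omega>" for f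
      by (rule continuous_on_subset[OF _ closure_subset]) (use that in \<open>simp add: holder1_space_def\<close>)
    have eq: "v q = w q" if "q \<in> I \<times> \<Omega>" for q
    proof -
      have "continuous_on (I \<times> \<Omega>) (\<lambda>q. v q - w q)"
        by (intro continuous_on_diff cont v w)
      moreover have "AE q in lebesgue_on (I \<times> \<Omega>). v q - w q = 0" using ae by (simp add: ae_equal_on_def)
      ultimately show ?thesis using ae_zero_continuous_imp_zero[of "\<lambda>q. v q - w q" q] that by simp
    qed
    have grad_eq: "space_gradient v q = space_gradient w q" if qS: "q \<in> I \<times> \<Omega>" for q
    proof -
      obtain t x where q: "q = (t, x)" "t \<in> I" "x \<in> \<Omega>" using qS by blast
      then show ?thesis using space_gradient_cong[OF \<Omega>, of x v t w] eq by simp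
    qed
    have "Linf_norm (I \<times> \<Omega>) v = Linf_norm (I \<times> \<Omega>) w" using eq by (rule Linf_norm_cong)
    moreover have "Linf_norm (I \<times> \<Omega>) (space_gradient v) = Linf_norm (I \<times> \<Omega>) (space_gradient w)"
      using grad_eq by (rule Linf_norm_cong)
    moreover have "(SUP x\<in>\<Omega>. SUP t\<in>I. SUP \<tau>\<in>I. ereal (\<bar>v (t, x) - v (\<tau>, x)\<bar> / \<bar>t - \<tau>\<bar> powr ((1 + \<beta>) / 2))) =
        (SUP x\<in>\<Omega>. SUP t\<in>I. SUP \<tau>\<in>I. ereal (\<bar>w (t, x) - w (\<tau>, x)\<bar> / \<bar>t - \<tau>\<bar> powr ((1 + \<beta>) / 2)))"
      using eq by (intro SUP_cong refl) simp
    moreover have "(SUP p\<in>I \<times> \<Omega>. SUP q\<in>I \<times> \<Omega>.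
          ereal (norm (space_gradient v p - space_gradient v q) / parabolic_dist p q powr \<beta>)) =
        (SUP p\<in>I \<times> \<Omega>. SUP q\<in>I \<times> \<Omega>.
          ereal (norm (space_gradient w p - space_gradient w q) / parabolic_dist p q powr \<beta>))"
      using grad_eq by (intro SUP_cong refl) simp
    ultimately show "holder1_norm \<beta> I \<Omega> v = holder1_norm \<beta> I \<Omega> w" by (simp only: holder1_norm_def)
  qed
qed

section \<open>Lipschitz cylinders\<close>

lemma lipschitz_cylinder_domain:
  fixes \<Omega> :: "'a::euclidean_space set"
  assumes "bounded \<Omega>" "lipschitz_domain \<Omega>" "bounded I" "is_interval I" "interior I \<noteq> {}"
  shows "\<exists>\<kappa>. cylinder_domain (I \<times> \<Omega>) (min (measure lebesgue I powr (1/2)) (diameter \<Omega>)) \<kappa>"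
proof -
  obtain \<kappa> where \<kappa>: "0 < \<kappa>" "\<kappa> \<le> 1"
    and box: "\<And>p r. p \<in> closure (I \<times> \<Omega>) \<Longrightarrow> 0 < r \<Longrightarrow> r \<le> min (measure lebesgue I powr (1/2)) (diameter \<Omega>) \<Longrightarrow>
      \<exists>s y. {s - \<kappa> * r\<^sup>2 <..< s + \<kappa> * r\<^sup>2} \<times> ball y (\<kappa> * r) \<subseteq> parabolic_cylinder r p \<inter> I \<times> \<Omega>"
    using cylinder_interior_box[OF assms] by metis
  have \<Omega>: "open \<Omega>" "\<Omega> \<noteq> {}" using assms(2) by (auto simp: lipschitz_domain_def)
  have I: "I \<in> lmeasurable" using assms(3,4) by (simp add: is_interval_convex measurable_convex)
  obtain s e where "0 < e" "cball s e \<subseteq> I" using assms(5) unfolding mem_interior_cball ex_in_conv[symmetric] by blast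
  then have "measure lebesgue (cball s e) \<le> measure lebesgue I"
    using I by (intro measure_mono_fmeasurable) auto
  moreover have "0 < measure lebesgue (cball s e)" using \<open>0 < e\<close> by (simp add: cball_eq_atLeastAtMost)
  ultimately have mI: "0 < measure lebesgue I" by linarith
  have d: "0 < diameter \<Omega>"
  proof -
    obtain x where "x \<in> \<Omega>" using \<Omega> by blast
    then obtain e where e: "0 < e" "cball x e \<subseteq> \<Omega>" using \<Omega>(1) open_contains_cball by blast
    have "diameter (cball x e) \<le> diameter \<Omega>" using e(2) assms(1) by (rule diameter_subset)
    moreover have "diameter (cball x e) = 2 * e" using e(1) by simp
    ultimately show ?thesis using e(1) by linarith
  qed
  have "cylinder_domain (I \<times> \<Omega>) (min (measure lebesgue I powr (1/2)) (diameter \<Omega>)) \<kappa>"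
  proof
    show "bounded (I \<times> \<Omega>)" using assms by (intro bounded_Times)
    have "I \<in> sets borel" using assms(4) by (rule real_interval_borel_measurable)
    then have "I \<times> \<Omega> \<in> sets lborel" using borel_Times[of I \<Omega>] borel_open[OF \<Omega>(1)] by simp
    then show "I \<times> \<Omega> \<in> sets lebesgue" by (rule sets_completionI_sets)
    show "0 < min (measure lebesgue I powr (1/2)) (diameter \<Omega>)" using mI d by simp
  qed (use \<kappa> box in auto)
  then show ?thesis by blast
qed

theorem theorem2p1:
  fixes \<Omega> :: "'a::euclidean_space set" and I :: "real set" and \<beta> r0 :: real
  assumes "bounded \<Omega>" and "lipschitz_domain \<Omega>"
    and "bounded I" and "is_interval I" and "interior I \<noteq> {}"
    and "r0 = min (measure lebesgue I powr (1/2)) (diameter \<Omega>)"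
    and "0 < \<beta>" and "\<beta> \<le> 1"
  shows
    "((\<forall>u. square_integrable (I \<times> \<Omega>) u \<longrightarrow>
         (\<exists>v\<in>holder_space \<beta> I \<Omega>. ae_equal_on (I \<times> \<Omega>) u v) \<longleftrightarrow>
         (\<exists>C>0. campanato_bound constant_polys \<beta> r0 (I \<times> \<Omega>) u C)) \<and>
      (\<exists>K>0. \<forall>u. \<forall>v\<in>holder_space \<beta> I \<Omega>.
         square_integrable (I \<times> \<Omega>) u \<and> ae_equal_on (I \<times> \<Omega>) u v \<longrightarrow>
         (let Cmin = (LEAST C. campanato_bound constant_polys \<beta> r0 (I \<times> \<Omega>) u C);
              N = holder_norm \<beta> I \<Omega> v
          in ereal (L2_norm_sq (I \<times> \<Omega>) u + Cmin) \<le> ereal K * N\<^sup>2 \<and>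
             N\<^sup>2 \<le> ereal K * ereal (L2_norm_sq (I \<times> \<Omega>) u + Cmin))))
     \<and>
     ((\<forall>u. square_integrable (I \<times> \<Omega>) u \<longrightarrow>
         (\<exists>v\<in>holder1_space \<beta> I \<Omega>. ae_equal_on (I \<times> \<Omega>) u v) \<longleftrightarrow>
         (\<exists>C>0. campanato_bound affine_polys (1 + \<beta>) r0 (I \<times> \<Omega>) u C)) \<and>
      (\<exists>K>0. \<forall>u. \<forall>v\<in>holder1_space \<beta> I \<Omega>.
         square_integrable (I \<times> \<Omega>) u \<and> ae_equal_on (I \<times> \<Omega>) u v \<longrightarrow>
         (let Cmin = (LEAST C. campanato_bound affine_polys (1 + \<beta>) r0 (I \<times> \<Omega>) u C);
              N = holder1_norm \<beta> I \<Omega> v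
          in ereal (L2_norm_sq (I \<times> \<Omega>) u + Cmin) \<le> ereal K * N\<^sup>2 \<and>
             N\<^sup>2 \<le> ereal K * ereal (L2_norm_sq (I \<times> \<Omega>) u + Cmin))))"
proof -
  obtain \<kappa> where dom: "cylinder_domain (I \<times> \<Omega>) r0 \<kappa>"
    using lipschitz_cylinder_domain[OF assms(1-5)] assms(6) by blast
  obtain \<epsilon> where \<epsilon>: "0 < \<epsilon>" "\<And>x. x \<in> closure \<Omega> \<Longrightarrow> short_paths_upto \<Omega> \<epsilon> x"
    using lipschitz_domain_uniform_geometry[OF assms(2,1)] by blast
  have \<Omega>: "open \<Omega>" "\<Omega> \<noteq> {}" using assms(2) by (auto simp: lipschitz_domain_def)
  moreover have "I \<noteq> {}" using assms(5) by auto
  ultimately have ne: "I \<times> \<Omega> \<noteq> {}" by blast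
  show ?thesis
    by (intro conjI[of "_ \<and> _" "_ \<and> _"] holder_campanato_equivalence[OF dom ne assms(7)]
        holder1_campanato_equivalence[OF dom ne assms(7,8) \<Omega>(1) \<epsilon>])
qed

end
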